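(* Let $L>0$, $D_1>0$, $h\ge0$, and let $\lambda_1$ be the first eigenvalue of $-\frac{d^2}{dx^2}$ on $(0,L)$ with homogeneous Dirichlet boundary conditions. Some solutions of the one-dimensional backward problem $$\partial_tA+A+\partial_x^2A-\phi^2A=|A|^2A,\qquad \partial_t\phi+D_1\partial_x^2\phi-h\phi+|A|^2\phi=0,\qquad x\in(0,L),\ t>0,$$ $$A|_{x=0}=A|_{x=L}=\phi|_{x=0}=\phi|_{x=L}=0,\qquad A|_{t=0}=A_0,\quad \phi|_{t=0}=\phi_0,$$ with $A$ complex valued and $\phi$ real valued, blow up in finite time. In fact, let $[A,\phi]$ be a local solution of this problem corresponding to the initial data $[A_0,\phi_0]$. Then $\Psi(t):=\|A(t)\|^2$ satisfies $$\Psi'(t)\ge -2\Psi(t)+2\lambda_1\Psi(t)+2L^{-1}\Psi^2(t),$$ and if $$\Psi_0:=\Psi(0)=\|A_0\|^2>(1-\lambda_1)L,$$ then $\Psi(t)$ tends to infinity in a finite time $$T_0\le\int_{\Psi_0}^{\infty}\frac{ds}{2\left(L^{-1}s^2+(\lambda_1-1)s\right)},$$ i.e., the solution of the problem blows up in finite time.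
   Context: $\|\cdot\|$ denotes the norm of $L^2(0,L)$. A local solution is a solution of the problem on some time interval starting at $t=0$.
   Formalization: Added: Ψ(0)>0 (zero data with λ₁>1 gives the global zero solution) and, only for Ψ→∞, that the solution is maximal and does not end at a finite time with Ψ bounded (a time-reversed rough L² profile does). That the lifetime is at most the integral holds without the latter. *)

theory Defs
  imports "HOL-Analysis.Analysis"
begin

definition dirichlet_eigenvalue :: "real \<Rightarrow> real \<Rightarrow> bool" where
  "dirichlet_eigenvalue L \<mu> \<longleftrightarrow>
     (\<exists>u u'. (\<forall>x\<in>{0..L}. (u has_real_derivative u' x) (at x within {0..L}))
           \<and> (\<forall>x\<in>{0..L}. (u' has_real_derivative (- (\<mu> * u x))) (at x within {0..L}))
           \<and> u 0 = 0 \<and> u L = 0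
           \<and> (\<exists>x\<in>{0..L}. u x \<noteq> 0))"

definition first_dirichlet_eigenvalue :: "real \<Rightarrow> real" where
  "first_dirichlet_eigenvalue L = (LEAST \<mu>. dirichlet_eigenvalue L \<mu>)"

definition in_L2 :: "real \<Rightarrow> (real \<Rightarrow> 'a::{banach,second_countable_topology}) \<Rightarrow> bool" where
  "in_L2 L f \<longleftrightarrow> set_borel_measurable lebesgue {0<..<L} f
     \<and> set_integrable lebesgue {0<..<L} (\<lambda>x. (norm (f x))\<^sup>2)"

definition L2norm :: "real \<Rightarrow> (real \<Rightarrow> 'a::{banach,second_countable_topology}) \<Rightarrow> real" where
  "L2norm L f = sqrt (LINT x:{0<..<L}|lebesgue. (norm (f x))\<^sup>2)"

(* Time comes first: u t x. The interval of existence is [0,T) with T possibly infinite.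
   C12_derivs says that u is of class C^{1,2} on (0,T) x [0,L], with u_t = ut, u_x = ux,
   u_xx = uxx (one-sided in x at the end points). *)
definition C12_derivs :: "real \<Rightarrow> ereal \<Rightarrow> (real \<Rightarrow> real \<Rightarrow> 'a::real_normed_vector) \<Rightarrow>
    (real \<Rightarrow> real \<Rightarrow> 'a) \<Rightarrow> (real \<Rightarrow> real \<Rightarrow> 'a) \<Rightarrow> (real \<Rightarrow> real \<Rightarrow> 'a) \<Rightarrow> bool" where
  "C12_derivs L T u ut ux uxx \<longleftrightarrow>
     (\<forall>t x. 0 < t \<and> ereal t < T \<and> x \<in> {0..L} \<longrightarrow>
          ((\<lambda>s. u s x) has_vector_derivative ut t x) (at t)
        \<and> ((\<lambda>y. u t y) has_vector_derivative ux t x) (at x within {0..L})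
        \<and> ((\<lambda>y. ux t y) has_vector_derivative uxx t x) (at x within {0..L}))
   \<and> (\<forall>v\<in>{u, ut, ux, uxx}.
        continuous_on ({t. 0 < t \<and> ereal t < T} \<times> {0..L}) (\<lambda>(t, x). v t x))"

(* A local solution on [0,T): classical for t > 0, with square integrable initial data that are
   attained in the L^2 norm. No smoothness is assumed at t = 0. *)
definition local_solution :: "real \<Rightarrow> real \<Rightarrow> real \<Rightarrow> ereal \<Rightarrow>
    (real \<Rightarrow> complex) \<Rightarrow> (real \<Rightarrow> real) \<Rightarrow>
    (real \<Rightarrow> real \<Rightarrow> complex) \<Rightarrow> (real \<Rightarrow> real \<Rightarrow> real) \<Rightarrow> bool" where
  "local_solution L D1 h T A0 \<phi>0 A \<phi> \<longleftrightarrow>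
     0 < T \<and> in_L2 L A0 \<and> in_L2 L \<phi>0
   \<and> (\<exists>At Ax Axx \<phi>t \<phi>x \<phi>xx.
        C12_derivs L T A At Ax Axx \<and> C12_derivs L T \<phi> \<phi>t \<phi>x \<phi>xx
      \<and> (\<forall>t x. 0 < t \<and> ereal t < T \<and> x \<in> {0<..<L} \<longrightarrow>
            At t x + A t x + Axx t x - complex_of_real ((\<phi> t x)\<^sup>2) * A t x
              = complex_of_real ((cmod (A t x))\<^sup>2) * A t x
          \<and> \<phi>t t x + D1 * \<phi>xx t x - h * \<phi> t x + (cmod (A t x))\<^sup>2 * \<phi> t x = 0))
   \<and> (\<forall>t. 0 < t \<and> ereal t < T \<longrightarrow> A t 0 = 0 \<and> A t L = 0 \<and> \<phi> t 0 = 0 \<and> \<phi> t L = 0)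
   \<and> (\<forall>x\<in>{0<..<L}. A 0 x = A0 x \<and> \<phi> 0 x = \<phi>0 x)
   \<and> ((\<lambda>t. L2norm L (\<lambda>x. A t x - A0 x)) \<longlongrightarrow> 0) (at_right 0)
   \<and> ((\<lambda>t. L2norm L (\<lambda>x. \<phi> t x - \<phi>0 x)) \<longlongrightarrow> 0) (at_right 0)"

definition Psi :: "real \<Rightarrow> (real \<Rightarrow> real \<Rightarrow> complex) \<Rightarrow> real \<Rightarrow> real" where
  "Psi L A t = (L2norm L (A t))\<^sup>2"

definition extendible :: "real \<Rightarrow> real \<Rightarrow> real \<Rightarrow> ereal \<Rightarrow>
    (real \<Rightarrow> complex) \<Rightarrow> (real \<Rightarrow> real) \<Rightarrow>
    (real \<Rightarrow> real \<Rightarrow> complex) \<Rightarrow> (real \<Rightarrow> real \<Rightarrow> real) \<Rightarrow> bool" where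
  "extendible L D1 h T A0 \<phi>0 A \<phi> \<longleftrightarrow>
     (\<exists>T' A' \<phi>'. T < T' \<and> local_solution L D1 h T' A0 \<phi>0 A' \<phi>'
        \<and> (\<forall>t x. 0 \<le> t \<and> ereal t < T \<and> x \<in> {0<..<L} \<longrightarrow> A' t x = A t x \<and> \<phi>' t x = \<phi> t x))"

(* The solution lives on its maximal interval [0,T) and does not stop at a finite time while
   Psi stays bounded. For the (ill-posed) backward problem the second part is a
   property of the individual solution: the time reversal of a forward solution that starts from
   a non-smooth square integrable profile is maximal, but its L^2 norm stays bounded. *)
definition maximal_with_continuation :: "real \<Rightarrow> real \<Rightarrow> real \<Rightarrow> ereal \<Rightarrow>
    (real \<Rightarrow> complex) \<Rightarrow> (real \<Rightarrow> real) \<Rightarrow>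
    (real \<Rightarrow> real \<Rightarrow> complex) \<Rightarrow> (real \<Rightarrow> real \<Rightarrow> real) \<Rightarrow> bool" where
  "maximal_with_continuation L D1 h T A0 \<phi>0 A \<phi> \<longleftrightarrow>
     local_solution L D1 h T A0 \<phi>0 A \<phi>
   \<and> \<not> extendible L D1 h T A0 \<phi>0 A \<phi>
   \<and> (T < \<infinity> \<and> bdd_above (Psi L A ` {t. 0 \<le> t \<and> ereal t < T})
        \<longrightarrow> extendible L D1 h T A0 \<phi>0 A \<phi>)"

definition blows_up_at :: "real \<Rightarrow> (real \<Rightarrow> real \<Rightarrow> complex) \<Rightarrow> real \<Rightarrow> bool" where
  "blows_up_at L A T0 \<longleftrightarrow> filterlim (Psi L A) at_top (at_left T0)"

definition blowup_integrand :: "real \<Rightarrow> real \<Rightarrow> real \<Rightarrow> real" where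
  "blowup_integrand L lam s = 1 / (2 * (s\<^sup>2 / L + (lam - 1) * s))"

end

theory Submission
  imports Defs
begin

text \<open>
The first eigenvalue is \<open>(pi / L)\<^sup>2\<close>, because Wirtinger's inequality has this constant
(\<open>wirtinger\<close>, \<open>first_dirichlet_eigenvalue_eq\<close>). Multiplying the equation for \<open>A\<close> by the conjugate of \<open>A\<close>, integrating,
and using Wirtinger for \<open>A\<^sub>x\<close> and the Cauchy-Schwarz inequality for \<open>\<bar>A\<bar>\<^sup>4\<close> gives the differential inequality for
\<open>\<Psi>\<close> (\<open>Psi_derivative_ge\<close>). It is of Riccati type: above the zeros of its right-hand side \<open>\<Psi>\<close> increases, and separation
of variables bounds the lifetime by the convergent integral (\<open>riccati_blowup\<close>). When the solution
cannot end while \<open>\<Psi>\<close> is bounded, monotonicity turns unboundedness into divergence to infinity.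

That blow-up does occur needs an actual solution, although the backward problem is ill posed. Put
\<open>\<phi> = 0\<close> and reverse time: what is wanted is a solution of the well-posed forward equation
\<open>B\<^sub>t = B\<^sub>x\<^sub>x + B - B\<^sup>3\<close> that is smooth for positive times but whose \<open>L\<^sup>2\<close> norm tends to infinity as time
decreases to zero. Such a solution starts from data just outside \<open>L\<^sup>2\<close>, with sine coefficients
\<open>n powr (-1/2)\<close>. These data are subcritical for the cubic equation: the linear evolution is bounded by a multiple of
\<open>t powr (-3/10)\<close>, whose cube \<open>t powr (-9/10)\<close> is integrable in time, and the nonlinear part of the solution
therefore tends to zero coefficientwise. The construction is a Picard iteration on the Fourier coefficients
(\<open>fixed_point_exists\<close>), in a weighted sequence space that is an algebra under convolution (\<open>conv_bound\<close>) and whose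
exponential weight makes the solution analytic in space at once. By Bessel's inequality (\<open>bessel_sine\<close>) the
squared norm is eventually above each partial sum of a multiple of the harmonic series
(\<open>singular_heat_solution\<close>).
\<close>

section \<open>The first Dirichlet eigenvalue\<close>

text \<open>The function \<open>\<psi> = k tan (k (x - L/2))\<close> solves the Riccati equation \<open>\<psi>' = k\<^sup>2 + \<psi>\<^sup>2\<close>, so that
\<open>u'\<^sup>2 - k\<^sup>2 u\<^sup>2 = (u' + \<psi> u)\<^sup>2 - (\<psi> u\<^sup>2)'\<close>, and the last term integrates to zero. Staying strictly below
\<open>pi / L\<close> keeps the poles of \<open>\<psi>\<close> off the closed interval; the sharp constant is a limit.\<close>

lemma wirtinger_aux:
  fixes u u' :: "real \<Rightarrow> real"
  assumes L: "L > 0" and k: "0 < k" "k < pi / L"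
    and der: "\<And>x. x \<in> {0..L} \<Longrightarrow> (u has_real_derivative u' x) (at x within {0..L})"
    and cont: "continuous_on {0..L} u'"
    and bc: "u 0 = 0" "u L = 0"
  shows "k\<^sup>2 * integral {0..L} (\<lambda>x. (u x)\<^sup>2) \<le> integral {0..L} (\<lambda>x. (u' x)\<^sup>2)"
proof -
  define \<psi> where "\<psi> x = k * tan (k * (x - L / 2))" for x
  have contu: "continuous_on {0..L} u"
    using der by (meson DERIV_continuous_on)
  have cos: "cos (k * (x - L / 2)) > 0" if "x \<in> {0..L}" for x
  proof (rule cos_gt_zero_pi)
    have kL: "k * L < pi" using k L by (simp add: field_simps)
    have "k * (- (L / 2)) \<le> k * (x - L / 2)" "k * (x - L / 2) \<le> k * (L / 2)"
      by (rule mult_left_mono; use that k in auto)+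
    then show "- (pi / 2) < k * (x - L / 2)" "k * (x - L / 2) < pi / 2"
      using kL by (auto simp: algebra_simps)
  qed
  have cont\<psi>: "continuous_on {0..L} \<psi>"
    unfolding \<psi>_def using cos by (intro continuous_intros) force
  have der\<psi>: "(\<psi> has_real_derivative k\<^sup>2 + (\<psi> x)\<^sup>2) (at x within {0..L})" if "x \<in> {0..L}" for x
  proof -
    have c: "cos (k * (x - L / 2)) \<noteq> 0" using cos[OF that] by simp
    have "inverse ((cos (k * (x - L / 2)))\<^sup>2) = 1 + (tan (k * (x - L / 2)))\<^sup>2"
      using c by (simp add: tan_sec power_inverse)
    then show ?thesis
      unfolding \<psi>_def using c
      by (auto intro!: derivative_eq_intros simp: power2_eq_square algebra_simps)
  qed
  have "((\<lambda>x. (k\<^sup>2 + (\<psi> x)\<^sup>2) * (u x)\<^sup>2 + \<psi> x * (2 * u x * u' x)) has_integral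
      \<psi> L * (u L)\<^sup>2 - \<psi> 0 * (u 0)\<^sup>2) {0..L}"
    using L der der\<psi>
    by (intro fundamental_theorem_of_calculus)
       (auto intro!: derivative_eq_intros simp: has_real_derivative_iff_has_vector_derivative[symmetric])
  then have 0: "integral {0..L} (\<lambda>x. (k\<^sup>2 + (\<psi> x)\<^sup>2) * (u x)\<^sup>2 + \<psi> x * (2 * u x * u' x)) = 0"
    using bc by (simp add: has_integral_iff)
  have "0 \<le> integral {0..L} (\<lambda>x. (u' x + \<psi> x * u x)\<^sup>2)"
    by (intro integral_nonneg integrable_continuous_real continuous_intros cont contu cont\<psi>) auto
  also have "(\<lambda>x. (u' x + \<psi> x * u x)\<^sup>2) = (\<lambda>x. ((u' x)\<^sup>2 - k\<^sup>2 * (u x)\<^sup>2)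
      + ((k\<^sup>2 + (\<psi> x)\<^sup>2) * (u x)\<^sup>2 + \<psi> x * (2 * u x * u' x)))"
    by (auto simp: power2_eq_square algebra_simps)
  also have "integral {0..L} \<dots> = integral {0..L} (\<lambda>x. (u' x)\<^sup>2 - k\<^sup>2 * (u x)\<^sup>2) + 0"
    by (subst integral_add)
       (auto simp: 0 intro!: integrable_continuous_real continuous_intros cont contu cont\<psi>)
  also have "\<dots> = integral {0..L} (\<lambda>x. (u' x)\<^sup>2) - k\<^sup>2 * integral {0..L} (\<lambda>x. (u x)\<^sup>2)"
    by (subst integral_diff)
       (auto intro!: integrable_continuous_real continuous_intros cont contu)
  finally show ?thesis by simp
qed

lemma wirtinger:
  fixes u u' :: "real \<Rightarrow> real"
  assumes L: "L > 0"
    and der: "\<And>x. x \<in> {0..L} \<Longrightarrow> (u has_real_derivative u' x) (at x within {0..L})"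
    and cont: "continuous_on {0..L} u'"
    and bc: "u 0 = 0" "u L = 0"
  shows "(pi / L)\<^sup>2 * integral {0..L} (\<lambda>x. (u x)\<^sup>2) \<le> integral {0..L} (\<lambda>x. (u' x)\<^sup>2)"
proof (rule tendsto_upperbound)
  show "((\<lambda>k. k\<^sup>2 * integral {0..L} (\<lambda>x. (u x)\<^sup>2)) \<longlongrightarrow>
      (pi / L)\<^sup>2 * integral {0..L} (\<lambda>x. (u x)\<^sup>2)) (at_left (pi / L))"
    by (intro tendsto_intros)
  have "\<forall>\<^sub>F k in at_left (pi / L). k \<in> {0<..<pi / L}"
    using L by (intro eventually_at_leftI[of 0]) auto
  then show "\<forall>\<^sub>F k in at_left (pi / L).
      k\<^sup>2 * integral {0..L} (\<lambda>x. (u x)\<^sup>2) \<le> integral {0..L} (\<lambda>x. (u' x)\<^sup>2)"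
    by eventually_elim (rule wirtinger_aux[OF L _ _ der cont bc]; simp)
qed simp

lemma wirtinger_complex:
  fixes u u' :: "real \<Rightarrow> complex"
  assumes L: "L > 0"
    and der: "\<And>x. x \<in> {0..L} \<Longrightarrow> (u has_vector_derivative u' x) (at x within {0..L})"
    and cont: "continuous_on {0..L} u'"
    and bc: "u 0 = 0" "u L = 0"
  shows "(pi / L)\<^sup>2 * integral {0..L} (\<lambda>x. (cmod (u x))\<^sup>2) \<le> integral {0..L} (\<lambda>x. (cmod (u' x))\<^sup>2)"
proof -
  have contu: "continuous_on {0..L} u"
    using der by (meson continuous_on_vector_derivative)
  have split: "integral {0..L} (\<lambda>x. (cmod (v x))\<^sup>2)
      = integral {0..L} (\<lambda>x. (Re (v x))\<^sup>2) + integral {0..L} (\<lambda>x. (Im (v x))\<^sup>2)"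
    if "continuous_on {0..L} v" for v
    unfolding cmod_power2
    by (intro integral_add integrable_continuous_real continuous_intros that)
  have re: "((\<lambda>x. Re (u x)) has_real_derivative Re (u' x)) (at x within {0..L})"
    and im: "((\<lambda>x. Im (u x)) has_real_derivative Im (u' x)) (at x within {0..L})"
    if "x \<in> {0..L}" for x
    using der[OF that]
    by (auto simp: has_vector_derivative_complex_iff)
  have "(pi / L)\<^sup>2 * integral {0..L} (\<lambda>x. (Re (u x))\<^sup>2) \<le> integral {0..L} (\<lambda>x. (Re (u' x))\<^sup>2)"
    by (intro wirtinger L re continuous_intros cont) (auto simp: bc)
  moreover have "(pi / L)\<^sup>2 * integral {0..L} (\<lambda>x. (Im (u x))\<^sup>2) \<le> integral {0..L} (\<lambda>x. (Im (u' x))\<^sup>2)"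
    by (intro wirtinger L im continuous_intros cont) (auto simp: bc)
  ultimately show ?thesis
    by (simp add: split[OF cont] split[OF contu] algebra_simps)
qed

text \<open>An eigenfunction satisfies \<open>(u u')' = u'\<^sup>2 - \<mu> u\<^sup>2\<close>, whose integral vanishes; hence Wirtinger's inequality
is exactly the statement that no eigenvalue lies below the one of the sine.\<close>

lemma first_dirichlet_eigenvalue_eq:
  assumes L: "L > 0"
  shows "first_dirichlet_eigenvalue L = (pi / L)\<^sup>2"
  unfolding first_dirichlet_eigenvalue_def
proof (rule Least_equality)
  show "dirichlet_eigenvalue L ((pi / L)\<^sup>2)"
    unfolding dirichlet_eigenvalue_def
  proof (intro exI conjI ballI)
    fix x
    show "((\<lambda>x. sin (pi / L * x)) has_real_derivative pi / L * cos (pi / L * x)) (at x within {0..L})"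
      using L by (auto intro!: derivative_eq_intros)
    show "((\<lambda>x. pi / L * cos (pi / L * x)) has_real_derivative - ((pi / L)\<^sup>2 * sin (pi / L * x)))
        (at x within {0..L})"
      using L by (auto intro!: derivative_eq_intros simp: power2_eq_square)
  next
    show "\<exists>x\<in>{0..L}. sin (pi / L * x) \<noteq> 0"
      by (intro bexI[of _ "L / 2"]) (use L in auto)
  next
    show "sin (pi / L * 0) = 0" by simp
    show "sin (pi / L * L) = 0" using L by simp
  qed
next
  fix \<mu> assume "dirichlet_eigenvalue L \<mu>"
  then obtain u u' where
    u: "\<And>x. x\<in>{0..L} \<Longrightarrow> (u has_real_derivative u' x) (at x within {0..L})"
    and u': "\<And>x. x\<in>{0..L} \<Longrightarrow> (u' has_real_derivative (- (\<mu> * u x))) (at x within {0..L})"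
    and bc: "u 0 = 0" "u L = 0" and nz: "\<exists>x\<in>{0..L}. u x \<noteq> 0"
    unfolding dirichlet_eigenvalue_def by blast
  have cont: "continuous_on {0..L} u" "continuous_on {0..L} u'"
    using u u' by (meson DERIV_continuous_on)+
  have "((\<lambda>x. (u' x)\<^sup>2 - \<mu> * (u x)\<^sup>2) has_integral u L * u' L - u 0 * u' 0) {0..L}"
    using L u u' by (intro fundamental_theorem_of_calculus)
      (auto intro!: derivative_eq_intros
        simp: has_real_derivative_iff_has_vector_derivative[symmetric] power2_eq_square)
  then have "integral {0..L} (\<lambda>x. (u' x)\<^sup>2 - \<mu> * (u x)\<^sup>2) = 0"
    using bc by (simp add: has_integral_iff)
  then have eq: "integral {0..L} (\<lambda>x. (u' x)\<^sup>2) = \<mu> * integral {0..L} (\<lambda>x. (u x)\<^sup>2)"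
    by (subst (asm) integral_diff)
       (auto intro!: integrable_continuous_real continuous_intros cont)
  have "integral {0..L} (\<lambda>x. (u x)\<^sup>2) \<noteq> 0"
    using nz L by (subst integral_eq_0_iff) (auto intro!: continuous_intros cont)
  moreover have "integral {0..L} (\<lambda>x. (u x)\<^sup>2) \<ge> 0"
    by (intro integral_nonneg integrable_continuous_real continuous_intros cont) auto
  ultimately have "integral {0..L} (\<lambda>x. (u x)\<^sup>2) > 0" by simp
  with wirtinger[OF L u cont(2) bc] eq show "(pi / L)\<^sup>2 \<le> \<mu>"
    by (simp add: mult_le_cancel_right)
qed

section \<open>The differential inequality for the squared norm\<close>

lemma set_integral_continuous_interior:
  fixes f :: "real \<Rightarrow> real"
  assumes "continuous_on {0..L} f"
  shows "set_integrable lebesgue {0<..<L} f"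
    and "(LINT x:{0<..<L}|lebesgue. f x) = integral {0..L} f"
proof -
  have "f absolutely_integrable_on {0..L}"
    using assms by (rule absolutely_integrable_continuous_real)
  then show *: "set_integrable lebesgue {0<..<L} f"
    by (rule set_integrable_subset) auto
  show "(LINT x:{0<..<L}|lebesgue. f x) = integral {0..L} f"
    using set_lebesgue_integral_eq_integral(2)[OF *] by (simp add: integral_open_interval_real)
qed

lemma Psi_eq_integral:
  assumes "continuous_on {0..L} (A t)"
  shows "Psi L A t = integral {0..L} (\<lambda>x. (cmod (A t x))\<^sup>2)"
proof -
  have "continuous_on {0..L} (\<lambda>x. (cmod (A t x))\<^sup>2)"
    by (intro continuous_intros assms)
  moreover from this have "0 \<le> integral {0..L} (\<lambda>x. (cmod (A t x))\<^sup>2)"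
    by (intro integral_nonneg integrable_continuous_real) auto
  ultimately show ?thesis
    by (simp add: Psi_def L2norm_def set_integral_continuous_interior(2))
qed

text \<open>The left-hand side falls short of the right-hand one by the integral of the squared deviation of
\<open>f\<close> from its mean.\<close>

lemma square_integral_le:
  fixes f :: "real \<Rightarrow> real"
  assumes "L > 0" and cont: "continuous_on {0..L} f"
  shows "(integral {0..L} f)\<^sup>2 / L \<le> integral {0..L} (\<lambda>x. (f x)\<^sup>2)"
proof -
  define m where "m = integral {0..L} f / L"
  have "0 \<le> integral {0..L} (\<lambda>x. (f x - m)\<^sup>2)"
    by (intro integral_nonneg integrable_continuous_real continuous_intros cont) auto
  also have "(\<lambda>x. (f x - m)\<^sup>2) = (\<lambda>x. ((f x)\<^sup>2 - 2 * m * f x) + m\<^sup>2)"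
    by (auto simp: power2_eq_square algebra_simps)
  also have "integral {0..L} \<dots> = integral {0..L} (\<lambda>x. (f x)\<^sup>2) - 2 * m * integral {0..L} f + m\<^sup>2 * L"
  proof -
    have int: "(\<lambda>x. (f x)\<^sup>2) integrable_on {0..L}" "(\<lambda>x. 2 * m * f x) integrable_on {0..L}"
      "(\<lambda>x. m\<^sup>2) integrable_on {0..L}"
      by (intro integrable_continuous_real continuous_intros cont)+
    then have "integral {0..L} (\<lambda>x. ((f x)\<^sup>2 - 2 * m * f x) + m\<^sup>2)
        = integral {0..L} (\<lambda>x. (f x)\<^sup>2) - integral {0..L} (\<lambda>x. 2 * m * f x) + integral {0..L} (\<lambda>x. m\<^sup>2)"
      by (simp only: integral_add integral_diff integrable_diff)
    then show ?thesis using assms by simp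
  qed
  also have "\<dots> = integral {0..L} (\<lambda>x. (f x)\<^sup>2) - (integral {0..L} f)\<^sup>2 / L"
    using assms by (simp add: m_def power2_eq_square field_simps)
  finally show ?thesis by simp
qed

lemma C12_derivsD:
  assumes "C12_derivs L T u ut ux uxx" "0 < t" "ereal t < T"
  shows "\<And>x. x \<in> {0..L} \<Longrightarrow> ((\<lambda>s. u s x) has_vector_derivative ut t x) (at t)"
    and "\<And>x. x \<in> {0..L} \<Longrightarrow> (u t has_vector_derivative ux t x) (at x within {0..L})"
    and "\<And>x. x \<in> {0..L} \<Longrightarrow> (ux t has_vector_derivative uxx t x) (at x within {0..L})"
    and "continuous_on {0..L} (u t)" "continuous_on {0..L} (ut t)"
    and "continuous_on {0..L} (ux t)" "continuous_on {0..L} (uxx t)"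
proof -
  have "continuous_on {0..L} (v t)" if "v \<in> {u, ut, ux, uxx}" for v
  proof -
    have "continuous_on ({t. 0 < t \<and> ereal t < T} \<times> {0..L}) (\<lambda>(t, x). v t x)"
      using assms(1) that unfolding C12_derivs_def by blast
    then have "continuous_on {0..L} (\<lambda>x. (\<lambda>(t, x). v t x) (t, x))"
      by (rule continuous_on_compose2) (use assms in \<open>auto intro!: continuous_intros\<close>)
    then show ?thesis by simp
  qed
  then show "continuous_on {0..L} (u t)" "continuous_on {0..L} (ut t)"
    "continuous_on {0..L} (ux t)" "continuous_on {0..L} (uxx t)" by auto
qed (use assms in \<open>auto simp: C12_derivs_def\<close>)

lemma Psi_has_derivative:
  assumes C: "C12_derivs L T A At Ax Axx" and t: "0 < t" "ereal t < T"
  shows "(Psi L A has_real_derivative integral {0..L} (\<lambda>x. 2 * (A t x \<bullet> At t x))) (at t)"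
proof -
  obtain b where b: "ereal t < ereal b" "ereal b < T"
    using ereal_dense2[OF t(2)] by auto
  define U where "U = {0<..<b}"
  have U: "t \<in> U" "open U" "convex U"
    using b t by (auto simp: U_def)
  have sub: "0 < s \<and> ereal s < T" if "s \<in> U" for s
    using that b by (auto simp: U_def intro: less_trans[of "ereal s" "ereal b" T])
  have cont: "continuous_on (U \<times> {0..L}) (\<lambda>(t, x). v t x)" if "v \<in> {A, At, Ax, Axx}" for v
    using C that sub unfolding C12_derivs_def
    by (auto elim!: continuous_on_subset)
  have "((\<lambda>s. integral (cbox 0 L) (\<lambda>x. (cmod (A s x))\<^sup>2)) has_real_derivative
      integral (cbox 0 L) (\<lambda>x. 2 * (A t x \<bullet> At t x))) (at t within U)"
  proof (rule leibniz_rule_field_derivative[OF _ _ _ U(1,3)])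
    fix s x assume sx: "s \<in> U" "x \<in> cbox 0 L"
    have "((\<lambda>s. A s x) has_vector_derivative At s x) (at s within U)"
      using C12_derivsD(1)[OF C, of s x] sub[OF sx(1)] sx
      by (auto intro: has_vector_derivative_at_within)
    from bounded_bilinear.has_vector_derivative[OF bounded_bilinear_inner this this]
    show "((\<lambda>s. (cmod (A s x))\<^sup>2) has_real_derivative 2 * (A s x \<bullet> At s x)) (at s within U)"
      by (simp add: has_real_derivative_iff_has_vector_derivative power2_norm_eq_inner inner_commute)
  next
    fix s assume "s \<in> U"
    then show "(\<lambda>x. (cmod (A s x))\<^sup>2) integrable_on cbox 0 L"
      using C12_derivsD(4)[OF C, of s] sub[of s]
      by (auto intro!: integrable_continuous_real continuous_intros)
  next
    show "continuous_on (U \<times> cbox 0 L) (\<lambda>(t, x). 2 * (A t x \<bullet> At t x))"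
      using cont[of A] cont[of At] by (auto simp: case_prod_unfold intro!: continuous_intros)
  qed
  then have "((\<lambda>s. integral {0..L} (\<lambda>x. (cmod (A s x))\<^sup>2)) has_real_derivative
      integral {0..L} (\<lambda>x. 2 * (A t x \<bullet> At t x))) (at t)"
    by (simp add: at_within_open[OF U(1,2)])
  then show ?thesis
  proof (rule has_field_derivative_transform_within_open[OF _ U(2,1)])
    fix s assume "s \<in> U"
    then show "integral {0..L} (\<lambda>x. (cmod (A s x))\<^sup>2) = Psi L A s"
      using Psi_eq_integral[of L A s] C12_derivsD(4)[OF C, of s] sub[of s] by simp
  qed
qed

text \<open>Take the real inner product of the equation with \<open>A\<close>. The second derivative gives \<open>\<integral>\<bar>A\<^sub>x\<bar>\<^sup>2\<close>, to which
Wirtinger applies; the coupling term \<open>\<phi>\<^sup>2 \<bar>A\<bar>\<^sup>2\<close> is nonnegative; the quartic term dominates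
\<open>\<Psi>\<^sup>2 / L\<close>.\<close>

lemma Psi_derivative_ge:
  assumes L: "L > 0" and C: "C12_derivs L T A At Ax Axx" and C\<phi>: "C12_derivs L T \<phi> \<phi>t \<phi>x \<phi>xx"
    and t: "0 < t" "ereal t < T"
    and pde: "\<And>x. x \<in> {0<..<L} \<Longrightarrow>
        At t x + A t x + Axx t x - complex_of_real ((\<phi> t x)\<^sup>2) * A t x
          = complex_of_real ((cmod (A t x))\<^sup>2) * A t x"
    and bc: "A t 0 = 0" "A t L = 0"
  shows "integral {0..L} (\<lambda>x. 2 * (A t x \<bullet> At t x))
    \<ge> - 2 * Psi L A t + 2 * (pi / L)\<^sup>2 * Psi L A t + 2 / L * (Psi L A t)\<^sup>2"
proof -
  note D = C12_derivsD[OF C t]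
  note cont = D(4-7) C12_derivsD(4)[OF C\<phi> t]
  let ?I = "\<lambda>f. integral {0..L} f :: real"
  have "((\<lambda>x. A t x \<bullet> Axx t x + Ax t x \<bullet> Ax t x) has_integral
      A t L \<bullet> Ax t L - A t 0 \<bullet> Ax t 0) {0..L}"
    using L by (intro fundamental_theorem_of_calculus
        bounded_bilinear.has_vector_derivative[OF bounded_bilinear_inner] D) auto
  then have "?I (\<lambda>x. A t x \<bullet> Axx t x + Ax t x \<bullet> Ax t x) = 0"
    using bc by (simp add: has_integral_iff)
  then have parts: "?I (\<lambda>x. A t x \<bullet> Axx t x) = - ?I (\<lambda>x. (cmod (Ax t x))\<^sup>2)"
    by (subst (asm) integral_add)
       (auto simp: power2_norm_eq_inner intro!: integrable_continuous_real continuous_intros cont)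
  have int: "(\<lambda>x. (\<phi> t x)\<^sup>2 * (cmod (A t x))\<^sup>2) integrable_on {0..L}"
    "(\<lambda>x. ((cmod (A t x))\<^sup>2)\<^sup>2) integrable_on {0..L}"
    "(\<lambda>x. (cmod (A t x))\<^sup>2) integrable_on {0..L}"
    "(\<lambda>x. A t x \<bullet> Axx t x) integrable_on {0..L}"
    by (intro integrable_continuous_real continuous_intros cont)+
  have "?I (\<lambda>x. A t x \<bullet> At t x) = ?I (\<lambda>x. ((((\<phi> t x)\<^sup>2 * (cmod (A t x))\<^sup>2) + ((cmod (A t x))\<^sup>2)\<^sup>2)
      - (cmod (A t x))\<^sup>2) - A t x \<bullet> Axx t x)"
  \<comment> \<open>The equation holds in the open interval only.\<close>
  proof (rule integral_spike[of "{0, L}"])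
    fix x assume x: "x \<in> {0..L} - {0, L}"
    have eq: "At t x = (\<phi> t x)\<^sup>2 *\<^sub>R A t x + (cmod (A t x))\<^sup>2 *\<^sub>R A t x - A t x - Axx t x"
      using pde[of x] x by (simp add: scaleR_conv_of_real algebra_simps)
    show "((((\<phi> t x)\<^sup>2 * (cmod (A t x))\<^sup>2) + ((cmod (A t x))\<^sup>2)\<^sup>2)
      - (cmod (A t x))\<^sup>2) - A t x \<bullet> Axx t x = A t x \<bullet> At t x"
      unfolding eq inner_diff_right inner_add_right inner_scaleR_right
      by (simp add: dot_square_norm power2_eq_square)
  qed auto
  also have "\<dots> = ?I (\<lambda>x. (\<phi> t x)\<^sup>2 * (cmod (A t x))\<^sup>2) + ?I (\<lambda>x. ((cmod (A t x))\<^sup>2)\<^sup>2)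
      - ?I (\<lambda>x. (cmod (A t x))\<^sup>2) - ?I (\<lambda>x. A t x \<bullet> Axx t x)"
    by (simp only: integral_add integral_diff integrable_add integrable_diff int)
  finally have eq: "?I (\<lambda>x. A t x \<bullet> At t x) = ?I (\<lambda>x. (\<phi> t x)\<^sup>2 * (cmod (A t x))\<^sup>2)
      + ?I (\<lambda>x. ((cmod (A t x))\<^sup>2)\<^sup>2) - Psi L A t + ?I (\<lambda>x. (cmod (Ax t x))\<^sup>2)"
    by (simp add: parts Psi_eq_integral[of L A t, OF cont(1)])
  have "(Psi L A t)\<^sup>2 / L \<le> ?I (\<lambda>x. ((cmod (A t x))\<^sup>2)\<^sup>2)"
    unfolding Psi_eq_integral[of L A t, OF cont(1)]
    by (intro square_integral_le L continuous_intros cont)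
  moreover have "(pi / L)\<^sup>2 * Psi L A t \<le> ?I (\<lambda>x. (cmod (Ax t x))\<^sup>2)"
    unfolding Psi_eq_integral[of L A t, OF cont(1)]
    by (intro wirtinger_complex L D bc)
  moreover have "0 \<le> ?I (\<lambda>x. (\<phi> t x)\<^sup>2 * (cmod (A t x))\<^sup>2)"
    by (intro integral_nonneg integrable_continuous_real continuous_intros cont) auto
  moreover have "integral {0..L} (\<lambda>x. 2 * (A t x \<bullet> At t x)) = 2 * ?I (\<lambda>x. A t x \<bullet> At t x)"
    by simp
  ultimately show ?thesis
    using eq by (simp only:) (simp add: algebra_simps)
qed

section \<open>Square integrable initial data\<close>

lemma in_L2_continuous:
  fixes f :: "real \<Rightarrow> 'a::euclidean_space"
  assumes "continuous_on {0..L} f"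
  shows "in_L2 L f"
proof -
  have "f absolutely_integrable_on {0..L}"
    using assms by (rule absolutely_integrable_continuous_real)
  then have "set_integrable lebesgue {0<..<L} f"
    by (rule set_integrable_subset) auto
  then have "set_borel_measurable lebesgue {0<..<L} f"
    unfolding set_integrable_def set_borel_measurable_def by (rule borel_measurable_integrable)
  moreover have "set_integrable lebesgue {0<..<L} (\<lambda>x. (norm (f x))\<^sup>2)"
    by (intro set_integral_continuous_interior(1) continuous_intros assms)
  ultimately show ?thesis by (simp add: in_L2_def)
qed

lemma in_L2_diff:
  fixes f g :: "real \<Rightarrow> 'a::euclidean_space"
  assumes "in_L2 L f" "in_L2 L g"
  shows "in_L2 L (\<lambda>x. f x - g x)"
proof -
  have meas: "set_borel_measurable lebesgue {0<..<L} (\<lambda>x. f x - g x)"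
    using assms by (auto simp: in_L2_def set_borel_measurable_def scaleR_right_diff_distrib)
  have "set_integrable lebesgue {0<..<L} (\<lambda>x. 2 * (norm (f x))\<^sup>2 + 2 * (norm (g x))\<^sup>2)"
    using assms by (auto simp: in_L2_def intro!: set_integral_add)
  then have "set_integrable lebesgue {0<..<L} (\<lambda>x. (norm (f x - g x))\<^sup>2)"
  proof (rule set_integrable_bound)
    have "(\<lambda>x. (norm (indicator {0<..<L} x *\<^sub>R (f x - g x)))\<^sup>2) \<in> borel_measurable lebesgue"
      using meas unfolding set_borel_measurable_def by measurable
    also have "(\<lambda>x. (norm (indicator {0<..<L} x *\<^sub>R (f x - g x)))\<^sup>2)
        = (\<lambda>x. indicator {0<..<L} x *\<^sub>R (norm (f x - g x))\<^sup>2)"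
      by (auto simp: indicator_def)
    finally show "set_borel_measurable lebesgue {0<..<L} (\<lambda>x. (norm (f x - g x))\<^sup>2)"
      by (simp add: set_borel_measurable_def)
    have "(norm (f x - g x))\<^sup>2 \<le> 2 * (norm (f x))\<^sup>2 + 2 * (norm (g x))\<^sup>2" for x
    proof -
      have "(norm (f x - g x))\<^sup>2 \<le> (norm (f x) + norm (g x))\<^sup>2"
        by (intro power_mono norm_triangle_ineq4) auto
      also have "\<dots> \<le> 2 * (norm (f x))\<^sup>2 + 2 * (norm (g x))\<^sup>2"
        using sum_squares_bound[of "norm (f x)" "norm (g x)"] by (simp add: power2_sum)
      finally show ?thesis .
    qed
    then show "AE x in lebesgue. x \<in> {0<..<L} \<longrightarrow> norm ((norm (f x - g x))\<^sup>2)
        \<le> norm (2 * (norm (f x))\<^sup>2 + 2 * (norm (g x))\<^sup>2)"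
      by auto
  qed
  with meas show ?thesis by (simp add: in_L2_def)
qed

lemma L2norm_nonneg: "0 \<le> L2norm L f"
  unfolding L2norm_def set_lebesgue_integral_def
  by (intro real_sqrt_ge_zero integral_nonneg_AE) auto

lemma L2norm_power2: "(L2norm L f)\<^sup>2 = (LINT x:{0<..<L}|lebesgue. (norm (f x))\<^sup>2)"
  unfolding L2norm_def set_lebesgue_integral_def
  by (intro real_sqrt_pow2 integral_nonneg_AE) auto

text \<open>Minkowski's inequality: weight the two terms of the elementary bound
  \<open>(p + q)\<^sup>2 \<le> (1 + \<epsilon>) p\<^sup>2 + (1 + 1/\<epsilon>) q\<^sup>2\<close> by the ratio of the two norms, kept away from zero by \<open>\<delta>\<close>.\<close>

lemma L2norm_triangle:
  fixes f g :: "real \<Rightarrow> 'a::euclidean_space"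
  assumes f: "in_L2 L f" and g: "in_L2 L g"
  shows "L2norm L f \<le> L2norm L g + L2norm L (\<lambda>x. f x - g x)"
proof (rule field_le_epsilon)
  define a where "a = L2norm L g"
  define b where "b = L2norm L (\<lambda>x. f x - g x)"
  have ab: "a \<ge> 0" "b \<ge> 0" by (auto simp: a_def b_def L2norm_nonneg)
  fix \<delta> :: real assume "\<delta> > 0"
  define p where "p = a + \<delta> / 2"
  define q where "q = b + \<delta> / 2"
  have pq: "p > 0" "q > 0" "a \<le> p" "b \<le> q" using ab \<open>\<delta> > 0\<close> by (auto simp: p_def q_def)
  have ptw: "(norm (f x))\<^sup>2 \<le> (1 + q / p) * (norm (g x))\<^sup>2 + (1 + p / q) * (norm (f x - g x))\<^sup>2" for x
  proof -
    define r s where "r = norm (g x)" and "s = norm (f x - g x)"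
    have "norm (f x) \<le> r + s"
      using norm_triangle_ineq[of "g x" "f x - g x"] by (simp add: r_def s_def)
    then have "(norm (f x))\<^sup>2 \<le> (r + s)\<^sup>2" by (intro power_mono) auto
    also have "(1 + q / p) * r\<^sup>2 + (1 + p / q) * s\<^sup>2 - (r + s)\<^sup>2 = (q * r - p * s)\<^sup>2 / (p * q)"
      using pq by (simp add: field_simps power2_eq_square)
    then have "(r + s)\<^sup>2 \<le> (1 + q / p) * r\<^sup>2 + (1 + p / q) * s\<^sup>2"
      using pq by (smt (verit) divide_nonneg_pos mult_pos_pos zero_le_power2)
    finally show ?thesis by (simp add: r_def s_def)
  qed
  have fg: "in_L2 L (\<lambda>x. f x - g x)" using f g by (rule in_L2_diff)
  have "(L2norm L f)\<^sup>2 \<le> (LINT x:{0<..<L}|lebesgue.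
      (1 + q / p) * (norm (g x))\<^sup>2 + (1 + p / q) * (norm (f x - g x))\<^sup>2)"
    unfolding L2norm_power2
    by (intro set_integral_mono set_integral_add set_integrable_mult_right ptw)
       (use f g fg in \<open>auto simp: in_L2_def\<close>)
  also have "\<dots> = (1 + q / p) * a\<^sup>2 + (1 + p / q) * b\<^sup>2"
    using f g fg by (subst set_integral_add)
      (auto simp: in_L2_def a_def b_def L2norm_power2)
  also have "\<dots> \<le> (1 + q / p) * p\<^sup>2 + (1 + p / q) * q\<^sup>2"
    using pq ab by (intro add_mono mult_left_mono power_mono) auto
  also have "\<dots> = (p + q)\<^sup>2"
    using pq by (simp add: field_simps power2_eq_square)
  finally have "L2norm L f \<le> p + q"
    by (rule power2_le_imp_le) (use pq in auto)
  then show "L2norm L f \<le> L2norm L g + L2norm L (\<lambda>x. f x - g x) + \<delta>"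
    by (simp add: p_def q_def a_def b_def)
qed

lemma Psi_zero:
  assumes "local_solution L D1 h T A0 \<phi>0 A \<phi>"
  shows "Psi L A 0 = (L2norm L A0)\<^sup>2"
proof -
  have "(LINT x:{0<..<L}|lebesgue. (norm (A 0 x))\<^sup>2) = (LINT x:{0<..<L}|lebesgue. (norm (A0 x))\<^sup>2)"
    using assms by (intro set_lebesgue_integral_cong) (auto simp: local_solution_def)
  then show ?thesis by (simp add: Psi_def L2norm_power2)
qed

text \<open>A solution need not be differentiable at time 0, so the initial value enters the differential
inequality only through this limit.\<close>

lemma Psi_tendsto_initial:
  assumes sol: "local_solution L D1 h T A0 \<phi>0 A \<phi>"
  shows "(Psi L A \<longlongrightarrow> Psi L A 0) (at_right 0)"
proof -
  from sol obtain At Ax Axx where C: "C12_derivs L T A At Ax Axx" and T: "0 < T"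
    and A0: "in_L2 L A0"
    and lim: "((\<lambda>t. L2norm L (\<lambda>x. A t x - A0 x)) \<longlongrightarrow> 0) (at_right 0)"
    unfolding local_solution_def by blast
  obtain b where b: "0 < ereal b" "ereal b < T"
    using ereal_dense2[OF T] by auto
  have "\<forall>\<^sub>F t in at_right 0. t \<in> {0<..<b}"
    using b by (intro eventually_at_rightI[of 0 b]) auto
  then have "\<forall>\<^sub>F t in at_right 0. norm (L2norm L (A t) - L2norm L A0) \<le> L2norm L (\<lambda>x. A t x - A0 x)"
  proof eventually_elim
    case (elim t)
    then have "ereal t < T" using b by (auto intro: less_trans[of "ereal t" "ereal b" T])
    then have "in_L2 L (A t)"
      using elim C12_derivsD(4)[OF C, of t] by (intro in_L2_continuous) auto
    from L2norm_triangle[OF this A0] L2norm_triangle[OF A0 this]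
    show ?case by (simp add: L2norm_def norm_minus_commute)
  qed
  then have "((\<lambda>t. L2norm L (A t) - L2norm L A0) \<longlongrightarrow> 0) (at_right 0)"
    by (rule Lim_null_comparison[OF _ lim])
  then have "((\<lambda>t. L2norm L (A t)) \<longlongrightarrow> L2norm L A0) (at_right 0)"
    by (rule LIM_zero_cancel)
  then show ?thesis
    unfolding Psi_zero[OF sol] unfolding Psi_def by (intro tendsto_intros)
qed

section \<open>Lifetime of solutions of the Riccati inequality\<close>

text \<open>At the first time at which \<open>y\<close> reaches \<open>z\<close> from above it would have to be non-increasing, contrary
to \<open>pos\<close>.\<close>

lemma barrier_from_below:
  fixes y :: "real \<Rightarrow> real"
  assumes lim: "(y \<longlongrightarrow> y0) (at_right 0)" and z: "z < y0"
    and der: "\<And>t. 0 < t \<Longrightarrow> ereal t < T \<Longrightarrow> (y has_real_derivative y' t) (at t)"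
    and pos: "\<And>t. 0 < t \<Longrightarrow> ereal t < T \<Longrightarrow> y t = z \<Longrightarrow> y' t > 0"
    and t: "0 < t" "ereal t < T"
  shows "y t > z"
proof (rule ccontr)
  assume "\<not> y t > z"
  have "\<forall>\<^sub>F s in at_right 0. y s > z" using lim z by (rule order_tendstoD)
  moreover have "\<forall>\<^sub>F s in at_right 0. s \<in> {0<..<t}"
    using t by (intro eventually_at_rightI[of 0 t]) auto
  ultimately have "\<forall>\<^sub>F s in at_right 0. y s > z \<and> s \<in> {0<..<t}" by eventually_elim auto
  then obtain r where r: "y r > z" "0 < r" "r < t"
    using eventually_happens[of _ "at_right (0::real)"] by force
  have sub: "ereal s < T" if "s \<le> t" for s
    using that t by (auto intro: le_less_trans[of "ereal s" "ereal t" T])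
  have "isCont y x" if "x \<in> {r..t}" for x
    using DERIV_isCont[OF der[of x]] sub[of x] that r by auto
  then have cont: "continuous_on {r..t} y"
    by (intro continuous_at_imp_continuous_on) auto
  define S where "S = {r..t} \<inter> y -` {..z}"
  have "closed S"
    unfolding S_def by (intro continuous_closed_preimage cont) auto
  moreover have "t \<in> S" using \<open>\<not> y t > z\<close> r by (auto simp: S_def)
  moreover have bb: "bdd_below S" by (auto simp: S_def intro!: bdd_belowI)
  ultimately have InfS: "Inf S \<in> S" by (intro closed_contains_Inf) auto
  define s where "s = Inf S"
  have s: "s \<in> {r..t}" "y s \<le> z" using InfS by (auto simp: S_def s_def)
  with r have "r < s" by (cases "r = s") auto
  have above: "y x > z" if "x \<in> {r..<s}" for x
  proof (rule ccontr)
    assume "\<not> y x > z"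
    then have "x \<in> S" using that s by (auto simp: S_def)
    then have "s \<le> x" unfolding s_def using bb by (rule cInf_lower)
    then show False using that by auto
  qed
  have "z \<le> y s"
  proof (rule tendsto_lowerbound)
    have "isCont y s"
      using DERIV_isCont[OF der[of s]] r s sub[of s] \<open>r < s\<close> by auto
    then show "(y \<longlongrightarrow> y s) (at_left s)"
      by (simp add: isCont_def filterlim_at_split)
    have "\<forall>\<^sub>F x in at_left s. x \<in> {r<..<s}"
      using \<open>r < s\<close> by (intro eventually_at_leftI[of r]) auto
    then show "\<forall>\<^sub>F x in at_left s. z \<le> y x"
      by eventually_elim (use above in \<open>auto intro: less_imp_le\<close>)
  qed simp
  with s have "y s = z" by simp
  then have "y' s > 0" using pos[of s] s r sub[of s] by auto
  with der[of s] s r sub[of s] obtain d where d: "d > 0" "\<And>h. h > 0 \<Longrightarrow> h < d \<Longrightarrow> y (s - h) < y s"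
    using DERIV_pos_inc_left[of y "y' s" s] by auto
  define h where "h = min (d / 2) (s - r)"
  have "y (s - h) < z" using d \<open>r < s\<close> \<open>y s = z\<close> by (auto simp: h_def)
  moreover have "y (s - h) > z" using d \<open>r < s\<close> by (intro above) (auto simp: h_def)
  ultimately show False by simp
qed

lemma blowup_integrand_pos:
  fixes L s lam :: real
  assumes "L > 0" "s > 0" "s > (1 - lam) * L"
  shows "2 * (s\<^sup>2 / L + (lam - 1) * s) > 0"
proof -
  have "s / L > 1 - lam" using assms by (simp add: pos_less_divide_eq)
  then have "s / L + (lam - 1) > 0" by simp
  then have "2 * (s * (s / L + (lam - 1))) > 0" using assms by simp
  then show ?thesis by (simp add: power2_eq_square algebra_simps)
qed

text \<open>On the half-line the denominator is at least \<open>2 \<delta> s\<^sup>2\<close>, because \<open>1 / L + (lam - 1) / s\<close> is monotone in \<open>s\<close>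
and positive both at \<open>a\<close> and at infinity.\<close>

lemma set_integrable_blowup_integrand:
  assumes L: "L > 0" and a: "a > 0" "a > (1 - lam) * L"
  shows "set_integrable lborel {a<..} (blowup_integrand L lam)"
proof -
  define \<delta> where "\<delta> = min (1 / L) (1 / L + (lam - 1) / a)"
  have "1 / L + (lam - 1) / a = (a - (1 - lam) * L) / (L * a)"
    using L a by (simp add: field_simps)
  then have \<delta>: "\<delta> > 0" using L a by (simp add: \<delta>_def)
  have bound: "blowup_integrand L lam s \<le> 1 / (2 * \<delta>) * (1 / s\<^sup>2)" if "s > a" for s
  proof -
    have s: "s > 0" using that a by simp
    have "\<delta> \<le> 1 / L + (lam - 1) / s"
    proof (cases "lam \<ge> 1")
      case False
      have "(lam - 1) / a \<le> (lam - 1) / s"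
        using False that a by (intro divide_left_mono_neg) auto
      then show ?thesis by (simp add: \<delta>_def)
    qed (use s in \<open>simp add: \<delta>_def min.coboundedI1\<close>)
    then have "\<delta> * s\<^sup>2 \<le> (1 / L + (lam - 1) / s) * s\<^sup>2"
      by (intro mult_right_mono) auto
    also have "\<dots> = s\<^sup>2 / L + (lam - 1) * s"
      using s by (simp add: field_simps power2_eq_square)
    finally have "2 * (\<delta> * s\<^sup>2) \<le> 2 * (s\<^sup>2 / L + (lam - 1) * s)" by simp
    then have "1 / (2 * (s\<^sup>2 / L + (lam - 1) * s)) \<le> 1 / (2 * (\<delta> * s\<^sup>2))"
      using \<delta> s by (intro frac_le) auto
    then show ?thesis by (simp add: blowup_integrand_def)
  qed
  have "((\<lambda>x::real. x powr -2) has_integral - (a powr (-2 + 1)) / (-2 + 1)) {a..}"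
    using a by (intro has_integral_powr_to_inf) auto
  then have "(\<lambda>x::real. x powr -2) integrable_on {a..}" by blast
  then have "(\<lambda>x::real. x powr -2) absolutely_integrable_on {a..}"
    by (rule nonnegative_absolutely_integrable_1) auto
  then have "(\<lambda>x::real. x powr -2) absolutely_integrable_on {a<..}"
    by (rule set_integrable_subset) auto
  then have "set_integrable lebesgue {a<..} (\<lambda>s. 1 / (2 * \<delta>) * s powr -2)"
    by auto
  then have "set_integrable lebesgue {a<..} (blowup_integrand L lam)"
  proof (rule set_integrable_bound)
    show "set_borel_measurable lebesgue {a<..} (blowup_integrand L lam)"
      unfolding set_borel_measurable_def blowup_integrand_def
      by (intro measurable_completion) measurable
    show "AE x in lebesgue. x \<in> {a<..} \<longrightarrow> norm (blowup_integrand L lam x)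
        \<le> norm (1 / (2 * \<delta>) * x powr -2)"
    proof (intro AE_I2 impI)
      fix x assume "x \<in> {a<..}"
      then have x: "x > 0" "x > (1 - lam) * L" "x > a" using a by auto
      have "blowup_integrand L lam x \<ge> 0"
        using blowup_integrand_pos[OF L x(1,2)] by (simp add: blowup_integrand_def)
      moreover have "1 / x\<^sup>2 = x powr -2"
        using x by (simp add: powr_minus_divide)
      ultimately show "norm (blowup_integrand L lam x) \<le> norm (1 / (2 * \<delta>) * x powr -2)"
        using bound[OF x(3)] \<delta> by simp
    qed
  qed
  then show ?thesis
    unfolding set_integrable_def
    by (subst (asm) integrable_completion) (auto simp: blowup_integrand_def)
qed

text \<open>Separation of variables: as long as the solution exists, \<open>y' / q(y) \<ge> 1\<close>, so the time elapsed is at most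
the integral of \<open>1 / q\<close> between the values taken, which the improper integral bounds. The barrier keeps
\<open>y\<close> above the zeros of \<open>q\<close>.\<close>

lemma riccati_blowup:
  fixes y :: "real \<Rightarrow> real"
  assumes L: "L > 0" and y0: "y0 > 0" "y0 > (1 - lam) * L" and T: "0 < T"
    and lim: "(y \<longlongrightarrow> y0) (at_right 0)"
    and der: "\<And>t. 0 < t \<Longrightarrow> ereal t < T \<Longrightarrow> (y has_real_derivative y' t) (at t)"
    and ineq: "\<And>t. 0 < t \<Longrightarrow> ereal t < T \<Longrightarrow>
      y' t \<ge> - 2 * y t + 2 * lam * y t + 2 / L * (y t)\<^sup>2"
  shows "T \<le> ereal (LINT s:{y0<..}|lborel. blowup_integrand L lam s)"
    and "\<And>s t. 0 < s \<Longrightarrow> s \<le> t \<Longrightarrow> ereal t < T \<Longrightarrow> y s \<le> y t"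
proof -
  let ?g = "blowup_integrand L lam"
  define q where "q s = 2 * (s\<^sup>2 / L + (lam - 1) * s)" for s
  have ineq': "y' t \<ge> q (y t)" if "0 < t" "ereal t < T" for t
    using ineq[OF that] by (simp add: q_def algebra_simps)
  define m where "m = max 0 ((1 - lam) * L)"
  have qpos: "q s > 0" if "s > m" for s
    using blowup_integrand_pos[OF L, of s lam] that by (auto simp: q_def m_def)
  have "m < y0" using y0 by (simp add: m_def)
  have above: "y t > z" if z: "m < z" "z < y0" and t: "0 < t" "ereal t < T" for z t
  proof (rule barrier_from_below[OF lim z(2) der _ t])
    fix t assume "0 < t" "ereal t < T" "y t = z"
    then show "y' t > 0" using ineq'[of t] qpos[OF z(1)] by auto
  qed auto
  have ge: "y t \<ge> y0" if t: "0 < t" "ereal t < T" for t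
  proof (rule dense_le_bounded[OF \<open>m < y0\<close>])
    fix z assume "m < z" "z < y0"
    then show "z \<le> y t" using above[OF _ _ t] by (auto intro: less_imp_le)
  qed
  have y'pos: "y' t > 0" if "0 < t" "ereal t < T" for t
    using ineq'[OF that] ge[OF that] qpos[of "y t"] \<open>m < y0\<close> by auto
  show mono: "y s \<le> y t" if "0 < s" "s \<le> t" "ereal t < T" for s t
  proof (rule DERIV_nonneg_imp_nondecreasing[OF that(2)])
    fix x assume "s \<le> x" "x \<le> t"
    then have "0 < x" "ereal x < T" using that by (auto intro: le_less_trans[of "ereal x" "ereal t" T])
    then show "\<exists>y'. (y has_real_derivative y') (at x) \<and> 0 \<le> y'"
      using der y'pos by (meson less_imp_le)
  qed
  \<comment> \<open>The primitive of \<open>1 / q\<close> starts at \<open>z\<close>, strictly below all values of \<open>y\<close>, to be two-sidedly differentiable there.\<close>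
  define z where "z = (m + y0) / 2"
  have z: "m < z" "z < y0" using \<open>m < y0\<close> by (auto simp: z_def)
  have g: "?g s = 1 / q s" for s by (simp add: blowup_integrand_def q_def)
  have contg: "continuous_on {z..Y} ?g" for Y
  proof -
    have "q s \<noteq> 0" if "s \<in> {z..Y}" for s using qpos[of s] that z by auto
    moreover have "continuous_on {z..Y} q" unfolding q_def by (intro continuous_intros) (use L in auto)
    ultimately show ?thesis unfolding g by (intro continuous_on_divide continuous_on_const) auto
  qed
  have integrable: "set_integrable lborel {y0<..} ?g"
    by (rule set_integrable_blowup_integrand[OF L y0])
  define I where "I = (LINT s:{y0<..}|lborel. ?g s)"
  have gnn: "?g s \<ge> 0" if "s > m" for s using qpos[OF that] by (simp add: g)
  have part: "integral {a..b} ?g \<le> I" if "y0 \<le> a" "a \<le> b" for a b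
  proof -
    have sub: "set_integrable lborel {a<..b} ?g"
      by (rule set_integrable_subset[OF integrable]) (use that in auto)
    have "integral {a..b} ?g = integral {a<..b} ?g"
      by (rule integral_spike_set) (auto intro: negligible_subset[of "{a}"])
    also have "\<dots> = (LINT s:{a<..b}|lborel. ?g s)"
      using set_borel_integral_eq_integral(2)[OF sub] by simp
    also have "\<dots> \<le> I"
      unfolding I_def set_lebesgue_integral_def
    proof (rule integral_mono)
      show "indicator {a<..b} x *\<^sub>R ?g x \<le> indicator {y0<..} x *\<^sub>R ?g x" for x
        using that gnn[of x] \<open>m < y0\<close> by (auto simp: indicator_def)
    qed (use sub integrable in \<open>auto simp: set_integrable_def\<close>)
    finally show ?thesis .
  qed
  have step: "t - s \<le> I" if st: "0 < s" "s < t" "ereal t < T" for s t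
  proof -
    define Y where "Y = y t + 1"
    have yr: "y r \<in> {z<..<Y}" if "s \<le> r" "r \<le> t" for r
    proof -
      have "ereal r < T" using that st by (auto intro: le_less_trans[of "ereal r" "ereal t" T])
      then show ?thesis using mono[of r t] ge[of r] z that st by (auto simp: Y_def)
    qed
    have "integral {z..y s} ?g - s \<le> integral {z..y t} ?g - t"
    proof (rule DERIV_nonneg_imp_nondecreasing[of s t "\<lambda>r. integral {z..y r} ?g - r"])
      fix r assume r: "s \<le> r" "r \<le> t"
      then have r': "0 < r" "ereal r < T" using st by (auto intro: le_less_trans[of "ereal r" "ereal t" T])
      have "((\<lambda>Y. integral {z..Y} ?g) has_real_derivative ?g (y r)) (at (y r) within {z..Y})"
        using yr[OF r] by (intro integral_has_real_derivative contg) auto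
      then have "((\<lambda>Y. integral {z..Y} ?g) has_real_derivative ?g (y r)) (at (y r))"
        using yr[OF r] by (subst (asm) at_within_Icc_at) auto
      from DERIV_chain2[OF this der[OF r']]
      have "((\<lambda>r. integral {z..y r} ?g - r) has_real_derivative ?g (y r) * y' r - 1) (at r)"
        by (auto intro!: derivative_eq_intros)
      moreover have "?g (y r) * y' r \<ge> 1"
        using ineq'[OF r'] qpos[of "y r"] ge[OF r'] \<open>m < y0\<close> by (simp add: g field_simps)
      ultimately show "\<exists>d. ((\<lambda>r. integral {z..y r} ?g - r) has_real_derivative d) (at r) \<and> 0 \<le> d"
        by (intro exI[of _ "?g (y r) * y' r - 1"]) auto
    qed (use st in auto)
    moreover have "integral {z..y s} ?g + integral {y s..y t} ?g = integral {z..y t} ?g"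
      using yr[of s] mono[of s t] st
      by (intro Henstock_Kurzweil_Integration.integral_combine integrable_continuous_real contg) auto
    moreover have "integral {y s..y t} ?g \<le> I"
    proof (intro part)
      have "ereal s < T" using st by (auto intro: less_trans[of "ereal s" "ereal t" T])
      then show "y0 \<le> y s" using ge st by auto
    qed (use st mono in auto)
    ultimately show ?thesis by simp
  qed
  have bound: "t \<le> I" if "0 < t" "ereal t < T" for t
  proof (rule field_le_epsilon)
    fix e :: real assume "e > 0"
    moreover have "t - min e (t / 2) \<le> I"
      using that \<open>e > 0\<close> by (intro step) auto
    ultimately show "t \<le> I + e" by linarith
  qed
  show "T \<le> ereal (LINT s:{y0<..}|lborel. ?g s)"
    unfolding I_def[symmetric]
  proof (rule ccontr)
    assume "\<not> T \<le> ereal I"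
    then have "max 0 (ereal I) < T" using T by auto
    then obtain t where "max 0 (ereal I) < ereal t" "ereal t < T"
      using ereal_dense2 by blast
    then show False using bound[of t] by auto
  qed
qed

section \<open>Convolution of weighted Fourier coefficients\<close>

text \<open>Sine series are handled through coefficients indexed by all integers, where products become
convolutions. The exponent \<open>11/10 = 1/2 + 2 \<cdot> 3/10\<close> serves two purposes: it exceeds 1, which makes the weight
summable and stable under convolution, and it is the decay that remains of \<open>\<bar>n\<bar> powr (-1/2)\<close> times a heat
factor once \<open>t powr (-3/10)\<close> has been split off.\<close>

definition poly_weight :: "int \<Rightarrow> real" where
  "poly_weight n = (1 + \<bar>real_of_int n\<bar>) powr (-11/10)"

definition exp_weight :: "real \<Rightarrow> int \<Rightarrow> real" where
  "exp_weight \<rho> n = poly_weight n * exp (- \<rho> * \<bar>real_of_int n\<bar>)"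

definition conv :: "(int \<Rightarrow> real) \<Rightarrow> (int \<Rightarrow> real) \<Rightarrow> int \<Rightarrow> real" where
  "conv a b n = (\<Sum>\<^sub>\<infinity>i. a i * b (n - i))"

definition conv_const :: real where
  "conv_const = 8 * infsum poly_weight UNIV"

lemma poly_weight_pos: "poly_weight n > 0" and poly_weight_le_1: "poly_weight n \<le> 1"
  using powr_mono[of "-11/10" 0 "1 + \<bar>real_of_int n\<bar>"] by (auto simp: poly_weight_def split: if_splits)

lemma exp_weight_pos: "exp_weight \<rho> n > 0"
  by (simp add: exp_weight_def poly_weight_pos)

lemma exp_weight_le_poly_weight: "\<rho> \<ge> 0 \<Longrightarrow> exp_weight \<rho> n \<le> poly_weight n"
  using poly_weight_pos[of n] by (simp add: exp_weight_def mult_le_cancel_left1)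

lemma summable_on_int:
  fixes f :: "int \<Rightarrow> real"
  assumes "(\<lambda>n. f (int n)) summable_on UNIV" "(\<lambda>n. f (- int n)) summable_on UNIV"
  shows "f summable_on UNIV"
proof -
  have "f summable_on range int"
    by (subst summable_on_reindex) (use assms in \<open>auto simp: o_def inj_on_def\<close>)
  moreover have "f summable_on range (\<lambda>n. - int n)"
    by (subst summable_on_reindex) (use assms in \<open>auto simp: o_def inj_on_def\<close>)
  moreover have "(UNIV :: int set) = range int \<union> range (\<lambda>n. - int n)"
    by (auto simp: image_iff intro: int_cases2)
  ultimately show ?thesis by (metis summable_on_union)
qed

lemma poly_weight_summable: "poly_weight summable_on UNIV"
proof -
  have "summable (\<lambda>n. real (Suc n) powr (-11/10))"
    by (subst summable_Suc_iff[of "\<lambda>n. real n powr (-11/10)"]) (simp add: summable_real_powr_iff)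
  then have "(\<lambda>n. real (Suc n) powr (-11/10)) summable_on UNIV"
    by (subst summable_on_UNIV_nonneg_real_iff) auto
  then show ?thesis
    by (intro summable_on_int) (auto simp: poly_weight_def add_ac)
qed

lemma poly_weight_shift: "(\<lambda>i. poly_weight (n - i)) summable_on UNIV" "(\<Sum>\<^sub>\<infinity>i. poly_weight (n - i)) = infsum poly_weight UNIV"
proof -
  have "bij_betw (\<lambda>i. n - i) UNIV UNIV"
    by (rule bij_betwI[of _ _ _ "\<lambda>i. n - i"]) auto
  from summable_on_reindex_bij_betw[OF this, of poly_weight] infsum_reindex_bij_betw[OF this, of poly_weight]
  show "(\<lambda>i. poly_weight (n - i)) summable_on UNIV" "(\<Sum>\<^sub>\<infinity>i. poly_weight (n - i)) = infsum poly_weight UNIV"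
    using poly_weight_summable by auto
qed

lemma conv_const_pos: "conv_const > 0"
proof -
  have "poly_weight 0 \<le> infsum poly_weight UNIV"
    using infsum_mono2[of poly_weight "{0}" UNIV] poly_weight_summable poly_weight_pos by (auto intro: less_imp_le)
  with poly_weight_pos[of 0] show ?thesis by (simp add: conv_const_def)
qed

lemma poly_weight_double:
  assumes "1 + \<bar>n\<bar> \<le> 2 * (1 + \<bar>m\<bar>)"
  shows "poly_weight m \<le> 4 * poly_weight n"
proof -
  have le: "1 + \<bar>real_of_int n\<bar> \<le> 2 * (1 + \<bar>real_of_int m\<bar>)"
    using of_int_le_iff[where 'a = real, THEN iffD2, OF assms] by simp
  have "poly_weight m \<le> ((1 + \<bar>real_of_int n\<bar>) / 2) powr (-11/10)"
    unfolding poly_weight_def using le by (intro powr_mono2') auto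
  also have "\<dots> = 2 powr (11/10) * poly_weight n"
    by (simp add: poly_weight_def powr_divide powr_minus divide_simps)
  also have "\<dots> \<le> 2 powr 2 * poly_weight n"
    using poly_weight_pos[of n] by (intro mult_right_mono powr_mono) auto
  finally show ?thesis by simp
qed

text \<open>One of \<open>i\<close> and \<open>n - i\<close> has at least half the size of \<open>n\<close>, so its weight is comparable to that of \<open>n\<close>
and the other weight is left over to be summed. The exponential factors only need the triangle
inequality.\<close>

lemma exp_weight_mult:
  assumes "\<rho> \<ge> 0"
  shows "exp_weight \<rho> i * exp_weight \<rho> (n - i) \<le> 4 * exp_weight \<rho> n * (poly_weight i + poly_weight (n - i))"
proof -
  have tri: "\<bar>n\<bar> \<le> \<bar>i\<bar> + \<bar>n - i\<bar>" using abs_triangle_ineq[of i "n - i"] by simp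
  have "poly_weight i * poly_weight (n - i) \<le> 4 * poly_weight n * (poly_weight i + poly_weight (n - i))"
  proof (cases "\<bar>i\<bar> \<le> \<bar>n - i\<bar>")
    case True
    then have "1 + \<bar>n\<bar> \<le> 2 * (1 + \<bar>n - i\<bar>)" using tri by (smt (verit))
    then have "poly_weight (n - i) \<le> 4 * poly_weight n" by (rule poly_weight_double)
    then have "poly_weight i * poly_weight (n - i) \<le> poly_weight i * (4 * poly_weight n)"
      using poly_weight_pos by (intro mult_left_mono) (auto intro: less_imp_le)
    also have "\<dots> \<le> 4 * poly_weight n * (poly_weight i + poly_weight (n - i))"
      using poly_weight_pos[of n] poly_weight_pos[of "n - i"] by (simp add: algebra_simps)
    finally show ?thesis .
  next
    case False
    then have "1 + \<bar>n\<bar> \<le> 2 * (1 + \<bar>i\<bar>)" using tri by (smt (verit))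
    then have "poly_weight i \<le> 4 * poly_weight n" by (rule poly_weight_double)
    then have "poly_weight i * poly_weight (n - i) \<le> 4 * poly_weight n * poly_weight (n - i)"
      using poly_weight_pos by (intro mult_right_mono) (auto intro: less_imp_le)
    also have "\<dots> \<le> 4 * poly_weight n * (poly_weight i + poly_weight (n - i))"
      using poly_weight_pos[of n] poly_weight_pos[of i] by (simp add: algebra_simps)
    finally show ?thesis .
  qed
  moreover have "exp (- \<rho> * \<bar>real_of_int i\<bar>) * exp (- \<rho> * \<bar>real_of_int (n - i)\<bar>)
      \<le> exp (- \<rho> * \<bar>real_of_int n\<bar>)"
  proof -
    have "\<rho> * \<bar>real_of_int n\<bar> \<le> \<rho> * (\<bar>real_of_int i\<bar> + \<bar>real_of_int (n - i)\<bar>)"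
      using assms by (intro mult_left_mono) auto
    then show ?thesis by (simp add: exp_add[symmetric] algebra_simps)
  qed
  ultimately have "(poly_weight i * poly_weight (n - i)) * (exp (- \<rho> * \<bar>real_of_int i\<bar>) * exp (- \<rho> * \<bar>real_of_int (n - i)\<bar>))
      \<le> (4 * poly_weight n * (poly_weight i + poly_weight (n - i))) * exp (- \<rho> * \<bar>real_of_int n\<bar>)"
  proof (rule mult_mono)
    show "0 \<le> 4 * poly_weight n * (poly_weight i + poly_weight (n - i))"
      using poly_weight_pos[of n] poly_weight_pos[of i] poly_weight_pos[of "n - i"] by simp
  qed auto
  then show ?thesis unfolding exp_weight_def by (simp only: mult_ac)
qed

lemma exp_weight_bound_nonneg:
  fixes x :: real
  assumes "\<bar>x\<bar> \<le> \<alpha> * exp_weight \<rho> n"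
  shows "\<alpha> \<ge> 0"
proof -
  have "0 \<le> \<alpha> * exp_weight \<rho> n" using assms by (rule order_trans[OF abs_ge_zero])
  then show ?thesis using exp_weight_pos[of \<rho> n] by (simp add: zero_le_mult_iff)
qed

text \<open>Sequences dominated by the weight form an algebra under convolution, with a constant independent of
the exponential rate \<open>\<rho>\<close>. This is why exponential decay of the coefficients, and hence smoothness of the
sine series, comes out of the fixed point argument without a separate regularity proof.\<close>

lemma conv_bound:
  assumes \<rho>: "\<rho> \<ge> 0"
    and a: "\<And>n. \<bar>a n\<bar> \<le> \<alpha> * exp_weight \<rho> n" and b: "\<And>n. \<bar>b n\<bar> \<le> \<beta> * exp_weight \<rho> n"
  shows "(\<lambda>i. norm (a i * b (n - i))) summable_on UNIV"
    and "\<bar>conv a b n\<bar> \<le> conv_const * \<alpha> * \<beta> * exp_weight \<rho> n"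
proof -
  have nn: "\<alpha> \<ge> 0" "\<beta> \<ge> 0"
    by (rule exp_weight_bound_nonneg[OF a[of 0]], rule exp_weight_bound_nonneg[OF b[of 0]])
  define g where "g i = 4 * \<alpha> * \<beta> * exp_weight \<rho> n * (poly_weight i + poly_weight (n - i))" for i
  have le: "norm (a i * b (n - i)) \<le> g i" for i
  proof -
    have "norm (a i * b (n - i)) \<le> (\<alpha> * exp_weight \<rho> i) * (\<beta> * exp_weight \<rho> (n - i))"
      unfolding real_norm_def abs_mult using nn
      by (intro mult_mono a b) (auto intro!: mult_nonneg_nonneg less_imp_le[OF exp_weight_pos])
    also have "\<dots> = \<alpha> * \<beta> * (exp_weight \<rho> i * exp_weight \<rho> (n - i))" by simp
    also have "\<dots> \<le> \<alpha> * \<beta> * (4 * exp_weight \<rho> n * (poly_weight i + poly_weight (n - i)))"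
      using nn by (intro mult_left_mono exp_weight_mult \<rho>) auto
    finally show ?thesis by (simp add: g_def mult_ac)
  qed
  have sums: "g summable_on UNIV"
    unfolding g_def by (intro summable_on_cmult_right summable_on_add poly_weight_summable poly_weight_shift)
  then show abs: "(\<lambda>i. norm (a i * b (n - i))) summable_on UNIV"
    using le by (rule Infinite_Sum.abs_summable_on_comparison_test')
  have "\<bar>conv a b n\<bar> \<le> infsum g UNIV"
    unfolding conv_def real_norm_def[symmetric]
    by (rule norm_infsum_le[OF has_sum_infsum[OF Infinite_Sum.abs_summable_summable[OF abs]] has_sum_infsum[OF sums] le])
  also have "\<dots> = 4 * \<alpha> * \<beta> * exp_weight \<rho> n * (infsum poly_weight UNIV + infsum poly_weight UNIV)"
    unfolding g_def infsum_cmult_right' infsum_add[OF poly_weight_summable poly_weight_shift(1)] poly_weight_shift(2) ..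
  finally show "\<bar>conv a b n\<bar> \<le> conv_const * \<alpha> * \<beta> * exp_weight \<rho> n"
    by (simp add: conv_const_def mult_ac)
qed

lemma conv_diff:
  assumes \<rho>: "\<rho> \<ge> 0"
    and "\<And>n. \<bar>a n\<bar> \<le> \<alpha> * exp_weight \<rho> n" "\<And>n. \<bar>b n\<bar> \<le> \<beta> * exp_weight \<rho> n"
    and "\<And>n. \<bar>c n\<bar> \<le> \<gamma> * exp_weight \<rho> n" "\<And>n. \<bar>d n\<bar> \<le> \<delta> * exp_weight \<rho> n"
    and "\<And>n. \<bar>a n - c n\<bar> \<le> \<epsilon> * exp_weight \<rho> n" "\<And>n. \<bar>b n - d n\<bar> \<le> \<zeta> * exp_weight \<rho> n"
  shows "\<bar>conv a b n - conv c d n\<bar> \<le> conv_const * (\<epsilon> * \<beta> + \<gamma> * \<zeta>) * exp_weight \<rho> n"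
proof -
  have s1: "(\<lambda>i. (a i - c i) * b (n - i)) summable_on UNIV"
    and s2: "(\<lambda>i. c i * (b (n - i) - d (n - i))) summable_on UNIV"
    and s3: "(\<lambda>i. c i * d (n - i)) summable_on UNIV"
    by (rule Infinite_Sum.abs_summable_summable, rule conv_bound(1)[OF \<rho>]; rule assms)+
  have "conv a b n = (\<Sum>\<^sub>\<infinity>i. ((a i - c i) * b (n - i) + c i * (b (n - i) - d (n - i))) + c i * d (n - i))"
    unfolding conv_def by (intro infsum_cong) (simp add: algebra_simps)
  also have "\<dots> = conv (\<lambda>n. a n - c n) b n + conv c (\<lambda>n. b n - d n) n + conv c d n"
    unfolding conv_def
    by (rule trans[OF infsum_add[OF summable_on_add[OF s1 s2] s3] arg_cong2[of _ _ _ _ "(+)", OF infsum_add[OF s1 s2] refl]])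
  finally have *: "conv a b n - conv c d n = conv (\<lambda>n. a n - c n) b n + conv c (\<lambda>n. b n - d n) n"
    by (simp only: diff_eq_eq)
  have "\<bar>conv a b n - conv c d n\<bar> \<le> \<bar>conv (\<lambda>n. a n - c n) b n\<bar> + \<bar>conv c (\<lambda>n. b n - d n) n\<bar>"
    unfolding * by (rule abs_triangle_ineq)
  also have "\<dots> \<le> conv_const * \<epsilon> * \<beta> * exp_weight \<rho> n + conv_const * \<gamma> * \<zeta> * exp_weight \<rho> n"
    by (rule add_mono[OF conv_bound(2)[OF \<rho> assms(6,3)] conv_bound(2)[OF \<rho> assms(4,7)]])
  also have "\<dots> = conv_const * (\<epsilon> * \<beta> + \<gamma> * \<zeta>) * exp_weight \<rho> n"
    by (simp only: distrib_left distrib_right mult.assoc)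
  finally show "\<bar>conv a b n - conv c d n\<bar> \<le> conv_const * (\<epsilon> * \<beta> + \<gamma> * \<zeta>) * exp_weight \<rho> n" .
qed

text \<open>Coefficients of the cubic nonlinearity; see \<open>sine_sum_cube\<close> for the sign.\<close>

definition cube :: "(int \<Rightarrow> real) \<Rightarrow> int \<Rightarrow> real" where
  "cube a = conv (conv a a) a"

lemma cube_bound:
  assumes \<rho>: "\<rho> \<ge> 0" and a: "\<And>n. \<bar>a n\<bar> \<le> R * exp_weight \<rho> n"
  shows "\<bar>cube a n\<bar> \<le> conv_const\<^sup>2 * R ^ 3 * exp_weight \<rho> n"
proof -
  have c2: "\<bar>conv a a n\<bar> \<le> (conv_const * R * R) * exp_weight \<rho> n" for n
    by (rule conv_bound(2)[OF \<rho> a a])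
  have "\<bar>cube a n\<bar> \<le> conv_const * (conv_const * R * R) * R * exp_weight \<rho> n"
    unfolding cube_def by (rule conv_bound(2)[OF \<rho> c2 a])
  also have "\<dots> = conv_const\<^sup>2 * R ^ 3 * exp_weight \<rho> n"
    by (simp only: power2_eq_square power3_eq_cube mult_ac)
  finally show ?thesis .
qed

lemma cube_diff:
  assumes \<rho>: "\<rho> \<ge> 0" and a: "\<And>n. \<bar>a n\<bar> \<le> R * exp_weight \<rho> n" and b: "\<And>n. \<bar>b n\<bar> \<le> R * exp_weight \<rho> n"
    and d: "\<And>n. \<bar>a n - b n\<bar> \<le> d * exp_weight \<rho> n"
  shows "\<bar>cube a n - cube b n\<bar> \<le> 3 * conv_const\<^sup>2 * R\<^sup>2 * d * exp_weight \<rho> n"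
proof -
  have ca: "\<bar>conv a a n\<bar> \<le> (conv_const * R * R) * exp_weight \<rho> n" for n
    by (rule conv_bound(2)[OF \<rho> a a])
  have cb: "\<bar>conv b b n\<bar> \<le> (conv_const * R * R) * exp_weight \<rho> n" for n
    by (rule conv_bound(2)[OF \<rho> b b])
  have d2: "\<bar>conv a a n - conv b b n\<bar> \<le> conv_const * (d * R + R * d) * exp_weight \<rho> n" for n
    by (rule conv_diff[OF \<rho> a a b b d d])
  have "\<bar>cube a n - cube b n\<bar>
      \<le> conv_const * (conv_const * (d * R + R * d) * R + conv_const * R * R * d) * exp_weight \<rho> n"
    unfolding cube_def by (rule conv_diff[OF \<rho> ca a cb b d2 d])
  also have "\<dots> = 3 * conv_const\<^sup>2 * R\<^sup>2 * d * exp_weight \<rho> n"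
    by (simp add: power2_eq_square)
  finally show ?thesis .
qed

lemma conv_parity:
  assumes "\<And>n. a (- n) = s * a n" "\<And>n. b (- n) = r * b n"
  shows "conv a b (- n) = s * r * conv a b n"
proof -
  have "conv a b (- n) = (\<Sum>\<^sub>\<infinity>i. a (- i) * b (- (n - i)))"
    unfolding conv_def
    by (rule infsum_reindex_bij_witness[of _ uminus uminus]) auto
  also have "\<dots> = s * r * conv a b n"
    unfolding conv_def assms by (simp add: mult_ac flip: infsum_cmult_right')
  finally show ?thesis .
qed

lemma cube_odd:
  assumes "\<And>n. a (- n) = - a n"
  shows "cube a (- n) = - cube a n"
  using conv_parity[of "conv a a" 1 a "-1" n] conv_parity[of a "-1" a "-1"] assms
  by (simp add: cube_def)

lemma continuous_on_conv:
  assumes a: "\<And>n. continuous_on S (\<lambda>t. a t n)" and b: "\<And>n. continuous_on S (\<lambda>t. b t n)"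
    and ba: "\<And>t n. t \<in> S \<Longrightarrow> \<bar>a t n\<bar> \<le> \<alpha> * exp_weight 0 n"
    and bb: "\<And>t n. t \<in> S \<Longrightarrow> \<bar>b t n\<bar> \<le> \<beta> * exp_weight 0 n"
  shows "continuous_on S (\<lambda>t. conv (a t) (b t) n)"
proof (cases "S = {}")
  case False
  then obtain t0 where t0: "t0 \<in> S" by blast
  have nn: "\<alpha> \<ge> 0" "\<beta> \<ge> 0"
    by (rule exp_weight_bound_nonneg[OF ba[OF t0, of 0]], rule exp_weight_bound_nonneg[OF bb[OF t0, of 0]])
  have "uniform_limit S (\<lambda>X t. \<Sum>i\<in>X. a t i * b t (n - i)) (\<lambda>t. \<Sum>\<^sub>\<infinity>i. a t i * b t (n - i))
      (finite_subsets_at_top UNIV)"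
  proof (rule Weierstrass_m_test_general)
    fix i t assume "t \<in> S"
    then have "norm (a t i * b t (n - i)) \<le> (\<alpha> * poly_weight i) * (\<beta> * poly_weight (n - i))"
      unfolding real_norm_def abs_mult using nn ba bb
      by (intro mult_mono) (auto simp: exp_weight_def intro!: mult_nonneg_nonneg less_imp_le[OF poly_weight_pos])
    also have "\<dots> \<le> (\<alpha> * poly_weight i) * (\<beta> * 1)"
      using nn poly_weight_le_1 by (intro mult_left_mono) (auto intro!: mult_nonneg_nonneg less_imp_le[OF poly_weight_pos])
    finally show "norm (a t i * b t (n - i)) \<le> \<alpha> * \<beta> * poly_weight i" by (simp add: mult_ac)
  next
    show "(\<lambda>i. \<alpha> * \<beta> * poly_weight i) summable_on UNIV"
      by (intro summable_on_cmult_right poly_weight_summable)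
  qed
  then show ?thesis
    unfolding conv_def
    by (rule uniform_limit_theorem[rotated]) (auto intro!: always_eventually continuous_intros a b)
qed auto

lemma continuous_on_cube:
  assumes a: "\<And>n. continuous_on S (\<lambda>t. a t n)"
    and ba: "\<And>t n. t \<in> S \<Longrightarrow> \<bar>a t n\<bar> \<le> \<alpha> * exp_weight 0 n"
  shows "continuous_on S (\<lambda>t. cube (a t) n)"
proof -
  have c2: "\<bar>conv (a t) (a t) n\<bar> \<le> (conv_const * \<alpha> * \<alpha>) * exp_weight 0 n" if "t \<in> S" for t n
    by (rule conv_bound(2)[OF order_refl ba[OF that] ba[OF that]])
  show ?thesis
    unfolding cube_def by (rule continuous_on_conv[OF continuous_on_conv[OF a a ba ba] a c2 ba])
qed

lemma infsum_convolution:
  fixes f g :: "int \<Rightarrow> complex"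
  assumes f: "(\<lambda>x. norm (f x)) summable_on UNIV" and g: "(\<lambda>x. norm (g x)) summable_on UNIV"
  shows "(\<Sum>\<^sub>\<infinity>n. \<Sum>\<^sub>\<infinity>i. f i * g (n - i)) = infsum f UNIV * infsum g UNIV"
proof -
  let ?h = "\<lambda>(i, j). f i * g j"
  have "(\<lambda>x. norm (?h x)) summable_on UNIV \<times> UNIV"
    unfolding Infinite_Sum.abs_summable_on_Sigma_iff using f g
    by (auto simp: norm_mult abs_mult infsum_cmult_right' intro!: summable_on_cmult_right summable_on_cmult_left)
  then have h: "?h summable_on UNIV \<times> UNIV" by (rule Infinite_Sum.abs_summable_summable)
  have "infsum f UNIV * infsum g UNIV = (\<Sum>\<^sub>\<infinity>i. \<Sum>\<^sub>\<infinity>j. f i * g j)"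
    by (simp add: infsum_cmult_right' infsum_cmult_left')
  also have "\<dots> = infsum ?h (UNIV \<times> UNIV)"
    using infsum_Sigma_banach[OF h] by simp
  also have "\<dots> = (\<Sum>\<^sub>\<infinity>(n, i)\<in>UNIV \<times> UNIV. f i * g (n - i))"
    by (rule infsum_reindex_bij_witness[of _ "\<lambda>(n, i). (i, n - i)" "\<lambda>(i, j). (i + j, i)"]) auto
  also have "\<dots> = (\<Sum>\<^sub>\<infinity>n. \<Sum>\<^sub>\<infinity>i. f i * g (n - i))"
  proof -
    have "(\<lambda>(n, i). f i * g (n - i)) summable_on UNIV \<times> UNIV \<longleftrightarrow> ?h summable_on UNIV \<times> UNIV"
      by (rule summable_on_reindex_bij_witness[of _ "\<lambda>(i, j). (i + j, i)" "\<lambda>(n, i). (i, n - i)"]) auto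
    from infsum_Sigma_banach[OF this[THEN iffD2, OF h]] show ?thesis by simp
  qed
  finally show ?thesis by simp
qed

definition fourier :: "(int \<Rightarrow> real) \<Rightarrow> real \<Rightarrow> complex" where
  "fourier a \<theta> = (\<Sum>\<^sub>\<infinity>n. complex_of_real (a n) * cis (of_int n * \<theta>))"

lemma poly_weight_bound_abs_summable:
  assumes "\<And>n. \<bar>a n\<bar> \<le> \<alpha> * exp_weight 0 n"
  shows "(\<lambda>x. norm (a x)) summable_on UNIV"
proof (rule Infinite_Sum.abs_summable_on_comparison_test')
  show "(\<lambda>n. \<alpha> * poly_weight n) summable_on UNIV" by (intro summable_on_cmult_right poly_weight_summable)
qed (use assms in \<open>simp add: exp_weight_def\<close>)

lemma fourier_abs_summable:
  assumes "\<And>n. \<bar>a n\<bar> \<le> \<alpha> * exp_weight 0 n"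
  shows "(\<lambda>n. norm (complex_of_real (a n) * cis (of_int n * \<theta>))) summable_on UNIV"
proof -
  have "(\<lambda>n. norm (a n)) summable_on UNIV" by (rule poly_weight_bound_abs_summable[OF assms])
  then show ?thesis by (simp add: norm_mult)
qed

lemma fourier_conv:
  assumes a: "\<And>n. \<bar>a n\<bar> \<le> \<alpha> * exp_weight 0 n" and b: "\<And>n. \<bar>b n\<bar> \<le> \<beta> * exp_weight 0 n"
  shows "fourier (conv a b) \<theta> = fourier a \<theta> * fourier b \<theta>"
proof -
  have "fourier (conv a b) \<theta> = (\<Sum>\<^sub>\<infinity>n. \<Sum>\<^sub>\<infinity>i. (of_real (a i) * cis (of_int i * \<theta>)) *
      (of_real (b (n - i)) * cis (of_int (n - i) * \<theta>)))"
    unfolding fourier_def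
  proof (intro infsum_cong)
    fix n
    have "complex_of_real (conv a b n) * cis (of_int n * \<theta>)
        = (\<Sum>\<^sub>\<infinity>i. of_real (a i * b (n - i)) * cis (of_int n * \<theta>))"
    proof -
      have "(\<lambda>i. a i * b (n - i)) summable_on UNIV"
        by (rule Infinite_Sum.abs_summable_summable[OF conv_bound(1)[OF order_refl a b]])
      then have "((\<lambda>i. complex_of_real (a i * b (n - i))) has_sum of_real (conv a b n)) UNIV"
        unfolding conv_def by (intro has_sum_of_real has_sum_infsum)
      from infsumI[OF this]
      have "complex_of_real (conv a b n) = (\<Sum>\<^sub>\<infinity>i. of_real (a i * b (n - i)))" ..
      then show ?thesis by (simp add: infsum_cmult_left')
    qed
    also have "\<dots> = (\<Sum>\<^sub>\<infinity>i. (of_real (a i) * cis (of_int i * \<theta>)) *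
      (of_real (b (n - i)) * cis (of_int (n - i) * \<theta>)))"
    proof (intro infsum_cong)
      fix i
      have "cis (of_int i * \<theta>) * cis (of_int (n - i) * \<theta>) = cis (of_int n * \<theta>)"
        by (simp add: cis_mult algebra_simps)
      then show "of_real (a i * b (n - i)) * cis (of_int n * \<theta>) = (of_real (a i) * cis (of_int i * \<theta>)) *
          (of_real (b (n - i)) * cis (of_int (n - i) * \<theta>))"
        by (simp add: mult_ac)
    qed
    finally show "complex_of_real (conv a b n) * cis (of_int n * \<theta>) = \<dots>" .
  qed
  also have "\<dots> = fourier a \<theta> * fourier b \<theta>"
    unfolding fourier_def
    by (rule infsum_convolution[OF fourier_abs_summable[OF a] fourier_abs_summable[OF b]])
  finally show ?thesis .
qed

text \<open>For odd coefficients \<open>\<Sum> a\<^sub>n exp (i n \<theta>) = i S\<close> with \<open>S\<close> the sine sum, and \<open>(i S)\<^sup>3 = - i S\<^sup>3\<close>. The minus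
sign turns the absorption term \<open>- S\<^sup>3\<close> of the forward equation into \<open>+ cube a\<close>.\<close>

lemma sine_sum_cube:
  assumes a: "\<And>n. \<bar>a n\<bar> \<le> \<alpha> * exp_weight 0 n" and odd: "\<And>n. a (- n) = - a n"
  shows "(\<Sum>\<^sub>\<infinity>n. cube a n * sin (of_int n * \<theta>)) = - ((\<Sum>\<^sub>\<infinity>n. a n * sin (of_int n * \<theta>)) ^ 3)"
proof -
  have summ: "(\<lambda>n. complex_of_real (c n) * cis (of_int n * \<theta>)) summable_on UNIV"
    if "\<And>n. \<bar>c n\<bar> \<le> \<gamma> * exp_weight 0 n" for c \<gamma>
    by (rule Infinite_Sum.abs_summable_summable[OF fourier_abs_summable[OF that]])
  have Im: "Im (fourier c \<theta>) = (\<Sum>\<^sub>\<infinity>n. c n * sin (of_int n * \<theta>))"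
    if "\<And>n. \<bar>c n\<bar> \<le> \<gamma> * exp_weight 0 n" for c \<gamma>
    unfolding fourier_def using summ[OF that] by (subst infsum_Im[symmetric]) auto
  have Re: "Re (fourier a \<theta>) = (\<Sum>\<^sub>\<infinity>n. a n * cos (of_int n * \<theta>))"
    unfolding fourier_def using summ[OF a] by (subst infsum_Re[symmetric]) auto
  have "(\<Sum>\<^sub>\<infinity>n. a n * cos (of_int n * \<theta>)) = (\<Sum>\<^sub>\<infinity>n. - (a n * cos (of_int n * \<theta>)))"
    by (rule infsum_reindex_bij_witness[of _ uminus uminus]) (auto simp: odd)
  also have "\<dots> = - (\<Sum>\<^sub>\<infinity>n. a n * cos (of_int n * \<theta>))"
    by (simp add: infsum_uminus)
  finally have "Re (fourier a \<theta>) = 0" unfolding Re by simp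
  moreover define y where "y = Im (fourier a \<theta>)"
  ultimately have fa: "fourier a \<theta> = \<i> * of_real y"
    by (simp add: complex_eq_iff)
  have c2: "\<And>n. \<bar>conv a a n\<bar> \<le> conv_const * \<alpha> * \<alpha> * exp_weight 0 n"
    by (rule conv_bound(2)[OF _ a a]) simp
  have "fourier (cube a) \<theta> = fourier a \<theta> ^ 3"
    unfolding cube_def fourier_conv[OF c2 a] fourier_conv[OF a a] by (simp add: power3_eq_cube)
  also have "\<dots> = - \<i> * of_real (y ^ 3)"
    unfolding fa by (simp add: complex_eq_iff power3_eq_cube)
  finally have "Im (fourier (cube a) \<theta>) = - (Im (fourier a \<theta>) ^ 3)" by (simp add: y_def)
  then show ?thesis
    using Im[OF a] Im[OF cube_bound[OF order_refl a]] by simp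
qed

lemma infsum_even_int:
  fixes f :: "int \<Rightarrow> real"
  assumes f: "(\<lambda>x. norm (f x)) summable_on UNIV" and even: "\<And>n. f (- n) = f n" and 0: "f 0 = 0"
  shows "(\<lambda>n. 2 * f (int n)) sums infsum f UNIV"
proof -
  have fs: "f summable_on UNIV" using f by (rule Infinite_Sum.abs_summable_summable)
  have sub: "f summable_on A" for A by (rule summable_on_subset_banach[OF fs]) simp
  have "infsum f UNIV = infsum f (range int \<union> (\<lambda>n. - int n) ` {1..})"
  proof (rule arg_cong[of _ _ "infsum f"])
    show "UNIV = range int \<union> (\<lambda>n. - int n) ` {1..}"
    proof (intro set_eqI iffI)
      fix x :: int
      show "x \<in> range int \<union> (\<lambda>n. - int n) ` {1..}"
        by (cases "x \<ge> 0") (auto simp: image_iff intro: exI[of _ "nat x"] bexI[of _ "nat (- x)"])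
    qed auto
  qed
  also have "\<dots> = infsum f (range int) + infsum f ((\<lambda>n. - int n) ` {1..})"
    by (intro infsum_Un_disjoint sub) auto
  also have "infsum f (range int) = infsum (\<lambda>n. f (int n)) UNIV"
    by (subst infsum_reindex) (auto simp: o_def)
  also have "infsum f ((\<lambda>n. - int n) ` {1..}) = infsum (\<lambda>n. f (int n)) {1..}"
    by (subst infsum_reindex) (auto simp: o_def even inj_on_def)
  also have "\<dots> = infsum (\<lambda>n. f (int n)) UNIV"
    by (rule infsum_cong_neutral) (auto simp: 0 not_less_eq_eq)
  finally have eq: "infsum f UNIV = 2 * infsum (\<lambda>n. f (int n)) UNIV" by simp
  have "(\<lambda>n. f (int n)) summable_on UNIV"
    using sub[of "range int"] by (subst (asm) summable_on_reindex) (auto simp: o_def)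
  then have "(\<lambda>n. f (int n)) sums infsum (\<lambda>n. f (int n)) UNIV"
    by (intro has_sum_imp_sums has_sum_infsum)
  then show ?thesis unfolding eq by (rule sums_mult)
qed

section \<open>The forward equation with rough data\<close>

text \<open>The exponent \<open>-9/10 = 3 \<cdot> (-3/10)\<close> is that of the cubic term of functions growing like \<open>t powr (-3/10)\<close> at
time zero; it is still integrable.\<close>

lemma singular_integral:
  fixes f :: "real \<Rightarrow> real"
  assumes t: "t > 0" and cont: "continuous_on {0<..t} f"
    and bound: "\<And>s. s \<in> {0<..t} \<Longrightarrow> \<bar>f s\<bar> \<le> M * s powr (-9/10)"
  shows "f integrable_on {0..t}" "\<bar>integral {0..t} f\<bar> \<le> 10 * M * t powr (1/10)"
proof -
  let ?g = "\<lambda>s. M * s powr (-9/10)"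
  have null: "negligible {x \<in> {0<..t} - {0..t}. h x \<noteq> 0}" "negligible {x \<in> {0..t} - {0<..t}. h x \<noteq> 0}"
    for h :: "real \<Rightarrow> real"
    by (auto intro: negligible_subset[of "{0}"])
  have "((\<lambda>s. s powr (-9/10)) has_integral t powr (-9/10 + 1) / (-9/10 + 1)) {0..t}"
    by (rule has_integral_powr_from_0) (use t in auto)
  then have "(?g has_integral M * (t powr (-9/10 + 1) / (-9/10 + 1))) {0..t}"
    by (rule has_integral_mult_right)
  then have g: "(?g has_integral 10 * M * t powr (1/10)) {0..t}" by (simp add: mult_ac)
  then have g': "?g integrable_on {0<..t}"
    using integrable_spike_set[OF has_integral_integrable[OF g] null(2) null(1)] by simp
  have "f absolutely_integrable_on {0<..t}"
  proof (rule measurable_bounded_by_integrable_imp_absolutely_integrable[OF _ _ g'])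
    show "f \<in> borel_measurable (lebesgue_on {0<..t})"
      by (rule continuous_imp_measurable_on_sets_lebesgue[OF cont]) auto
  qed (use bound in auto)
  then have f: "f integrable_on {0<..t}" by (rule set_lebesgue_integral_eq_integral(1))
  then show "f integrable_on {0..t}"
    by (rule integrable_spike_set[OF _ null])
  have eq: "integral {0<..t} h = integral {0..t} h" for h :: "real \<Rightarrow> real"
    by (rule integral_spike_set[OF null])
  have "norm (integral {0<..t} f) \<le> integral {0<..t} ?g"
    by (rule integral_norm_bound_integral[OF f g']) (use bound in auto)
  also have "\<dots> = 10 * M * t powr (1/10)"
    unfolding eq using g by (rule integral_unique)
  finally show "\<bar>integral {0..t} f\<bar> \<le> 10 * M * t powr (1/10)" unfolding eq by simp
qed

lemma continuous_on_half_open: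
  fixes f :: "real \<Rightarrow> real"
  assumes "\<And>c. 0 < c \<Longrightarrow> continuous_on {c..\<tau>} f"
  shows "continuous_on {0<..\<tau>} f"
  unfolding continuous_on_eq_continuous_within
proof
  fix x assume x: "x \<in> {0<..\<tau>}"
  then have "continuous (at x within {x/2..\<tau>}) f"
    using assms[of "x/2"] by (auto simp: continuous_on_eq_continuous_within)
  also have "at x within {x/2..\<tau>} = at x within {0<..\<tau>}"
    by (rule at_within_nhd[of _ "{x/2<..}"]) (use x in auto)
  finally show "continuous (at x within {0<..\<tau>}) f" .
qed

lemma powr_mult_exp_le_1:
  fixes x p :: real
  assumes "x > 0" "0 \<le> p" "p \<le> 1"
  shows "x powr p * exp (- x) \<le> 1"
proof -
  have "x powr p \<le> exp x"
  proof (cases "x \<le> 1")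
    case True
    then have "x powr p \<le> 1" using assms by (intro powr_le1) auto
    also have "1 \<le> exp x" using assms by simp
    finally show ?thesis .
  next
    case False
    then have "x powr p \<le> x powr 1" using assms by (intro powr_mono) auto
    also have "x powr 1 = x" using assms by simp
    also have "x \<le> exp x" using exp_ge_add_one_self[of x] by linarith
    finally show ?thesis .
  qed
  then show ?thesis by (simp add: exp_minus field_simps)
qed

lemma abs_le_square_of_int: "\<bar>real_of_int n\<bar> \<le> (real_of_int n)\<^sup>2"
proof (cases "n = 0")
  case False
  then have "\<bar>real_of_int n\<bar> \<ge> 1" by linarith
  then have "\<bar>real_of_int n\<bar> \<le> \<bar>real_of_int n\<bar> ^ 2" by (intro self_le_power) auto
  then show ?thesis by simp
qed auto

text \<open>Initial data that just fail to be square summable: their squares form the harmonic series.\<close>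

definition init_coeff :: "int \<Rightarrow> real" where
  "init_coeff n = sgn (real_of_int n) * \<bar>real_of_int n\<bar> powr (-1/2)"

text \<open>The forward equation \<open>B\<^sub>t = B\<^sub>x\<^sub>x + B - B\<^sup>3\<close> on the interval of length \<open>L\<close> becomes, with \<open>\<mu> = (pi / L)\<^sup>2\<close>, the system
\<open>a\<^sub>n' = (1 - \<mu> n\<^sup>2) a\<^sub>n + (cube a)\<^sub>n\<close>. It is solved in Duhamel form among paths dominated by \<open>path_weight\<close>: a time
singularity \<open>t powr (-3/10)\<close>, and an exponential rate in \<open>n\<close> that grows linearly in time, which the heat semigroup
can afford.\<close>

locale rough_data =
  fixes \<mu> :: real
  assumes mu: "\<mu> > 0"
begin

definition growth :: "int \<Rightarrow> real" where
  "growth n = 1 - \<mu> * (real_of_int n)\<^sup>2"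

definition path_weight :: "real \<Rightarrow> int \<Rightarrow> real" where
  "path_weight t n = t powr (-3/10) * exp_weight (\<mu> * t / 2) n"

definition linpart :: "real \<Rightarrow> int \<Rightarrow> real" where
  "linpart t n = init_coeff n * exp (growth n * t)"

definition duhamel :: "(real \<Rightarrow> int \<Rightarrow> real) \<Rightarrow> real \<Rightarrow> int \<Rightarrow> real" where
  "duhamel a t n = integral {0..t} (\<lambda>s. exp (growth n * (t - s)) * cube (a s) n)"

definition admissible :: "real \<Rightarrow> real \<Rightarrow> (real \<Rightarrow> int \<Rightarrow> real) \<Rightarrow> bool" where
  "admissible \<tau> R a \<longleftrightarrow> (\<forall>n. continuous_on {0<..\<tau>} (\<lambda>t. a t n))
     \<and> (\<forall>t\<in>{0<..\<tau>}. \<forall>n. \<bar>a t n\<bar> \<le> R * path_weight t n)"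

lemma path_weight_pos: "t > 0 \<Longrightarrow> path_weight t n > 0"
  by (simp add: path_weight_def exp_weight_pos)

lemma path_weight_le:
  assumes "0 < c" "c \<le> t"
  shows "path_weight t n \<le> c powr (-3/10) * exp_weight 0 n"
proof -
  have "exp_weight (\<mu> * t / 2) n \<le> poly_weight n" using mu assms by (intro exp_weight_le_poly_weight) auto
  moreover have "t powr (-3/10) \<le> c powr (-3/10)" using assms by (intro powr_mono2') auto
  ultimately show ?thesis
    unfolding path_weight_def using exp_weight_pos[of "\<mu> * t / 2" n]
    by (intro mult_mono) (auto simp: exp_weight_def)
qed

text \<open>The heat factor over the time span \<open>t - s\<close> pays for the increase of the exponential rate from
\<open>\<mu> s / 2\<close> to \<open>\<mu> t / 2\<close>, since \<open>\<bar>n\<bar> / 2 \<le> n\<^sup>2\<close>.\<close>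

lemma semigroup_decay:
  assumes "0 \<le> s" "s \<le> t" "t \<le> 1"
  shows "exp (growth n * (t - s)) * exp_weight (\<mu> * s / 2) n \<le> exp 1 * exp_weight (\<mu> * t / 2) n"
proof -
  let ?n = "real_of_int n"
  have "\<mu> * (t - s) * (\<bar>?n\<bar> / 2) \<le> \<mu> * (t - s) * ?n\<^sup>2"
    using mu assms abs_le_square_of_int[of n] by (intro mult_left_mono) auto
  moreover have "growth n * (t - s) = (t - s) - \<mu> * (t - s) * ?n\<^sup>2"
    by (simp add: growth_def algebra_simps)
  moreover have "- (\<mu> * s / 2) * \<bar>?n\<bar> - - (\<mu> * t / 2) * \<bar>?n\<bar> = \<mu> * (t - s) * (\<bar>?n\<bar> / 2)"
    by (simp add: field_simps)
  ultimately have "growth n * (t - s) + (- (\<mu> * s / 2) * \<bar>?n\<bar>) \<le> 1 + (- (\<mu> * t / 2) * \<bar>?n\<bar>)"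
    using assms by linarith
  then have "exp (growth n * (t - s)) * exp (- (\<mu> * s / 2) * \<bar>?n\<bar>) \<le> exp 1 * exp (- (\<mu> * t / 2) * \<bar>?n\<bar>)"
    by (simp only: exp_add[symmetric] exp_le_cancel_iff)
  then have "poly_weight n * (exp (growth n * (t - s)) * exp (- (\<mu> * s / 2) * \<bar>?n\<bar>))
      \<le> poly_weight n * (exp 1 * exp (- (\<mu> * t / 2) * \<bar>?n\<bar>))"
    by (rule mult_left_mono) (rule less_imp_le[OF poly_weight_pos])
  then show ?thesis by (simp only: exp_weight_def mult_ac)
qed

lemma duhamel_integral:
  assumes t: "0 < t" "t \<le> 1" and cont: "continuous_on {0<..t} X"
    and X: "\<And>s. s \<in> {0<..t} \<Longrightarrow> \<bar>X s\<bar> \<le> K * s powr (-9/10) * exp_weight (\<mu> * s / 2) n"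
  shows "(\<lambda>s. exp (growth n * (t - s)) * X s) integrable_on {0..t}"
    and "\<bar>integral {0..t} (\<lambda>s. exp (growth n * (t - s)) * X s)\<bar>
      \<le> 10 * exp 1 * K * t powr (1/10) * exp_weight (\<mu> * t / 2) n"
proof -
  have K: "K \<ge> 0"
    using X[of t] t exp_weight_bound_nonneg[of "X t" "K * t powr (-9/10)"]
    by (auto simp: zero_le_mult_iff)
  have cont': "continuous_on {0<..t} (\<lambda>s. exp (growth n * (t - s)) * X s)"
    by (intro continuous_intros cont)
  have le: "\<bar>exp (growth n * (t - s)) * X s\<bar> \<le> (exp 1 * K * exp_weight (\<mu> * t / 2) n) * s powr (-9/10)"
    if s: "s \<in> {0<..t}" for s
  proof -
    have "\<bar>exp (growth n * (t - s)) * X s\<bar> \<le> exp (growth n * (t - s)) * (K * s powr (-9/10) * exp_weight (\<mu> * s / 2) n)"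
      unfolding abs_mult using X[OF s] by simp
    also have "\<dots> = K * s powr (-9/10) * (exp (growth n * (t - s)) * exp_weight (\<mu> * s / 2) n)" by simp
    also have "\<dots> \<le> K * s powr (-9/10) * (exp 1 * exp_weight (\<mu> * t / 2) n)"
      using s t K by (intro mult_left_mono semigroup_decay) auto
    finally show ?thesis by (simp only: mult_ac)
  qed
  show "(\<lambda>s. exp (growth n * (t - s)) * X s) integrable_on {0..t}"
    by (rule singular_integral(1)[OF t(1) cont' le])
  have "\<bar>integral {0..t} (\<lambda>s. exp (growth n * (t - s)) * X s)\<bar>
      \<le> 10 * (exp 1 * K * exp_weight (\<mu> * t / 2) n) * t powr (1/10)"
    by (rule singular_integral(2)[OF t(1) cont' le])
  then show "\<bar>integral {0..t} (\<lambda>s. exp (growth n * (t - s)) * X s)\<bar>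
      \<le> 10 * exp 1 * K * t powr (1/10) * exp_weight (\<mu> * t / 2) n"
    by (simp only: mult_ac)
qed

lemma path_weight_cubed: "(t::real) > 0 \<Longrightarrow> (R * t powr (-3/10)) ^ 3 = R ^ 3 * t powr (-9/10)"
  by (simp add: power_mult_distrib powr_power)

lemma cube_path_bound:
  assumes "t > 0" and a: "\<And>n. \<bar>a n\<bar> \<le> R * path_weight t n"
  shows "\<bar>cube a n\<bar> \<le> conv_const\<^sup>2 * R ^ 3 * t powr (-9/10) * exp_weight (\<mu> * t / 2) n"
proof -
  have "\<bar>cube a n\<bar> \<le> conv_const\<^sup>2 * (R * t powr (-3/10)) ^ 3 * exp_weight (\<mu> * t / 2) n"
    by (rule cube_bound) (use a mu assms(1) in \<open>simp_all add: path_weight_def mult.assoc\<close>)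
  then show ?thesis using path_weight_cubed[OF assms(1), of R] by (simp add: mult_ac)
qed

lemma cube_path_diff:
  assumes "t > 0" and a: "\<And>n. \<bar>a n\<bar> \<le> R * path_weight t n" and b: "\<And>n. \<bar>b n\<bar> \<le> R * path_weight t n"
    and d: "\<And>n. \<bar>a n - b n\<bar> \<le> d * path_weight t n"
  shows "\<bar>cube a n - cube b n\<bar> \<le> 3 * conv_const\<^sup>2 * R\<^sup>2 * d * t powr (-9/10) * exp_weight (\<mu> * t / 2) n"
proof -
  let ?p = "t powr (-3/10)"
  have "\<bar>cube a n - cube b n\<bar> \<le> 3 * conv_const\<^sup>2 * (R * ?p)\<^sup>2 * (d * ?p) * exp_weight (\<mu> * t / 2) n"
    by (rule cube_diff) (use a b d mu assms(1) in \<open>simp_all add: path_weight_def mult.assoc\<close>)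
  also have "\<dots> = 3 * conv_const\<^sup>2 * R\<^sup>2 * d * ?p ^ 3 * exp_weight (\<mu> * t / 2) n"
    by (simp add: power2_eq_square power3_eq_cube)
  also have "?p ^ 3 = t powr (-9/10)" using path_weight_cubed[OF assms(1), of 1] by simp
  finally show ?thesis .
qed

lemma cube_path_continuous:
  assumes "admissible \<tau> R a"
  shows "continuous_on {0<..\<tau>} (\<lambda>t. cube (a t) n)"
proof (rule continuous_on_half_open, rule continuous_on_cube)
  fix c :: real and n assume "0 < c"
  then show "continuous_on {c..\<tau>} (\<lambda>t. a t n)"
    using assms by (auto simp: admissible_def intro: continuous_on_subset)
next
  fix c t n assume c: "(0::real) < c" "t \<in> {c..\<tau>}"
  then have t: "t \<in> {0<..\<tau>}" by auto
  have "\<bar>a t n\<bar> \<le> R * path_weight t n" using assms t by (auto simp: admissible_def)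
  moreover from this have "R \<ge> 0"
    using path_weight_pos[of t n] t abs_ge_zero[of "a t n"] by (smt (verit) greaterThanAtMost_iff mult_neg_pos)
  ultimately show "\<bar>a t n\<bar> \<le> (R * c powr (-3/10)) * exp_weight 0 n"
    using path_weight_le[of c t n] c by (smt (verit) atLeastAtMost_iff mult.assoc mult_left_mono)
qed

lemma admissible_mono: "admissible \<tau> R a \<Longrightarrow> t \<le> \<tau> \<Longrightarrow> admissible t R a"
  by (auto simp: admissible_def intro: continuous_on_subset)

lemma duhamel_bound:
  assumes a: "admissible \<tau> R a" and t: "t \<in> {0<..\<tau>}" and "\<tau> \<le> 1"
  shows "(\<lambda>s. exp (growth n * (t - s)) * cube (a s) n) integrable_on {0..t}"
    and "\<bar>duhamel a t n\<bar> \<le> 10 * exp 1 * (conv_const\<^sup>2 * R ^ 3) * t powr (1/10) * exp_weight (\<mu> * t / 2) n"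
proof -
  have t': "0 < t" "t \<le> 1" using t assms(3) by auto
  have cont: "continuous_on {0<..t} (\<lambda>s. cube (a s) n)"
    using t by (intro cube_path_continuous[OF admissible_mono[OF a]]) auto
  have bd: "\<bar>cube (a s) n\<bar> \<le> (conv_const\<^sup>2 * R ^ 3) * s powr (-9/10) * exp_weight (\<mu> * s / 2) n" if "s \<in> {0<..t}" for s
    using that t a by (intro cube_path_bound) (auto simp: admissible_def)
  show "(\<lambda>s. exp (growth n * (t - s)) * cube (a s) n) integrable_on {0..t}"
    by (rule duhamel_integral(1)[OF t' cont bd])
  show "\<bar>duhamel a t n\<bar> \<le> 10 * exp 1 * (conv_const\<^sup>2 * R ^ 3) * t powr (1/10) * exp_weight (\<mu> * t / 2) n"
    unfolding duhamel_def by (rule duhamel_integral(2)[OF t' cont bd])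
qed

text \<open>The time integral of the cubic term gains \<open>t powr (1/10)\<close>, against the admitted \<open>t powr (-3/10)\<close>; the
surplus \<open>\<tau> powr (2/5)\<close> makes the Duhamel operator a contraction on short intervals.\<close>

lemma duhamel_diff:
  assumes a: "admissible \<tau> R a" and b: "admissible \<tau> R b" and t: "t \<in> {0<..\<tau>}" and "\<tau> \<le> 1"
    and d: "\<And>s n. s \<in> {0<..\<tau>} \<Longrightarrow> \<bar>a s n - b s n\<bar> \<le> d * path_weight s n" "d \<ge> 0"
  shows "\<bar>duhamel a t n - duhamel b t n\<bar> \<le> 30 * exp 1 * conv_const\<^sup>2 * R\<^sup>2 * \<tau> powr (2/5) * d * path_weight t n"
proof -
  have t': "0 < t" "t \<le> 1" using t assms(4) by auto
  have cont: "continuous_on {0<..t} (\<lambda>s. cube (a s) n - cube (b s) n)"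
    using t by (intro continuous_on_diff cube_path_continuous[OF admissible_mono[OF a]]
        cube_path_continuous[OF admissible_mono[OF b]]) auto
  have bd: "\<bar>cube (a s) n - cube (b s) n\<bar>
      \<le> (3 * conv_const\<^sup>2 * R\<^sup>2 * d) * s powr (-9/10) * exp_weight (\<mu> * s / 2) n" if "s \<in> {0<..t}" for s
    using that t a b d by (intro cube_path_diff) (auto simp: admissible_def)
  have "duhamel a t n - duhamel b t n
      = integral {0..t} (\<lambda>s. exp (growth n * (t - s)) * cube (a s) n - exp (growth n * (t - s)) * cube (b s) n)"
    unfolding duhamel_def
    by (rule Henstock_Kurzweil_Integration.integral_diff[symmetric])
       (rule duhamel_bound(1)[OF a t assms(4)] duhamel_bound(1)[OF b t assms(4)])+
  also have "\<dots> = integral {0..t} (\<lambda>s. exp (growth n * (t - s)) * (cube (a s) n - cube (b s) n))"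
    by (simp only: right_diff_distrib)
  also have "\<bar>\<dots>\<bar> \<le> 10 * exp 1 * (3 * conv_const\<^sup>2 * R\<^sup>2 * d) * t powr (1/10) * exp_weight (\<mu> * t / 2) n"
    by (rule duhamel_integral(2)[OF t' cont bd])
  also have "\<dots> = 30 * exp 1 * conv_const\<^sup>2 * R\<^sup>2 * t powr (2/5) * d * path_weight t n"
  proof -
    have "t powr (1/10) = t powr (2/5) * t powr (-3/10)" by (simp flip: powr_add)
    then show ?thesis by (simp add: path_weight_def mult_ac)
  qed
  also have "\<dots> \<le> 30 * exp 1 * conv_const\<^sup>2 * R\<^sup>2 * \<tau> powr (2/5) * d * path_weight t n"
    using t path_weight_pos[of t n] d
    by (intro mult_right_mono mult_left_mono powr_mono2) auto
  finally show ?thesis .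
qed

lemma duhamel_has_derivative:
  assumes a: "admissible \<tau> R a" and t: "t \<in> {0<..\<tau>}" and tau: "\<tau> \<le> 1"
  shows "((\<lambda>t. duhamel a t n) has_real_derivative growth n * duhamel a t n + cube (a t) n)
    (at t within {0<..\<tau>})"
proof -
  define h where "h s = exp (- growth n * s) * cube (a s) n" for s
  have factor: "exp (growth n * (r - s)) * cube (a s) n = exp (growth n * r) * h s" for r s
    by (simp add: h_def algebra_simps flip: exp_add)
  have duh: "duhamel a r n = exp (growth n * r) * integral {0..r} h" for r
    unfolding duhamel_def factor by simp
  have hint: "h integrable_on {0..r}" if "r \<in> {0<..\<tau>}" for r
    using integrable_cmul[OF duhamel_bound(1)[OF a that tau, of n, unfolded factor], of "exp (- growth n * r)"]
    by (simp add: exp_minus)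
  \<comment> \<open>Split the integral at \<open>c\<close>: its singular part near zero does not depend on the upper limit.\<close>
  define c where "c = t / 2"
  have c: "0 < c" "c < t" "c < \<tau>" using t by (auto simp: c_def)
  have conth: "continuous_on {c..\<tau>} h"
    unfolding h_def using c
    by (intro continuous_intros continuous_on_subset[OF cube_path_continuous[OF a]]) auto
  have "((\<lambda>r. integral {c..r} h) has_real_derivative h t) (at t within {c..\<tau>})"
    by (rule integral_has_real_derivative[OF conth]) (use c t in auto)
  then have "((\<lambda>r. integral {0..c} h + integral {c..r} h) has_real_derivative h t) (at t within {c..\<tau>})"
    by (auto intro!: derivative_eq_intros)
  then have "((\<lambda>r. integral {0..r} h) has_real_derivative h t) (at t within {c..\<tau>})"
  proof (rule has_field_derivative_transform_within[OF _ zero_less_one])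
    fix r assume "r \<in> {c..\<tau>}"
    then show "integral {0..c} h + integral {c..r} h = integral {0..r} h"
      using c by (intro Henstock_Kurzweil_Integration.integral_combine hint) auto
  qed (use c t in auto)
  also have "at t within {c..\<tau>} = at t within {0<..\<tau>}"
    by (rule at_within_nhd[of _ "{c<..}"]) (use c t in auto)
  finally have "((\<lambda>r. exp (growth n * r) * integral {0..r} h) has_real_derivative
      growth n * (exp (growth n * t) * integral {0..t} h) + exp (growth n * t) * h t) (at t within {0<..\<tau>})"
    by (auto intro!: derivative_eq_intros)
  moreover have "exp (growth n * t) * h t = cube (a t) n"
    using factor[of t t] by simp
  ultimately show ?thesis unfolding duh by simp
qed

text \<open>Half of the heat exponent is kept for the exponential weight; the other half, \<open>x = \<mu> n\<^sup>2 t / 2\<close>, is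
traded for \<open>x powr (-3/10)\<close>, which supplies both the time singularity and the extra decay in \<open>n\<close>.\<close>

lemma linpart_bound:
  assumes t: "0 < t" "t \<le> 1"
  shows "\<bar>linpart t n\<bar> \<le> 4 * exp 1 * (\<mu> / 2) powr (-3/10) * path_weight t n"
proof (cases "n = 0")
  case True
  then show ?thesis using path_weight_pos[of t n] t by (simp add: linpart_def init_coeff_def)
next
  case False
  define m where "m = \<bar>real_of_int n\<bar>"
  have m: "m \<ge> 1" using False by (simp add: m_def)
  define x where "x = \<mu> / 2 * m\<^sup>2 * t"
  have x: "x > 0" using mu m t by (simp add: x_def)
  have "x powr (3/10) * exp (- x) \<le> 1" using x by (intro powr_mult_exp_le_1) auto
  then have ex: "exp (- x) \<le> x powr (-3/10)"
    using x by (simp add: powr_minus field_simps)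
  have xp: "x powr (-3/10) = (\<mu> / 2) powr (-3/10) * m powr (-6/10) * t powr (-3/10)"
  proof -
    have "(m\<^sup>2) powr (-3/10) = m powr (-6/10)"
      using m by (simp add: powr_powr flip: powr_numeral)
    moreover have "x powr (-3/10) = (\<mu> / 2) powr (-3/10) * (m\<^sup>2) powr (-3/10) * t powr (-3/10)"
      unfolding x_def by (simp only: powr_mult)
    ultimately show ?thesis by simp
  qed
  have "m \<le> m\<^sup>2" using m by (simp add: power2_eq_square)
  then have "\<mu> * t / 2 * m \<le> x"
    using mu t by (simp add: x_def mult_ac)
  moreover have "growth n * t = t - 2 * x" by (simp add: growth_def x_def m_def algebra_simps)
  ultimately have "growth n * t \<le> 1 + (- x) + (- (\<mu> * t / 2) * m)"
    using t by simp
  then have "exp (growth n * t) \<le> exp 1 * exp (- x) * exp (- (\<mu> * t / 2) * m)"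
    by (simp only: exp_add[symmetric] exp_le_cancel_iff)
  also have "\<dots> \<le> exp 1 * x powr (-3/10) * exp (- (\<mu> * t / 2) * m)"
    using ex by (intro mult_right_mono mult_left_mono) auto
  finally have "m powr (-1/2) * exp (growth n * t)
      \<le> m powr (-1/2) * (exp 1 * x powr (-3/10) * exp (- (\<mu> * t / 2) * m))"
    by (rule mult_left_mono) auto
  also have "\<dots> = (m powr (-1/2) * m powr (-6/10)) * (exp 1 * (\<mu> / 2) powr (-3/10) * t powr (-3/10) *
      exp (- (\<mu> * t / 2) * m))"
    unfolding xp by (simp only: mult_ac)
  also have "m powr (-1/2) * m powr (-6/10) = m powr (-11/10)" by (simp flip: powr_add)
  also have "m powr (-11/10) \<le> 4 * poly_weight n"
  proof -
    have "m powr (-11/10) \<le> ((1 + m) / 2) powr (-11/10)"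
      using m by (intro powr_mono2') auto
    also have "\<dots> = 2 powr (11/10) * poly_weight n"
      using m by (simp add: poly_weight_def powr_divide powr_minus divide_simps flip: m_def)
    also have "\<dots> \<le> 2 powr 2 * poly_weight n"
      using poly_weight_pos[of n] by (intro mult_right_mono powr_mono) auto
    finally show ?thesis by simp
  qed
  finally have "m powr (-1/2) * exp (growth n * t) \<le> 4 * poly_weight n * (exp 1 * (\<mu> / 2) powr (-3/10) * t powr (-3/10) *
      exp (- (\<mu> * t / 2) * m))" by (simp add: mult_right_mono)
  moreover have "\<bar>linpart t n\<bar> = m powr (-1/2) * exp (growth n * t)"
    using False by (simp add: linpart_def init_coeff_def abs_mult m_def sgn_if)
  ultimately show ?thesis by (simp add: path_weight_def exp_weight_def m_def mult_ac)
qed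

end

text \<open>This gives the limit of the Picard iterates for each mode and each time separately.\<close>

lemma geometric_limit:
  fixes x :: "nat \<Rightarrow> real"
  assumes step: "\<And>j. \<bar>x (Suc j) - x j\<bar> \<le> c * (1/2) ^ j"
  shows "x \<longlonglongrightarrow> lim x" and "\<bar>lim x - x j\<bar> \<le> 2 * c * (1/2) ^ j"
proof -
  have "summable (\<lambda>j. c * (1/2) ^ j)"
    by (intro summable_mult summable_geometric) auto
  then have "summable (\<lambda>j. x (Suc j) - x j)"
    by (rule summable_comparison_test'[of _ 0]) (use step in auto)
  then have "convergent (\<lambda>n. x n - x 0)"
    by (simp add: summable_iff_convergent sum_lessThan_telescope)
  then have "convergent x" by (simp add: convergent_diff_const_right_iff)
  then show lim: "x \<longlonglongrightarrow> lim x" by (simp add: convergent_LIMSEQ_iff)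
  have c: "c \<ge> 0" using step[of 0] by simp
  have tail: "\<bar>x (j + m) - x j\<bar> \<le> 2 * c * ((1/2) ^ j - (1/2) ^ (j + m))" for m
  proof (induction m)
    case (Suc m)
    have "\<bar>x (j + Suc m) - x j\<bar> \<le> \<bar>x (Suc (j + m)) - x (j + m)\<bar> + \<bar>x (j + m) - x j\<bar>" by simp
    also have "\<dots> \<le> c * (1/2) ^ (j + m) + 2 * c * ((1/2) ^ j - (1/2) ^ (j + m))"
      by (intro add_mono step Suc)
    also have "\<dots> = 2 * c * ((1/2) ^ j - (1/2) ^ (j + Suc m))" by (simp add: algebra_simps)
    finally show ?case .
  qed simp
  have "(\<lambda>m. \<bar>x (j + m) - x j\<bar>) \<longlonglongrightarrow> \<bar>lim x - x j\<bar>"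
    using LIMSEQ_ignore_initial_segment[OF lim, of j] by (intro tendsto_intros) (simp add: add.commute)
  then show "\<bar>lim x - x j\<bar> \<le> 2 * c * (1/2) ^ j"
  proof (rule tendsto_upperbound)
    have "\<bar>x (j + m) - x j\<bar> \<le> 2 * c * (1/2) ^ j" for m
    proof -
      have "2 * c * ((1/2) ^ j - (1/2) ^ (j + m)) \<le> 2 * c * (1/2) ^ j"
        using c by (intro mult_left_mono) auto
      with tail[of m] show ?thesis by simp
    qed
    then show "\<forall>\<^sub>F m in sequentially. \<bar>x (j + m) - x j\<bar> \<le> 2 * c * (1/2) ^ j" by simp
  qed simp
qed

context rough_data
begin

primrec picard :: "nat \<Rightarrow> real \<Rightarrow> int \<Rightarrow> real" where
  "picard 0 = (\<lambda>t n. 0)"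
| "picard (Suc j) = (\<lambda>t n. linpart t n + duhamel (picard j) t n)"

lemma duhamel_zero: "duhamel (\<lambda>t n. 0) t n = 0"
  by (simp add: duhamel_def cube_def conv_def)

lemma duhamel_odd:
  assumes "\<And>t n. a t (- n) = - a t n"
  shows "duhamel a t (- n) = - duhamel a t n"
proof -
  have "cube (a s) (- n) = - cube (a s) n" for s
    by (rule cube_odd) (rule assms)
  then show ?thesis by (simp add: duhamel_def growth_def)
qed

lemma picard_odd: "picard j t (- n) = - picard j t n"
proof (induction j arbitrary: t n)
  case (Suc j)
  then show ?case using duhamel_odd[of "picard j" t n]
    by (simp add: linpart_def init_coeff_def growth_def sgn_minus)
qed simp

lemma admissible_linpart_duhamel:
  assumes a: "admissible \<tau> R a" and tau: "\<tau> \<le> 1"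
    and bd: "\<And>t n. t \<in> {0<..\<tau>} \<Longrightarrow> \<bar>linpart t n + duhamel a t n\<bar> \<le> R * path_weight t n"
  shows "admissible \<tau> R (\<lambda>t n. linpart t n + duhamel a t n)"
  unfolding admissible_def
proof (intro conjI allI ballI bd)
  fix n
  have "continuous_on {0<..\<tau>} (\<lambda>t. duhamel a t n)"
    using duhamel_has_derivative[OF a _ tau] by (rule DERIV_continuous_on)
  then show "continuous_on {0<..\<tau>} (\<lambda>t. linpart t n + duhamel a t n)"
    unfolding linpart_def by (intro continuous_intros)
qed

text \<open>Picard iteration with halving errors, measured pointwise against \<open>path_weight\<close>; oddness is inherited from the
initial data by all iterates.\<close>

lemma fixed_point_exists:
  obtains \<tau> R a where "0 < \<tau>" "\<tau> \<le> 1" "admissible \<tau> R a"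
    "\<And>t n. t \<in> {0<..\<tau>} \<Longrightarrow> a t (- n) = - a t n"
    "\<And>t n. t \<in> {0<..\<tau>} \<Longrightarrow> a t n = linpart t n + duhamel a t n"
proof -
  define R0 where "R0 = 4 * exp 1 * (\<mu> / 2) powr (-3/10)"
  have R0: "R0 > 0" using mu by (simp add: R0_def)
  define R where "R = 2 * R0"
  have R: "R > 0" using R0 by (simp add: R_def)
  define K where "K = 30 * exp 1 * conv_const\<^sup>2 * R\<^sup>2"
  have K: "K > 0" using R conv_const_pos by (simp add: K_def)
  \<comment> \<open>Up to the cap at 1, the largest time for which the contraction factor \<open>K \<tau> powr (2/5)\<close> is at most one half.\<close>
  define \<tau> where "\<tau> = min 1 ((1 / (2 * K)) powr (5/2))"
  have tau: "0 < \<tau>" "\<tau> \<le> 1" using K by (auto simp: \<tau>_def)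
  have "\<tau> powr (2/5) \<le> ((1 / (2 * K)) powr (5/2)) powr (2/5)"
    using tau by (intro powr_mono2) (auto simp: \<tau>_def)
  also have "\<dots> = 1 / (2 * K)" using K by (simp add: powr_powr)
  finally have small: "K * \<tau> powr (2/5) \<le> 1 / 2" using K by (simp add: field_simps)
  have contr: "\<bar>duhamel a t n - duhamel b t n\<bar> \<le> d / 2 * path_weight t n"
    if "admissible \<tau> R a" "admissible \<tau> R b" "t \<in> {0<..\<tau>}" "d \<ge> 0"
      and d: "\<And>s n. s \<in> {0<..\<tau>} \<Longrightarrow> \<bar>a s n - b s n\<bar> \<le> d * path_weight s n" for a b t n d
  proof -
    have "\<bar>duhamel a t n - duhamel b t n\<bar> \<le> K * \<tau> powr (2/5) * d * path_weight t n"
      unfolding K_def by (rule duhamel_diff[OF that(1-3) tau(2) d that(4)])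
    also have "\<dots> \<le> 1 / 2 * d * path_weight t n"
      using path_weight_pos[of t n] that(3,4) small by (intro mult_right_mono) auto
    finally show ?thesis by simp
  qed
  have lin: "\<bar>linpart t n\<bar> \<le> R0 * path_weight t n" if "t \<in> {0<..\<tau>}" for t n
    unfolding R0_def using that tau by (intro linpart_bound) auto
  have adm0: "admissible \<tau> R (\<lambda>t n. 0)"
    using R path_weight_pos by (auto simp: admissible_def less_imp_le)
  have adm_step: "admissible \<tau> R (\<lambda>t n. linpart t n + duhamel a t n)" if a: "admissible \<tau> R a" for a
  proof (rule admissible_linpart_duhamel[OF a tau(2)])
    fix t n assume t: "t \<in> {0<..\<tau>}"
    have "\<bar>duhamel a t n - duhamel (\<lambda>t n. 0) t n\<bar> \<le> R / 2 * path_weight t n"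
      using a R by (intro contr adm0 t) (auto simp: admissible_def)
    then show "\<bar>linpart t n + duhamel a t n\<bar> \<le> R * path_weight t n"
      using lin[OF t, of n] abs_triangle_ineq[of "linpart t n" "duhamel a t n"]
      by (simp add: duhamel_zero R_def)
  qed
  have adm: "admissible \<tau> R (picard j)" for j
    by (induction j) (simp_all add: adm0 adm_step)
  have diff: "\<bar>picard (Suc j) t n - picard j t n\<bar> \<le> (R * path_weight t n) * (1/2) ^ j" if "t \<in> {0<..\<tau>}" for j t n
    using that
  proof (induction j arbitrary: t n)
    case 0
    have "\<bar>picard (Suc 0) t n\<bar> \<le> R * path_weight t n"
      using adm[of "Suc 0"] 0 unfolding admissible_def by blast
    then show ?case by simp
  next
    case (Suc j)
    have "\<bar>duhamel (picard (Suc j)) t n - duhamel (picard j) t n\<bar> \<le> (R * (1/2) ^ j) / 2 * path_weight t n"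
    proof (rule contr[OF adm adm Suc.prems])
      show "0 \<le> R * (1/2) ^ j" using R by simp
      show "\<bar>picard (Suc j) s m - picard j s m\<bar> \<le> R * (1/2) ^ j * path_weight s m" if "s \<in> {0<..\<tau>}" for s m
        using Suc.IH[OF that, of m] by (simp add: mult_ac)
    qed
    then show ?case by (subst (1) picard.simps, subst (2) picard.simps) (simp add: mult_ac)
  qed
  define a where "a t n = lim (\<lambda>j. picard j t n)" for t n
  have lim: "(\<lambda>j. picard j t n) \<longlonglongrightarrow> a t n" if "t \<in> {0<..\<tau>}" for t n
    unfolding a_def by (rule geometric_limit(1)[OF diff[OF that]])
  have err: "\<bar>a t n - picard j t n\<bar> \<le> (2 * R * (1/2) ^ j) * path_weight t n" if "t \<in> {0<..\<tau>}" for t n j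
    using geometric_limit(2)[OF diff[OF that, of _ n], of j] by (simp add: a_def mult_ac)
  have a_bound: "\<bar>a t n\<bar> \<le> R * path_weight t n" if "t \<in> {0<..\<tau>}" for t n
  proof (rule tendsto_upperbound)
    show "(\<lambda>j. \<bar>picard j t n\<bar>) \<longlonglongrightarrow> \<bar>a t n\<bar>" by (intro tendsto_intros lim that)
    show "\<forall>\<^sub>F j in sequentially. \<bar>picard j t n\<bar> \<le> R * path_weight t n"
      using adm that by (simp add: admissible_def)
  qed simp
  have a_cont: "continuous_on {0<..\<tau>} (\<lambda>t. a t n)" for n
  proof -
    \<comment> \<open>Convergence is uniform only after the singularity at time zero has been multiplied away.\<close>
    have "uniform_limit {0<..\<tau>} (\<lambda>j t. t powr (3/10) * picard j t n) (\<lambda>t. t powr (3/10) * a t n) sequentially"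
    proof (rule uniform_limitI)
      fix e :: real assume e: "e > 0"
      have "(\<lambda>j. 2 * R * (1/2) ^ j) \<longlonglongrightarrow> 2 * R * 0"
        by (intro tendsto_intros) auto
      then have "\<forall>\<^sub>F j in sequentially. 2 * R * (1/2) ^ j < e"
        using e by (intro order_tendstoD(2)[of _ "2 * R * 0"]) auto
      then show "\<forall>\<^sub>F j in sequentially. \<forall>t\<in>{0<..\<tau>}. dist (t powr (3/10) * picard j t n) (t powr (3/10) * a t n) < e"
      proof eventually_elim
        case (elim j)
        show ?case
        proof
          fix t assume t: "t \<in> {0<..\<tau>}"
          have "dist (t powr (3/10) * picard j t n) (t powr (3/10) * a t n)
              = t powr (3/10) * \<bar>a t n - picard j t n\<bar>"
            unfolding dist_real_def right_diff_distrib[symmetric] abs_mult by (simp add: abs_minus_commute)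
          also have "\<dots> \<le> t powr (3/10) * ((2 * R * (1/2) ^ j) * path_weight t n)"
            by (intro mult_left_mono err t) auto
          also have "\<dots> = (2 * R * (1/2) ^ j) * exp_weight (\<mu> * t / 2) n"
            using t by (simp add: path_weight_def flip: powr_add)
          also have "\<dots> \<le> (2 * R * (1/2) ^ j) * 1"
            using R mu t exp_weight_le_poly_weight[of "\<mu> * t / 2" n] poly_weight_le_1[of n] by (intro mult_left_mono) auto
          finally show "dist (t powr (3/10) * picard j t n) (t powr (3/10) * a t n) < e"
            using elim by simp
        qed
      qed
    qed
    then have "continuous_on {0<..\<tau>} (\<lambda>t. t powr (3/10) * a t n)"
    proof (rule uniform_limit_theorem[rotated])
      have "continuous_on {0<..\<tau>} (\<lambda>t. picard j t n)" for j
        using adm by (simp add: admissible_def)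
      then show "\<forall>\<^sub>F j in sequentially. continuous_on {0<..\<tau>} (\<lambda>t. t powr (3/10) * picard j t n)"
        by (intro always_eventually allI continuous_intros) auto
    qed simp
    moreover have "continuous_on {0<..\<tau>} (\<lambda>t. t powr (-3/10))"
      by (intro continuous_intros) auto
    ultimately have "continuous_on {0<..\<tau>} (\<lambda>t. t powr (-3/10) * (t powr (3/10) * a t n))"
      by (rule continuous_on_mult[rotated])
    then show ?thesis
      by (rule continuous_on_eq) (simp flip: mult.assoc powr_add)
  qed
  have adm_a: "admissible \<tau> R a"
    unfolding admissible_def using a_cont a_bound by blast
  show thesis
  proof (rule that[OF tau adm_a])
    fix t n assume t: "t \<in> {0<..\<tau>}"
    have "(\<lambda>j. - picard j t n) \<longlonglongrightarrow> - a t n" by (intro tendsto_intros lim t)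
    then show "a t (- n) = - a t n"
      using lim[OF t, of "- n"] LIMSEQ_unique by (simp add: picard_odd)
    have "(\<lambda>j. duhamel a t n - duhamel (picard j) t n) \<longlonglongrightarrow> 0"
    proof (rule Lim_null_comparison)
      show "(\<lambda>j. (2 * R * (1/2) ^ j) / 2 * path_weight t n) \<longlonglongrightarrow> 0"
        by (intro tendsto_eq_intros LIMSEQ_power_zero) auto
      show "\<forall>\<^sub>F j in sequentially. norm (duhamel a t n - duhamel (picard j) t n) \<le> (2 * R * (1/2) ^ j) / 2 * path_weight t n"
      proof (rule always_eventually, rule allI)
        fix j
        show "norm (duhamel a t n - duhamel (picard j) t n) \<le> (2 * R * (1/2) ^ j) / 2 * path_weight t n"
          unfolding real_norm_def by (rule contr[OF adm_a adm t _ err]) (use R in auto)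
      qed
    qed
    then have "(\<lambda>j. linpart t n + (duhamel a t n - (duhamel a t n - duhamel (picard j) t n)))
        \<longlonglongrightarrow> linpart t n + (duhamel a t n - 0)"
      by (intro tendsto_intros)
    then have "(\<lambda>j. picard (Suc j) t n) \<longlonglongrightarrow> linpart t n + duhamel a t n" by simp
    moreover have "(\<lambda>j. picard (Suc j) t n) \<longlonglongrightarrow> a t n"
      using lim[OF t] by (rule LIMSEQ_Suc)
    ultimately show "a t n = linpart t n + duhamel a t n"
      using LIMSEQ_unique by blast
  qed
qed

lemma rough_solution:
  obtains \<tau> R a where "0 < \<tau>"
    "\<And>t n. 0 < t \<Longrightarrow> t < \<tau> \<Longrightarrow>
      ((\<lambda>t. a t n) has_real_derivative (1 - \<mu> * (real_of_int n)\<^sup>2) * a t n + cube (a t) n) (at t)"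
    "\<And>t n. 0 < t \<Longrightarrow> t < \<tau> \<Longrightarrow> \<bar>a t n\<bar> \<le> R * t powr (-3/10) * exp_weight (\<mu> * t / 2) n"
    "\<And>t n. 0 < t \<Longrightarrow> t < \<tau> \<Longrightarrow> a t (- n) = - a t n"
    "\<And>n. ((\<lambda>t. a t n) \<longlongrightarrow> init_coeff n) (at_right 0)"
proof (rule fixed_point_exists)
  fix \<tau> R :: real and a :: "real \<Rightarrow> int \<Rightarrow> real"
  assume tau: "0 < \<tau>" "\<tau> \<le> 1" and adm: "admissible \<tau> R a"
    and odd: "\<And>t n. t \<in> {0<..\<tau>} \<Longrightarrow> a t (- n) = - a t n"
    and eq: "\<And>t n. t \<in> {0<..\<tau>} \<Longrightarrow> a t n = linpart t n + duhamel a t n"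
  show thesis
  proof (rule that[OF tau(1)])
    fix t n assume t: "0 < t" "t < \<tau>"
    have "((\<lambda>t. duhamel a t n) has_real_derivative growth n * duhamel a t n + cube (a t) n) (at t within {0<..\<tau>})"
      by (rule duhamel_has_derivative[OF adm _ tau(2)]) (use t in auto)
    moreover have "at t within {0<..\<tau>} = at t"
      by (rule at_within_open_subset[of _ "{0<..<\<tau>}"]) (use t in auto)
    ultimately have "((\<lambda>t. linpart t n + duhamel a t n) has_real_derivative
        growth n * (linpart t n + duhamel a t n) + cube (a t) n) (at t)"
      unfolding linpart_def by (auto intro!: derivative_eq_intros simp: algebra_simps)
    then have "((\<lambda>t. a t n) has_real_derivative growth n * (linpart t n + duhamel a t n) + cube (a t) n) (at t)"
      by (rule has_field_derivative_transform_within_open[of _ _ _ "{0<..<\<tau>}"]) (use t eq in auto)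
    then show "((\<lambda>t. a t n) has_real_derivative (1 - \<mu> * (real_of_int n)\<^sup>2) * a t n + cube (a t) n) (at t)"
      using eq[of t n] t by (simp add: growth_def)
    show "\<bar>a t n\<bar> \<le> R * t powr (-3/10) * exp_weight (\<mu> * t / 2) n"
      using adm t by (auto simp: admissible_def path_weight_def mult.assoc)
    show "a t (- n) = - a t n" using odd t by simp
  next
    fix n
    let ?C = "10 * exp 1 * (conv_const\<^sup>2 * R ^ 3)"
    have near: "\<forall>\<^sub>F t in at_right 0. t \<in> {0<..<\<tau>}"
      using tau by (intro eventually_at_rightI[of 0 \<tau>]) auto
    have R: "R \<ge> 0"
      using adm path_weight_pos[of \<tau> 0] tau abs_ge_zero[of "a \<tau> 0"] unfolding admissible_def
      by (smt (verit) greaterThanAtMost_iff mult_neg_pos)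
    have "((\<lambda>t. duhamel a t n) \<longlongrightarrow> 0) (at_right 0)"
    proof (rule Lim_null_comparison)
      show "((\<lambda>t::real. ?C * t powr (1/10)) \<longlongrightarrow> 0) (at_right 0)"
      proof (rule tendsto_mult_right_zero)
        have "((\<lambda>t::real. t powr (1/10)) \<longlongrightarrow> 0 powr (1/10)) (at_right 0)"
          by (rule tendsto_powr'[OF tendsto_ident_at tendsto_const])
             (auto intro: eventually_mono[OF eventually_at_right_less])
        then show "((\<lambda>t::real. t powr (1/10)) \<longlongrightarrow> 0) (at_right 0)" by simp
      qed
      show "\<forall>\<^sub>F t in at_right 0. norm (duhamel a t n) \<le> ?C * t powr (1/10)"
        using near
      proof eventually_elim
        case (elim t)
        then have "\<bar>duhamel a t n\<bar> \<le> ?C * t powr (1/10) * exp_weight (\<mu> * t / 2) n"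
          by (intro duhamel_bound(2)[OF adm _ tau(2)]) auto
        also have "\<dots> \<le> ?C * t powr (1/10) * 1"
          using R mu elim exp_weight_le_poly_weight[of "\<mu> * t / 2" n] poly_weight_le_1[of n] by (intro mult_left_mono) auto
        finally show ?case by simp
      qed
    qed
    moreover have "((\<lambda>t. linpart t n) \<longlongrightarrow> init_coeff n * exp (growth n * 0)) (at_right 0)"
      unfolding linpart_def by (intro tendsto_intros)
    ultimately have "((\<lambda>t. linpart t n + duhamel a t n) \<longlongrightarrow> init_coeff n * exp (growth n * 0) + 0) (at_right 0)"
      by (intro tendsto_add)
    then have lim: "((\<lambda>t. linpart t n + duhamel a t n) \<longlongrightarrow> init_coeff n) (at_right 0)"
      by simp
    have "\<forall>\<^sub>F t in at_right 0. linpart t n + duhamel a t n = a t n"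
      using near by eventually_elim (use eq in auto)
    with lim show "((\<lambda>t. a t n) \<longlongrightarrow> init_coeff n) (at_right 0)"
      by (rule Lim_transform_eventually)
  qed
qed

end

section \<open>Sine series\<close>

lemma continuous_on_suminf_pair:
  fixes h :: "nat \<Rightarrow> real \<Rightarrow> real \<Rightarrow> real"
  assumes cont: "\<And>n. continuous_on ({0<..<\<tau>} \<times> UNIV) (\<lambda>(t, x). h n t x)"
    and maj: "\<And>\<delta>. 0 < \<delta> \<Longrightarrow> summable (M \<delta>)"
    and bd: "\<And>\<delta> t x n. 0 < \<delta> \<Longrightarrow> \<delta> \<le> t \<Longrightarrow> t < \<tau> \<Longrightarrow> \<bar>h n t x\<bar> \<le> M \<delta> n"
  shows "continuous_on ({0<..<\<tau>} \<times> UNIV) (\<lambda>(t, x). \<Sum>n. h n t x)"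
proof (rule continuous_at_imp_continuous_on, rule ballI)
  fix p :: "real \<times> real" assume "p \<in> {0<..<\<tau>} \<times> UNIV"
  then obtain t x where p: "p = (t, x)" "0 < t" "t < \<tau>" by auto
  define V where "V = {t/2<..<\<tau>} \<times> (UNIV :: real set)"
  have V: "open V" "p \<in> V" using p by (auto simp: V_def open_Times)
  have "uniform_limit V (\<lambda>N p. \<Sum>n<N. h n (fst p) (snd p)) (\<lambda>p. \<Sum>n. h n (fst p) (snd p)) sequentially"
    by (rule Weierstrass_m_test[of _ _ "M (t/2)"])
       (use p maj[of "t/2"] bd[of "t/2"] in \<open>auto simp: V_def\<close>)
  then have "continuous_on V (\<lambda>p. \<Sum>n. h n (fst p) (snd p))"
  proof (rule uniform_limit_theorem[rotated])
    have "continuous_on V (\<lambda>p. h n (fst p) (snd p))" for n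
    proof -
      have "V \<subseteq> {0<..<\<tau>} \<times> UNIV" using p by (force simp: V_def)
      from continuous_on_subset[OF cont[of n] this] show ?thesis by (simp add: case_prod_unfold)
    qed
    then show "\<forall>\<^sub>F N in sequentially. continuous_on V (\<lambda>p. \<Sum>n<N. h n (fst p) (snd p))"
      by (intro always_eventually allI continuous_on_sum)
  qed simp
  then show "isCont (\<lambda>(t, x). \<Sum>n. h n t x) p"
    using V by (simp add: continuous_on_eq_continuous_at case_prod_unfold)
qed

lemma integral_cos_multiple:
  assumes L: "L > 0"
  shows "((\<lambda>x. cos (real_of_int j * (pi / L * x))) has_integral (if j = 0 then L else 0)) {0..L}"
proof (cases "j = 0")
  case True
  have "((\<lambda>x. 1::real) has_integral 1 * (L - 0)) {0..L}"
    using has_integral_const_real[of "1::real" 0 L] L by simp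
  then show ?thesis using True by simp
next
  case False
  define w where "w = real_of_int j * (pi / L)"
  have w: "w \<noteq> 0" "w * L = real_of_int j * pi" using False L by (auto simp: w_def)
  have "((\<lambda>x. cos (w * x)) has_integral sin (w * L) / w - sin (w * 0) / w) {0..L}"
    using L w by (intro fundamental_theorem_of_calculus)
      (auto intro!: derivative_eq_intros simp flip: has_real_derivative_iff_has_vector_derivative)
  moreover have "sin (w * L) = 0" unfolding w(2) by (simp add: sin_zero_iff_int2)
  ultimately show ?thesis using False by (simp add: w_def mult.assoc)
qed

lemma integral_sin_sin:
  assumes L: "L > 0" and m: "m > 0"
  shows "((\<lambda>x. sin (real i * (pi / L * x)) * sin (real m * (pi / L * x))) has_integral
    (if i = m then L / 2 else 0)) {0..L}"
proof -
  let ?c = "\<lambda>j x. cos (real_of_int j * (pi / L * x))"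
  have "((\<lambda>x. (?c (int i - int m) x - ?c (int i + int m) x) / 2) has_integral
      ((if int i - int m = 0 then L else 0) - (if int i + int m = 0 then L else 0)) / 2) {0..L}"
    by (intro has_integral_divide has_integral_diff integral_cos_multiple L)
  moreover have "(\<lambda>x. (?c (int i - int m) x - ?c (int i + int m) x) / 2)
      = (\<lambda>x. sin (real i * (pi / L * x)) * sin (real m * (pi / L * x)))"
    by (simp only: sin_times_sin of_int_diff of_int_add of_int_of_nat_eq left_diff_distrib distrib_right)
  moreover have "((if int i - int m = 0 then L else 0) - (if int i + int m = 0 then L else 0)) / 2
      = (if i = m then L / 2 else 0)"
    using m by simp
  ultimately show ?thesis by (simp only:)
qed

lemma sine_coefficient:
  fixes f :: "nat \<Rightarrow> real"
  assumes L: "L > 0" and m: "m > 0" and f: "summable (\<lambda>n. \<bar>f n\<bar>)"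
  shows "((\<lambda>x. (\<Sum>n. f n * sin (real n * (pi / L * x))) * sin (real m * (pi / L * x)))
    has_integral L / 2 * f m) {0..L}"
proof -
  let ?s = "\<lambda>n x. sin (real n * (pi / L * x))"
  have le: "\<bar>f n * ?s n x\<bar> \<le> \<bar>f n\<bar>" for n x by (simp add: abs_mult mult_left_le)
  have "uniform_limit {0..L} (\<lambda>N x. \<Sum>n<N. f n * ?s n x * ?s m x)
      (\<lambda>x. \<Sum>n. f n * ?s n x * ?s m x) sequentially"
  proof (rule Weierstrass_m_test[OF _ f])
    fix n x
    have "\<bar>f n * ?s n x * ?s m x\<bar> \<le> \<bar>f n\<bar> * 1"
      unfolding abs_mult[of "f n * ?s n x"] by (intro mult_mono le) auto
    then show "norm (f n * ?s n x * ?s m x) \<le> \<bar>f n\<bar>" by simp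
  qed
  from this obtain I J where I: "\<And>N. ((\<lambda>x. \<Sum>n<N. f n * ?s n x * ?s m x) has_integral I N) {0..L}"
    and J: "((\<lambda>x. \<Sum>n. f n * ?s n x * ?s m x) has_integral J) {0..L}" "I \<longlonglongrightarrow> J"
    by (rule uniform_limit_integral) (use L in \<open>auto intro!: continuous_intros\<close>)
  have "I N = (\<Sum>n<N. f n * (if n = m then L / 2 else 0))" for N
  proof (rule has_integral_unique[OF I])
    have "((\<lambda>x. \<Sum>n<N. f n * (?s n x * ?s m x)) has_integral (\<Sum>n<N. f n * (if n = m then L / 2 else 0))) {0..L}"
      by (intro has_integral_sum has_integral_mult_right integral_sin_sin L m) auto
    then show "((\<lambda>x. \<Sum>n<N. f n * ?s n x * ?s m x) has_integral (\<Sum>n<N. f n * (if n = m then L / 2 else 0))) {0..L}"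
      by (simp only: mult.assoc)
  qed
  then have "\<forall>\<^sub>F N in sequentially. I N = L / 2 * f m"
    by (intro eventually_mono[OF eventually_gt_at_top[of m]]) (auto simp: sum.delta' if_distrib cong: if_cong)
  then have "I \<longlonglongrightarrow> L / 2 * f m" by (rule tendsto_eventually)
  with J(2) have "J = L / 2 * f m" by (rule LIMSEQ_unique)
  moreover have "(\<Sum>n. f n * ?s n x * ?s m x) = (\<Sum>n. f n * ?s n x) * ?s m x" for x
    using summable_comparison_test'[OF f, of 0 "\<lambda>n. f n * ?s n x"] le
    by (intro suminf_mult2[symmetric]) auto
  ultimately show ?thesis using J(1) by (simp only:)
qed

text \<open>Expand the square of the difference between the series and its partial sum.\<close>

lemma bessel_sine:
  fixes f :: "nat \<Rightarrow> real"
  assumes L: "L > 0" and f: "summable (\<lambda>n. \<bar>f n\<bar>)"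
    and cont: "continuous_on {0..L} (\<lambda>x. \<Sum>n. f n * sin (real n * (pi / L * x)))"
  shows "L / 2 * (\<Sum>n\<in>{1..N}. (f n)\<^sup>2) \<le> integral {0..L} (\<lambda>x. (\<Sum>n. f n * sin (real n * (pi / L * x)))\<^sup>2)"
proof -
  let ?s = "\<lambda>n x. sin (real n * (pi / L * x))"
  define S where "S x = (\<Sum>n. f n * ?s n x)" for x
  define P where "P x = (\<Sum>n\<in>{1..N}. f n * ?s n x)" for x
  have contS: "continuous_on {0..L} S" using cont by (simp add: S_def)
  have contP: "continuous_on {0..L} P" unfolding P_def using L by (intro continuous_intros) auto
  have "((\<lambda>x. \<Sum>n\<in>{1..N}. f n * (S x * ?s n x)) has_integral (\<Sum>n\<in>{1..N}. f n * (L / 2 * f n))) {0..L}"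
    unfolding S_def
    by (intro has_integral_sum has_integral_mult_right sine_coefficient L f) auto
  then have SP: "((\<lambda>x. S x * P x) has_integral (\<Sum>n\<in>{1..N}. f n * (L / 2 * f n))) {0..L}"
    by (simp add: P_def sum_distrib_left mult_ac)
  have Ps: "((\<lambda>x. P x * ?s m x) has_integral L / 2 * f m) {0..L}" if m: "m \<in> {1..N}" for m
  proof -
    have "((\<lambda>x. \<Sum>n\<in>{1..N}. f n * (?s n x * ?s m x)) has_integral
        (\<Sum>n\<in>{1..N}. f n * (if n = m then L / 2 else 0))) {0..L}"
      using m by (intro has_integral_sum has_integral_mult_right integral_sin_sin L) auto
    moreover have "(\<Sum>n\<in>{1..N}. f n * (if n = m then L / 2 else 0)) = L / 2 * f m"
      using m by (simp add: sum.delta' if_distrib cong: if_cong)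
    moreover have "(\<Sum>n\<in>{1..N}. f n * (?s n x * ?s m x)) = P x * ?s m x" for x
      unfolding P_def sum_distrib_right mult.assoc ..
    ultimately show ?thesis by (simp only:)
  qed
  have "((\<lambda>x. \<Sum>n\<in>{1..N}. f n * (P x * ?s n x)) has_integral (\<Sum>n\<in>{1..N}. f n * (L / 2 * f n))) {0..L}"
    by (intro has_integral_sum has_integral_mult_right Ps) auto
  moreover have "(\<Sum>n\<in>{1..N}. f n * (P x * ?s n x)) = P x * P x" for x
  proof -
    have "(\<Sum>n\<in>{1..N}. f n * (P x * ?s n x)) = P x * (\<Sum>n\<in>{1..N}. f n * ?s n x)"
      unfolding sum_distrib_left by (simp only: mult_ac)
    then show ?thesis by (simp only: P_def)
  qed
  ultimately have PP: "((\<lambda>x. P x * P x) has_integral (\<Sum>n\<in>{1..N}. f n * (L / 2 * f n))) {0..L}"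
    by simp
  have SS: "((\<lambda>x. S x * S x) has_integral integral {0..L} (\<lambda>x. (S x)\<^sup>2)) {0..L}"
    unfolding power2_eq_square
    by (intro integrable_integral integrable_continuous_real continuous_intros contS)
  let ?q = "\<Sum>n\<in>{1..N}. f n * (L / 2 * f n)"
  have "((\<lambda>x. S x * S x - 2 * (S x * P x) + P x * P x) has_integral
      integral {0..L} (\<lambda>x. (S x)\<^sup>2) - 2 * ?q + ?q) {0..L}"
    by (intro has_integral_add has_integral_diff has_integral_mult_right SS SP PP)
  moreover have "(\<lambda>x. S x * S x - 2 * (S x * P x) + P x * P x) = (\<lambda>x. (S x - P x)\<^sup>2)"
    by (simp add: power2_eq_square algebra_simps)
  ultimately have "((\<lambda>x. (S x - P x)\<^sup>2) has_integral integral {0..L} (\<lambda>x. (S x)\<^sup>2) - 2 * ?q + ?q) {0..L}"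
    by simp
  then have "0 \<le> integral {0..L} (\<lambda>x. (S x)\<^sup>2) - 2 * ?q + ?q"
    by (rule has_integral_nonneg) auto
  moreover have "?q = L / 2 * (\<Sum>n\<in>{1..N}. (f n)\<^sup>2)"
    by (simp add: sum_distrib_left power2_eq_square mult_ac)
  ultimately show ?thesis by (simp add: S_def)
qed

text \<open>With \<open>y = 1 + n\<close>, the exponential is at most \<open>(6 / (c y))\<^sup>6\<close> up to a constant factor, which leaves
\<open>1 / y\<^sup>2\<close>.\<close>

lemma summable_poly_exp:
  assumes c: "c > 0"
  shows "summable (\<lambda>n. (1 + real n) ^ 4 * exp (- c * real n))"
proof (rule summable_comparison_test'[of _ 0])
  have "summable (\<lambda>n. inverse ((real (Suc n))\<^sup>2))"
    by (subst summable_Suc_iff[of "\<lambda>n. inverse ((real n)\<^sup>2)"]) (rule inverse_power_summable, simp)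
  then show "summable (\<lambda>n. exp c * (6 / c) ^ 6 * inverse ((real (Suc n))\<^sup>2))"
    by (rule summable_mult)
next
  fix n :: nat
  define y where "y = 1 + real n"
  have y: "y > 0" by (simp add: y_def)
  have "c * y / 6 * exp (- (c * y / 6)) \<le> 1"
    using powr_mult_exp_le_1[of "c * y / 6" 1] c y by simp
  then have "((c * y / 6) * exp (- (c * y / 6))) ^ 6 \<le> 1 ^ 6"
    using c y by (intro power_mono) auto
  moreover have "exp (- (c * y / 6)) ^ 6 = exp (- (c * y))"
    by (simp flip: exp_of_nat_mult)
  ultimately have "(c * y / 6) ^ 6 * exp (- (c * y)) \<le> 1"
    by (simp only: power_mult_distrib[of "c * y / 6" "exp (- (c * y / 6))"] power_one)
  then have "y ^ 6 * exp (- (c * y)) \<le> (6 / c) ^ 6"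
    using c by (simp add: power_divide power_mult_distrib field_simps)
  then have "y ^ 6 * exp (- (c * y)) * (exp c * inverse (y\<^sup>2)) \<le> (6 / c) ^ 6 * (exp c * inverse (y\<^sup>2))"
    by (rule mult_right_mono) simp
  also have "y ^ 6 * exp (- (c * y)) * (exp c * inverse (y\<^sup>2)) = y ^ 4 * exp (- c * real n)"
  proof -
    have "y ^ 6 = y ^ 4 * y\<^sup>2" by (simp flip: power_add)
    moreover have "exp (- (c * y)) * exp c = exp (- c * real n)"
      by (simp add: y_def algebra_simps flip: exp_add)
    ultimately show ?thesis using y by (simp add: field_simps)
  qed
  finally show "norm ((1 + real n) ^ 4 * exp (- c * real n)) \<le> exp c * (6 / c) ^ 6 * inverse ((real (Suc n))\<^sup>2)"
    by (simp add: y_def mult_ac add_ac)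
qed

section \<open>A forward solution with infinite initial norm\<close>

lemma has_derivative_suminf:
  fixes h h' :: "nat \<Rightarrow> real \<Rightarrow> real"
  assumes S: "open S" "convex S" and x: "x \<in> S"
    and der: "\<And>n x. x \<in> S \<Longrightarrow> (h n has_real_derivative h' n x) (at x)"
    and h: "\<And>n x. x \<in> S \<Longrightarrow> \<bar>h n x\<bar> \<le> M n"
    and h': "\<And>n x. x \<in> S \<Longrightarrow> \<bar>h' n x\<bar> \<le> M n" and M: "summable M"
  shows "((\<lambda>x. \<Sum>n. h n x) has_real_derivative (\<Sum>n. h' n x)) (at x)"
proof (rule has_field_derivative_series'(2)[OF S(2)])
  have "uniform_limit S (\<lambda>n x. \<Sum>i<n. h' i x) (\<lambda>x. \<Sum>n. h' n x) sequentially"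
    by (rule Weierstrass_m_test[OF _ M]) (use h' in auto)
  then show "uniformly_convergent_on S (\<lambda>n x. \<Sum>i<n. h' i x)"
    by (rule uniformly_convergentI)
  show "summable (\<lambda>n. h n x)"
    by (rule summable_comparison_test'[OF M, of 0]) (use h[OF x] in auto)
  show "x \<in> interior S" using S x by (simp add: interior_open)
  show "(h n has_real_derivative h' n y) (at y within S)" if "y \<in> S" for n y
    using der[OF that] by (rule has_field_derivative_at_within)
qed (fact x)

text \<open>The smooth forward solution with infinite initial norm. The exponential decay of the coefficients at
positive times justifies all termwise differentiations, and Bessel's inequality reduces the growth of
the norm as \<open>t\<close> tends to 0 to the convergence of finitely many coefficients at a time.\<close>

lemma singular_heat_solution:
  assumes L: "L > 0"
  obtains \<tau> :: real and B Bt Bx Bxx :: "real \<Rightarrow> real \<Rightarrow> real"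
  where "0 < \<tau>"
    and "\<And>t x. 0 < t \<Longrightarrow> t < \<tau> \<Longrightarrow> ((\<lambda>s. B s x) has_real_derivative Bt t x) (at t)"
    and "\<And>t x. 0 < t \<Longrightarrow> t < \<tau> \<Longrightarrow> (B t has_real_derivative Bx t x) (at x)"
    and "\<And>t x. 0 < t \<Longrightarrow> t < \<tau> \<Longrightarrow> (Bx t has_real_derivative Bxx t x) (at x)"
    and "\<And>v. v \<in> {B, Bt, Bx, Bxx} \<Longrightarrow> continuous_on ({0<..<\<tau>} \<times> UNIV) (\<lambda>(t, x). v t x)"
    and "\<And>t x. 0 < t \<Longrightarrow> t < \<tau> \<Longrightarrow> Bt t x = Bxx t x + B t x - B t x ^ 3"
    and "\<And>t. B t 0 = 0" "\<And>t. B t L = 0"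
    and "filterlim (\<lambda>t. integral {0..L} (\<lambda>x. (B t x)\<^sup>2)) at_top (at_right 0)"
proof -
  define k where "k = pi / L"
  have k: "k > 0" using L by (simp add: k_def)
  define \<mu> where "\<mu> = k\<^sup>2"
  have mu: "\<mu> > 0" using k by (simp add: \<mu>_def)
  interpret rough_data \<mu> by standard (fact mu)
  obtain \<tau>0 R a where tau0: "0 < \<tau>0"
    and der0: "\<And>t n. 0 < t \<Longrightarrow> t < \<tau>0 \<Longrightarrow>
      ((\<lambda>t. a t n) has_real_derivative (1 - \<mu> * (real_of_int n)\<^sup>2) * a t n + cube (a t) n) (at t)"
    and bound0: "\<And>t n. 0 < t \<Longrightarrow> t < \<tau>0 \<Longrightarrow> \<bar>a t n\<bar> \<le> R * t powr (-3/10) * exp_weight (\<mu> * t / 2) n"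
    and odd0: "\<And>t n. 0 < t \<Longrightarrow> t < \<tau>0 \<Longrightarrow> a t (- n) = - a t n"
    and lim: "\<And>n. ((\<lambda>t. a t n) \<longlongrightarrow> init_coeff n) (at_right 0)"
    by (rule rough_solution) blast
  \<comment> \<open>Halving the interval makes the coefficients admissible paths up to and including its right end.\<close>
  define \<tau> where "\<tau> = \<tau>0 / 2"
  have tau: "0 < \<tau>" "\<And>t. t \<le> \<tau> \<Longrightarrow> t < \<tau>0" using tau0 by (auto simp: \<tau>_def)
  have R: "R \<ge> 0"
  proof -
    have "0 \<le> R * \<tau> powr (-3/10)"
      using exp_weight_bound_nonneg[OF bound0[of \<tau> 0]] tau by simp
    then show ?thesis using tau by (simp add: zero_le_mult_iff)
  qed
  have cont_a: "continuous_on {0<..\<tau>} (\<lambda>t. a t n)" for n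
    using der0 tau by (intro continuous_at_imp_continuous_on ballI DERIV_isCont) auto
  have adm: "admissible \<tau> R a"
    unfolding admissible_def using cont_a bound0 tau by (auto simp: path_weight_def mult.assoc)
  have cont_cube: "continuous_on {0<..\<tau>} (\<lambda>t. cube (a t) n)" for n
    by (rule cube_path_continuous[OF adm])

  \<comment> \<open>By oddness the modes \<open>n\<close> and \<open>- n\<close> contribute equally, hence the factor 2.\<close>
  define f where "f n t = 2 * a t (int n)" for n t
  define g where "g n t = 2 * ((1 - \<mu> * (real n)\<^sup>2) * a t (int n) + cube (a t) (int n))" for n t
  define A1 where "A1 \<delta> = R * \<delta> powr (-3/10)" for \<delta> :: real
  define A2 where "A2 \<delta> = conv_const\<^sup>2 * R ^ 3 * \<delta> powr (-9/10)" for \<delta> :: real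
  define D where "D \<delta> = 2 * ((1 + k + \<mu>) * A1 \<delta> + A2 \<delta>)" for \<delta>
  define E where "E \<delta> n = exp (- (\<mu> * \<delta> / 2) * real n)" for \<delta> and n :: nat
  \<comment> \<open>One majorant, valid for \<open>t \<ge> \<delta>\<close>, dominates the series and all derivatives that are needed.\<close>
  define M where "M \<delta> n = D \<delta> * ((1 + real n) ^ 4 * E \<delta> n)" for \<delta> and n :: nat
  have summM: "summable (M \<delta>)" if "0 < \<delta>" for \<delta>
    unfolding M_def E_def by (intro summable_mult summable_poly_exp) (use mu that in simp)
  have A: "A1 \<delta> \<ge> 0" "A2 \<delta> \<ge> 0" for \<delta> using R by (auto simp: A1_def A2_def)
  have a_bd: "\<bar>a t (int n)\<bar> \<le> A1 \<delta> * E \<delta> n" and c_bd: "\<bar>cube (a t) (int n)\<bar> \<le> A2 \<delta> * E \<delta> n"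
    if t: "0 < \<delta>" "\<delta> \<le> t" "t < \<tau>" for \<delta> t n
  proof -
    have t0: "0 < t" "t < \<tau>0" using t tau(2)[of t] by auto
    have w: "exp_weight (\<mu> * t / 2) (int n) \<le> E \<delta> n"
    proof -
      have "\<mu> * \<delta> / 2 * real n \<le> \<mu> * t / 2 * real n" using mu t by (intro mult_right_mono) auto
      then have "poly_weight (int n) * exp (- (\<mu> * t / 2) * real n) \<le> 1 * exp (- (\<mu> * \<delta> / 2) * real n)"
        using poly_weight_pos[of "int n"] poly_weight_le_1[of "int n"] by (intro mult_mono) auto
      then show ?thesis by (simp add: exp_weight_def E_def)
    qed
    have "\<bar>a t (int n)\<bar> \<le> R * t powr (-3/10) * exp_weight (\<mu> * t / 2) (int n)" by (rule bound0[OF t0])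
    also have "\<dots> \<le> R * \<delta> powr (-3/10) * E \<delta> n"
      using t R w exp_weight_pos[of "\<mu> * t / 2" "int n"] by (intro mult_mono mult_left_mono powr_mono2') auto
    finally show "\<bar>a t (int n)\<bar> \<le> A1 \<delta> * E \<delta> n" by (simp add: A1_def)
    have "\<bar>cube (a t) (int n)\<bar> \<le> conv_const\<^sup>2 * R ^ 3 * t powr (-9/10) * exp_weight (\<mu> * t / 2) (int n)"
      by (rule cube_path_bound[OF t0(1)]) (use bound0[OF t0] in \<open>simp add: path_weight_def mult.assoc\<close>)
    also have "\<dots> \<le> conv_const\<^sup>2 * R ^ 3 * \<delta> powr (-9/10) * E \<delta> n"
      using t R w exp_weight_pos[of "\<mu> * t / 2" "int n"] by (intro mult_mono mult_left_mono powr_mono2') auto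
    finally show "\<bar>cube (a t) (int n)\<bar> \<le> A2 \<delta> * E \<delta> n" by (simp add: A2_def)
  qed
  have poly: "1 \<le> (1 + real n) ^ 4" "real n \<le> (1 + real n) ^ 4" "(real n)\<^sup>2 \<le> (1 + real n) ^ 4" for n
  proof -
    have "(1 + real n) ^ 1 \<le> (1 + real n) ^ 4" by (intro power_increasing) auto
    then show "1 \<le> (1 + real n) ^ 4" "real n \<le> (1 + real n) ^ 4" by auto
    have "(real n)\<^sup>2 \<le> (1 + real n)\<^sup>2" by (intro power_mono) auto
    also have "\<dots> \<le> (1 + real n) ^ 4" by (intro power_increasing) auto
    finally show "(real n)\<^sup>2 \<le> (1 + real n) ^ 4" .
  qed
  have f_bd: "\<bar>f n t\<bar> \<le> M \<delta> n" "\<bar>f n t * (real n * k)\<bar> \<le> M \<delta> n" "\<bar>f n t * (real n * k)\<^sup>2\<bar> \<le> M \<delta> n"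
    and g_bd: "\<bar>g n t\<bar> \<le> M \<delta> n" if t: "0 < \<delta>" "\<delta> \<le> t" "t < \<tau>" for \<delta> t n
  proof -
    define P where "P = (1 + real n) ^ 4"
    have P: "1 \<le> P" "real n \<le> P" "(real n)\<^sup>2 \<le> P" using poly[of n] by (auto simp: P_def)
    have E: "E \<delta> n > 0" by (simp add: E_def)
    have fA: "\<bar>f n t\<bar> \<le> 2 * A1 \<delta> * E \<delta> n" using a_bd[OF t, of n] by (simp add: f_def abs_mult)
    have gen: "\<bar>f n t * q\<bar> \<le> M \<delta> n" if q: "0 \<le> q" "q \<le> (1 + k + \<mu>) * P" for q
    proof -
      have "\<bar>f n t * q\<bar> \<le> (2 * A1 \<delta> * E \<delta> n) * ((1 + k + \<mu>) * P)"
        unfolding abs_mult using fA q A E by (intro mult_mono) auto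
      also have "\<dots> = 2 * ((1 + k + \<mu>) * A1 \<delta>) * (P * E \<delta> n)" by (simp only: mult_ac)
      also have "\<dots> \<le> D \<delta> * (P * E \<delta> n)"
        using A P E by (intro mult_right_mono) (auto simp: D_def)
      finally show ?thesis by (simp add: M_def P_def)
    qed
    have "1 * 1 \<le> (1 + k + \<mu>) * P" using k mu P by (intro mult_mono) auto
    then show "\<bar>f n t\<bar> \<le> M \<delta> n" using gen[of 1] by simp
    have "k * real n \<le> (1 + k + \<mu>) * P" using k mu P by (intro mult_mono) auto
    then show "\<bar>f n t * (real n * k)\<bar> \<le> M \<delta> n" using k by (intro gen) (auto simp: mult.commute)
    have m1: "\<mu> * (real n)\<^sup>2 \<le> (1 + k + \<mu>) * P" using k mu P by (intro mult_mono) auto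
    then show "\<bar>f n t * (real n * k)\<^sup>2\<bar> \<le> M \<delta> n"
      using k by (intro gen) (auto simp: \<mu>_def power_mult_distrib mult.commute)
    have "\<bar>1 - \<mu> * (real n)\<^sup>2\<bar> \<le> 1 + \<mu> * (real n)\<^sup>2"
      using mult_nonneg_nonneg[OF less_imp_le[OF mu] zero_le_power2[of "real n"]] by linarith
    also have "\<dots> \<le> 1 * P + \<mu> * P" using mu P by (intro add_mono mult_left_mono) auto
    also have "\<dots> \<le> (1 + k + \<mu>) * P" using k P by (simp add: algebra_simps)
    finally have n1: "\<bar>1 - \<mu> * (real n)\<^sup>2\<bar> \<le> (1 + k + \<mu>) * P" .
    have "\<bar>g n t\<bar> = 2 * \<bar>(1 - \<mu> * (real n)\<^sup>2) * a t (int n) + cube (a t) (int n)\<bar>"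
      unfolding g_def abs_mult[of 2] by simp
    also have "\<dots> \<le> 2 * (\<bar>1 - \<mu> * (real n)\<^sup>2\<bar> * \<bar>a t (int n)\<bar> + \<bar>cube (a t) (int n)\<bar>)"
      by (intro mult_left_mono order_trans[OF abs_triangle_ineq]) (auto simp: abs_mult)
    also have "\<dots> \<le> 2 * ((1 + k + \<mu>) * P * (A1 \<delta> * E \<delta> n) + P * (A2 \<delta> * E \<delta> n))"
    proof (intro mult_left_mono add_mono mult_mono n1 a_bd[OF t])
      have "A2 \<delta> * E \<delta> n * 1 \<le> A2 \<delta> * E \<delta> n * P"
        using A E P by (intro mult_left_mono) auto
      then show "\<bar>cube (a t) (int n)\<bar> \<le> P * (A2 \<delta> * E \<delta> n)"
        using c_bd[OF t, of n] by (simp add: mult.commute)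
    qed (use k mu P in auto)
    also have "\<dots> = D \<delta> * (P * E \<delta> n)" by (simp only: D_def distrib_left distrib_right mult_ac)
    finally show "\<bar>g n t\<bar> \<le> M \<delta> n" by (simp add: M_def P_def)
  qed
  have f_der: "(f n has_real_derivative g n t) (at t)" if "0 < t" "t < \<tau>" for n t
    unfolding f_def g_def using der0[of t "int n"] tau(2)[of t] that
    by (auto intro!: derivative_eq_intros)
  have cont_f: "continuous_on {0<..<\<tau>} (f n)" for n
    unfolding f_def by (intro continuous_intros continuous_on_subset[OF cont_a]) auto
  have cont_g: "continuous_on {0<..<\<tau>} (g n)" for n
    unfolding g_def
    by (intro continuous_intros continuous_on_subset[OF cont_a] continuous_on_subset[OF cont_cube]) auto

  define B where "B t x = (\<Sum>n. f n t * sin (real n * (k * x)))" for t x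
  define Bt where "Bt t x = (\<Sum>n. g n t * sin (real n * (k * x)))" for t x
  define Bx where "Bx t x = (\<Sum>n. f n t * (real n * k) * cos (real n * (k * x)))" for t x
  define Bxx where "Bxx t x = (\<Sum>n. - (f n t * (real n * k)\<^sup>2) * sin (real n * (k * x)))" for t x
  have le_mult: "\<bar>u * v\<bar> \<le> m" if "\<bar>u\<bar> \<le> m" "\<bar>v\<bar> \<le> 1" for u v m :: real
    using mult_mono[OF that] that by (simp add: abs_mult)
  have term_bd:
    "\<bar>f n t * sin (real n * (k * x))\<bar> \<le> M \<delta> n"
    "\<bar>g n t * sin (real n * (k * x))\<bar> \<le> M \<delta> n"
    "\<bar>f n t * (real n * k) * cos (real n * (k * x))\<bar> \<le> M \<delta> n"
    "\<bar>- (f n t * (real n * k)\<^sup>2) * sin (real n * (k * x))\<bar> \<le> M \<delta> n"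
    if "0 < \<delta>" "\<delta> \<le> t" "t < \<tau>" for \<delta> n t x
    by (rule le_mult; use f_bd[OF that, of n] g_bd[OF that, of n] in simp)+
  have cont_fst: "continuous_on ({0<..<\<tau>} \<times> UNIV) (\<lambda>p. q (fst p))"
    if "continuous_on {0<..<\<tau>} q" for q :: "real \<Rightarrow> real"
    by (rule continuous_on_compose2[OF that continuous_on_fst[OF continuous_on_id]]) auto
  show thesis
  proof (rule that[OF tau(1)])
    fix t x :: real assume t: "0 < t" "t < \<tau>"
    note bd = term_bd[of t t, OF t(1) order_refl t(2)]
    show "((\<lambda>s. B s x) has_real_derivative Bt t x) (at t)"
      unfolding B_def Bt_def
    proof (rule has_derivative_suminf[of "{t/2<..<\<tau>}" t _ _ "M (t/2)"])
      fix n s assume "s \<in> {t/2<..<\<tau>}"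
      then have s: "0 < s" "t/2 \<le> s" "s < \<tau>" using t by auto
      show "((\<lambda>s. f n s * sin (real n * (k * x))) has_real_derivative g n s * sin (real n * (k * x))) (at s)"
        by (rule DERIV_cmult_right[OF f_der]) (use s in auto)
      show "\<bar>f n s * sin (real n * (k * x))\<bar> \<le> M (t/2) n" "\<bar>g n s * sin (real n * (k * x))\<bar> \<le> M (t/2) n"
        using term_bd(1,2)[of "t/2" s] s t by auto
    qed (use t summM[of "t/2"] in auto)
    show "(B t has_real_derivative Bx t x) (at x)"
      unfolding B_def Bx_def
    proof (rule has_derivative_suminf[of UNIV x _ _ "M t"])
      fix n y
      show "((\<lambda>y. f n t * sin (real n * (k * y))) has_real_derivative
          f n t * (real n * k) * cos (real n * (k * y))) (at y)"
        by (auto intro!: derivative_eq_intros)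
    qed (use bd summM[OF t(1)] in auto)
    show "(Bx t has_real_derivative Bxx t x) (at x)"
      unfolding Bx_def Bxx_def
    proof (rule has_derivative_suminf[of UNIV x _ _ "M t"])
      fix n y
      show "((\<lambda>y. f n t * (real n * k) * cos (real n * (k * y))) has_real_derivative
          - (f n t * (real n * k)\<^sup>2) * sin (real n * (k * y))) (at y)"
        by (auto intro!: derivative_eq_intros simp: power2_eq_square)
      show "\<bar>f n t * (real n * k) * cos (real n * (k * y))\<bar> \<le> M t n"
        "\<bar>- (f n t * (real n * k)\<^sup>2) * sin (real n * (k * y))\<bar> \<le> M t n"
        by (rule bd)+
    qed (use summM[OF t(1)] in auto)
    have bQ: "\<bar>a t n\<bar> \<le> (R * t powr (-3/10)) * exp_weight 0 n" for n
    proof -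
      have "R * t powr (-3/10) * exp_weight (\<mu> * t / 2) n \<le> R * t powr (-3/10) * poly_weight n"
        using R mu t by (intro mult_left_mono exp_weight_le_poly_weight) auto
      then show ?thesis using bound0[of t n] t tau(2)[of t] by (simp add: exp_weight_def)
    qed
    have odd: "a t (- n) = - a t n" for n using odd0[of t n] t tau(2)[of t] by simp
    have sine_sums: "(\<lambda>n. 2 * (c (int n) * sin (real_of_int (int n) * (k * x)))) sums
        (\<Sum>\<^sub>\<infinity>n. c n * sin (real_of_int n * (k * x)))"
      if c: "\<And>n. \<bar>c n\<bar> \<le> \<gamma> * exp_weight 0 n" and co: "\<And>n. c (- n) = - c n" for c \<gamma>
    proof (rule infsum_even_int)
      show "(\<lambda>n. norm (c n * sin (real_of_int n * (k * x)))) summable_on UNIV"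
      proof (rule Infinite_Sum.abs_summable_on_comparison_test'[OF poly_weight_bound_abs_summable[OF c]])
        fix n show "norm (c n * sin (real_of_int n * (k * x))) \<le> norm (c n)"
          by (simp add: abs_mult mult_left_le)
      qed
    qed (simp_all add: co)
    have B_sums: "(\<lambda>n. f n t * sin (real n * (k * x))) sums (\<Sum>\<^sub>\<infinity>n. a t n * sin (real_of_int n * (k * x)))"
      using sine_sums[OF bQ odd] by (simp add: f_def mult.assoc)
    have cube_sums: "(\<lambda>n. 2 * (cube (a t) (int n) * sin (real n * (k * x)))) sums
        (\<Sum>\<^sub>\<infinity>n. cube (a t) n * sin (real_of_int n * (k * x)))"
    proof -
      have "\<bar>cube (a t) n\<bar> \<le> (conv_const\<^sup>2 * (R * t powr (-3/10)) ^ 3) * exp_weight 0 n" for n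
        by (rule cube_bound[OF order_refl bQ])
      moreover have "cube (a t) (- n) = - cube (a t) n" for n
        by (rule cube_odd) (rule odd)
      ultimately show ?thesis
        using sine_sums[of "cube (a t)" "conv_const\<^sup>2 * (R * t powr (-3/10)) ^ 3"] by simp
    qed
    have "(\<Sum>\<^sub>\<infinity>n. cube (a t) n * sin (real_of_int n * (k * x))) = - (B t x ^ 3)"
      unfolding B_def sums_unique[OF B_sums, symmetric] by (rule sine_sum_cube[OF bQ odd])
    with cube_sums have C: "(\<lambda>n. 2 * (cube (a t) (int n) * sin (real n * (k * x)))) sums - (B t x ^ 3)"
      by simp
    have "(\<lambda>n. - (f n t * (real n * k)\<^sup>2) * sin (real n * (k * x))) sums Bxx t x"
      unfolding Bxx_def
      by (rule summable_sums, rule summable_comparison_test'[OF summM[OF t(1)], of 0])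
         (use bd(4) in auto)
    moreover have "(\<lambda>n. f n t * sin (real n * (k * x))) sums B t x"
      unfolding B_def using sums_summable[OF B_sums] by (rule summable_sums)
    ultimately have "(\<lambda>n. - (f n t * (real n * k)\<^sup>2) * sin (real n * (k * x)) + f n t * sin (real n * (k * x))
        + 2 * (cube (a t) (int n) * sin (real n * (k * x)))) sums (Bxx t x + B t x + - (B t x ^ 3))"
      by (intro sums_add C)
    moreover have "- (f n t * (real n * k)\<^sup>2) * sin (real n * (k * x)) + f n t * sin (real n * (k * x))
        + 2 * (cube (a t) (int n) * sin (real n * (k * x))) = g n t * sin (real n * (k * x))" for n
      by (simp add: g_def f_def \<mu>_def power_mult_distrib algebra_simps)
    ultimately have "(\<lambda>n. g n t * sin (real n * (k * x))) sums (Bxx t x + B t x + - (B t x ^ 3))"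
      by (simp only:)
    then show "Bt t x = Bxx t x + B t x - B t x ^ 3"
      unfolding Bt_def by (simp add: sums_iff)
  next
    have "continuous_on ({0<..<\<tau>} \<times> UNIV) (\<lambda>(t, x). B t x)"
      unfolding B_def
      by (rule continuous_on_suminf_pair[OF _ summM term_bd(1)])
         (unfold case_prod_unfold, intro continuous_intros cont_fst cont_f)
    moreover have "continuous_on ({0<..<\<tau>} \<times> UNIV) (\<lambda>(t, x). Bt t x)"
      unfolding Bt_def
      by (rule continuous_on_suminf_pair[OF _ summM term_bd(2)])
         (unfold case_prod_unfold, intro continuous_intros cont_fst cont_g)
    moreover have "continuous_on ({0<..<\<tau>} \<times> UNIV) (\<lambda>(t, x). Bx t x)"
      unfolding Bx_def
      by (rule continuous_on_suminf_pair[OF _ summM term_bd(3)])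
         (unfold case_prod_unfold, intro continuous_intros cont_fst cont_f)
    moreover have "continuous_on ({0<..<\<tau>} \<times> UNIV) (\<lambda>(t, x). Bxx t x)"
      unfolding Bxx_def
      by (rule continuous_on_suminf_pair[OF _ summM term_bd(4)])
         (unfold case_prod_unfold, intro continuous_intros cont_fst cont_f)
    ultimately show "continuous_on ({0<..<\<tau>} \<times> UNIV) (\<lambda>(t, x). v t x)" if "v \<in> {B, Bt, Bx, Bxx}" for v
      using that by auto
  next
    show "B t 0 = 0" for t by (simp add: B_def)
    have "sin (real n * (k * L)) = 0" for n
      using L by (simp add: k_def)
    then show "B t L = 0" for t by (simp add: B_def)
  next
    show "filterlim (\<lambda>t. integral {0..L} (\<lambda>x. (B t x)\<^sup>2)) at_top (at_right 0)"
      unfolding filterlim_at_top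
    proof
      fix Z :: real
      have "\<exists>N. Z / (2 * L) < (\<Sum>n<N. inverse (real n))"
      proof (rule ccontr)
        assume "\<not> ?thesis"
        then have "summable (\<lambda>n. inverse (real n))"
          by (intro summableI_nonneg_bounded[of _ "Z / (2 * L)"]) (auto simp: not_less)
        then show False using not_summable_harmonic[where 'a = real] by simp
      qed
      then obtain N where "Z / (2 * L) < (\<Sum>n<N. inverse (real n))" by blast
      also have "\<dots> \<le> (\<Sum>n\<in>insert 0 {1..N}. inverse (real n))"
        by (intro sum_mono2) auto
      finally have N: "Z < 2 * L * (\<Sum>n\<in>{1..N}. inverse (real n))"
        using L by (simp add: field_simps)
      have b2: "(2 * init_coeff (int n))\<^sup>2 = 4 * inverse (real n)" if "n \<in> {1..N}" for n
      proof -
        have "(real n powr (-1/2))\<^sup>2 = real n powr (-1)"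
          unfolding power2_eq_square by (simp flip: powr_add)
        also have "\<dots> = inverse (real n)" using that by (simp add: powr_minus)
        finally have "(real n powr (-1/2))\<^sup>2 = inverse (real n)" .
        then show ?thesis using that by (simp add: init_coeff_def power_mult_distrib)
      qed
      have "((\<lambda>t. L / 2 * (\<Sum>n\<in>{1..N}. (f n t)\<^sup>2)) \<longlongrightarrow> L / 2 * (\<Sum>n\<in>{1..N}. (2 * init_coeff (int n))\<^sup>2)) (at_right 0)"
        unfolding f_def by (intro tendsto_intros lim)
      moreover have "L / 2 * (\<Sum>n\<in>{1..N}. (2 * init_coeff (int n))\<^sup>2) > Z"
      proof -
        have "(\<Sum>n\<in>{1..N}. (2 * init_coeff (int n))\<^sup>2) = (\<Sum>n\<in>{1..N}. 4 * inverse (real n))"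
          by (rule sum.cong[OF refl b2])
        also have "\<dots> = 4 * (\<Sum>n\<in>{1..N}. inverse (real n))" by (rule sum_distrib_left[symmetric])
        finally show ?thesis using N by simp
      qed
      ultimately have "\<forall>\<^sub>F t in at_right 0. L / 2 * (\<Sum>n\<in>{1..N}. (f n t)\<^sup>2) > Z"
        by (rule order_tendstoD)
      moreover have "\<forall>\<^sub>F t in at_right 0. t \<in> {0<..<\<tau>}"
        using tau by (intro eventually_at_rightI[of 0 \<tau>]) auto
      ultimately show "\<forall>\<^sub>F t in at_right 0. Z \<le> integral {0..L} (\<lambda>x. (B t x)\<^sup>2)"
      proof eventually_elim
        case (elim t)
        then have t: "0 < t" "t < \<tau>" by auto
        have summ: "summable (\<lambda>n. \<bar>f n t\<bar>)"
          by (rule summable_comparison_test'[OF summM[OF t(1)], of 0])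
             (use f_bd(1)[OF t(1) order_refl t(2)] in auto)
        have "continuous_on {0..L} (B t)"
        proof (rule continuous_at_imp_continuous_on, rule ballI)
          fix x
          have "(B t has_real_derivative Bx t x) (at x)"
            unfolding B_def Bx_def
          proof (rule has_derivative_suminf[of UNIV x _ _ "M t"])
            fix n y
            show "((\<lambda>y. f n t * sin (real n * (k * y))) has_real_derivative
                f n t * (real n * k) * cos (real n * (k * y))) (at y)"
              by (auto intro!: derivative_eq_intros)
          qed (use term_bd[of t t, OF t(1) order_refl t(2)] summM[OF t(1)] in auto)
          then show "isCont (B t) x" by (rule DERIV_isCont)
        qed
        then have "L / 2 * (\<Sum>n\<in>{1..N}. (f n t)\<^sup>2) \<le> integral {0..L} (\<lambda>x. (B t x)\<^sup>2)"
          unfolding B_def k_def by (intro bessel_sine[OF L summ])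
        with elim show ?case by simp
      qed
    qed
  qed
qed

section \<open>Blow-up\<close>

lemma filterlim_reflect_at_left: "filterlim (\<lambda>t::real. T - t) (at_right 0) (at_left T)"
  unfolding filterlim_at
proof
  show "\<forall>\<^sub>F t in at_left T. T - t \<in> {0<..} \<and> T - t \<noteq> 0"
    by (intro eventually_at_leftI[of "T - 1"]) auto
  have "((\<lambda>t. T - t) \<longlongrightarrow> T - T) (at_left T)" by (intro tendsto_intros)
  then show "((\<lambda>t. T - t) \<longlongrightarrow> 0) (at_left T)" by simp
qed

text \<open>Reverse time in the singular forward solution, taking \<open>\<phi> = 0\<close>, for which the second equation is
trivial: the infinite initial norm becomes blow-up at \<open>T0\<close>, and parabolic smoothing makes the reversed
solution classical, with smooth initial data.\<close>

lemma blowup_solution_exists: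
  assumes L: "L > 0"
  shows "\<exists>T0 A0 \<phi>0 A \<phi>. local_solution L D1 h (ereal T0) A0 \<phi>0 A \<phi> \<and> blows_up_at L A T0"
proof -
  obtain \<tau> B Bt Bx Bxx where tau: "0 < \<tau>"
    and Bt: "\<And>t x. 0 < t \<Longrightarrow> t < \<tau> \<Longrightarrow> ((\<lambda>s. B s x) has_real_derivative Bt t x) (at t)"
    and Bx: "\<And>t x. 0 < t \<Longrightarrow> t < \<tau> \<Longrightarrow> (B t has_real_derivative Bx t x) (at x)"
    and Bxx: "\<And>t x. 0 < t \<Longrightarrow> t < \<tau> \<Longrightarrow> (Bx t has_real_derivative Bxx t x) (at x)"
    and cont: "\<And>v. v \<in> {B, Bt, Bx, Bxx} \<Longrightarrow> continuous_on ({0<..<\<tau>} \<times> UNIV) (\<lambda>(t, x). v t x)"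
    and pde: "\<And>t x. 0 < t \<Longrightarrow> t < \<tau> \<Longrightarrow> Bt t x = Bxx t x + B t x - B t x ^ 3"
    and bc: "\<And>t. B t 0 = 0" "\<And>t. B t L = 0"
    and blowup: "filterlim (\<lambda>t. integral {0..L} (\<lambda>x. (B t x)\<^sup>2)) at_top (at_right 0)"
    by (rule singular_heat_solution[OF L]) blast
  define T0 where "T0 = \<tau> / 2"
  have T0: "0 < T0" "T0 < \<tau>" using tau by (auto simp: T0_def)
  define A where "A t x = complex_of_real (B (T0 - t) x)" for t x
  define \<phi> :: "real \<Rightarrow> real \<Rightarrow> real" where "\<phi> = (\<lambda>t x. 0)"
  have cont': "continuous_on ({0..<T0} \<times> UNIV) (\<lambda>p. v (T0 - fst p) (snd p))"
    if "v \<in> {B, Bt, Bx, Bxx}" for v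
  proof -
    have "continuous_on ({0..<T0} \<times> UNIV) (\<lambda>p. (\<lambda>(t, x). v t x) (T0 - fst p, snd p))"
      by (rule continuous_on_compose2[OF cont[OF that]]) (use T0 in \<open>auto intro!: continuous_intros\<close>)
    then show ?thesis by simp
  qed
  have C\<phi>: "C12_derivs L (ereal T0) \<phi> (\<lambda>t x. 0) (\<lambda>t x. 0) (\<lambda>t x. 0)"
    by (auto simp: C12_derivs_def \<phi>_def case_prod_unfold)
  have C: "C12_derivs L (ereal T0) A (\<lambda>t x. complex_of_real (- Bt (T0 - t) x))
      (\<lambda>t x. complex_of_real (Bx (T0 - t) x)) (\<lambda>t x. complex_of_real (Bxx (T0 - t) x))"
    unfolding C12_derivs_def
  proof (intro conjI allI impI ballI)
    fix t x assume "0 < t \<and> ereal t < ereal T0 \<and> x \<in> {0..L}"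
    then have t: "0 < T0 - t" "T0 - t < \<tau>" using T0 by auto
    have "((\<lambda>s. B (T0 - s) x) has_real_derivative Bt (T0 - t) x * (-1)) (at t)"
      by (rule DERIV_chain2[where f = "\<lambda>s. B s x" and g = "\<lambda>s. T0 - s", OF Bt[OF t]]) (auto intro!: derivative_eq_intros)
    then show "((\<lambda>s. A s x) has_vector_derivative complex_of_real (- Bt (T0 - t) x)) (at t)"
      unfolding A_def by (intro has_vector_derivative_of_real) simp
    show "(A t has_vector_derivative complex_of_real (Bx (T0 - t) x)) (at x within {0..L})"
      unfolding A_def
      by (intro has_vector_derivative_of_real has_field_derivative_at_within[OF Bx[OF t]])
    show "((\<lambda>y. complex_of_real (Bx (T0 - t) y)) has_vector_derivative complex_of_real (Bxx (T0 - t) x))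
        (at x within {0..L})"
      by (intro has_vector_derivative_of_real has_field_derivative_at_within[OF Bxx[OF t]])
  next
    fix v assume v: "v \<in> {A, \<lambda>t x. complex_of_real (- Bt (T0 - t) x),
      \<lambda>t x. complex_of_real (Bx (T0 - t) x), \<lambda>t x. complex_of_real (Bxx (T0 - t) x)}"
    let ?D = "{t. 0 < t \<and> ereal t < ereal T0} \<times> {0..L}"
    have sub: "?D \<subseteq> {0..<T0} \<times> UNIV" by auto
    note c = continuous_on_subset[OF cont' sub]
    show "continuous_on ?D (\<lambda>(t, x). v t x)"
      using v c[of B] c[of Bt] c[of Bx] c[of Bxx]
      by (auto simp: A_def case_prod_unfold intro!: continuous_intros)
  qed
  have contA: "continuous_on {0..L} (A t)" if "0 \<le> t" "t < T0" for t
  proof -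
    have "continuous_on {0..L} (\<lambda>x. (\<lambda>p. B (T0 - fst p) (snd p)) (t, x))"
      by (rule continuous_on_compose2[OF cont'[of B]]) (use that in \<open>auto intro!: continuous_intros\<close>)
    then show ?thesis unfolding A_def by (intro continuous_intros) simp
  qed
  have init: "((\<lambda>t. L2norm L (\<lambda>x. A t x - A 0 x)) \<longlongrightarrow> 0) (at_right 0)"
  proof -
    define F where "F t = integral (cbox 0 L) (\<lambda>x. (B (T0 - t) x - B T0 x)\<^sup>2)" for t
    have "continuous_on ({0..T0/2} \<times> cbox 0 L) (\<lambda>(t, x). (B (T0 - t) x - B T0 x)\<^sup>2)"
    proof -
      have sub: "{0..T0/2} \<times> cbox 0 L \<subseteq> {0..<T0} \<times> UNIV" using T0 by auto
      have "continuous_on ({0..T0/2} \<times> cbox 0 L) (\<lambda>p. (\<lambda>q. B (T0 - fst q) (snd q)) (0, snd p))"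
        by (rule continuous_on_compose2[OF cont'[of B]]) (use T0 in \<open>auto intro!: continuous_intros\<close>)
      then show ?thesis
        unfolding case_prod_unfold
        using continuous_on_subset[OF cont'[of B] sub] by (auto intro!: continuous_intros)
    qed
    then have "continuous_on {0..T0/2} F"
      unfolding F_def by (rule integral_continuous_on_param)
    then have "continuous (at 0 within {0..T0/2}) F"
      using T0 by (auto simp: continuous_on_eq_continuous_within)
    then have "(F \<longlongrightarrow> F 0) (at_right 0)"
      using T0 by (simp add: continuous_within at_within_Icc_at_right)
    then have "((\<lambda>t. sqrt (F t)) \<longlongrightarrow> sqrt (F 0)) (at_right 0)"
      by (rule tendsto_real_sqrt)
    moreover have "F 0 = 0" by (simp add: F_def)
    ultimately have "((\<lambda>t. sqrt (F t)) \<longlongrightarrow> 0) (at_right 0)" by simp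
    moreover have "\<forall>\<^sub>F t in at_right 0. sqrt (F t) = L2norm L (\<lambda>x. A t x - A 0 x)"
    proof -
      have "\<forall>\<^sub>F t in at_right 0. t \<in> {0<..<T0}"
        using T0 by (intro eventually_at_rightI[of 0 T0]) auto
      then show ?thesis
      proof eventually_elim
        case (elim t)
        have "continuous_on {0..L} (\<lambda>x. (cmod (A t x - A 0 x))\<^sup>2)"
          using elim T0 by (intro continuous_intros contA) auto
        moreover have "cmod (A t x - A 0 x) = \<bar>B (T0 - t) x - B T0 x\<bar>" for x
          unfolding A_def by (simp flip: of_real_diff)
        ultimately show ?case
          by (simp add: L2norm_def F_def set_integral_continuous_interior(2))
      qed
    qed
    ultimately show ?thesis by (rule Lim_transform_eventually)
  qed
  have "local_solution L D1 h (ereal T0) (A 0) (\<phi> 0) A \<phi>"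
    unfolding local_solution_def
  proof (intro conjI exI)
    show "in_L2 L (A 0)" using T0 by (intro in_L2_continuous contA) auto
    show "in_L2 L (\<phi> 0)" by (intro in_L2_continuous) (simp add: \<phi>_def)
    show "((\<lambda>t. L2norm L (\<lambda>x. \<phi> t x - \<phi> 0 x)) \<longlongrightarrow> 0) (at_right 0)"
      by (simp add: \<phi>_def L2norm_def)
    show "\<forall>t x. 0 < t \<and> ereal t < ereal T0 \<and> x \<in> {0<..<L} \<longrightarrow>
            complex_of_real (- Bt (T0 - t) x) + A t x + complex_of_real (Bxx (T0 - t) x)
              - complex_of_real ((\<phi> t x)\<^sup>2) * A t x = complex_of_real ((cmod (A t x))\<^sup>2) * A t x
          \<and> 0 + D1 * 0 - h * \<phi> t x + (cmod (A t x))\<^sup>2 * \<phi> t x = 0"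
    proof (intro allI impI)
      fix t x assume "0 < t \<and> ereal t < ereal T0 \<and> x \<in> {0<..<L}"
      then have t: "0 < T0 - t" "T0 - t < \<tau>" using T0 by auto
      have "- Bt (T0 - t) x + B (T0 - t) x + Bxx (T0 - t) x = (B (T0 - t) x)\<^sup>2 * B (T0 - t) x"
        unfolding pde[OF t] by (simp add: power2_eq_square power3_eq_cube)
      then have "complex_of_real (- Bt (T0 - t) x + B (T0 - t) x + Bxx (T0 - t) x)
          = complex_of_real ((B (T0 - t) x)\<^sup>2 * B (T0 - t) x)" by simp
      then show "complex_of_real (- Bt (T0 - t) x) + A t x + complex_of_real (Bxx (T0 - t) x)
              - complex_of_real ((\<phi> t x)\<^sup>2) * A t x = complex_of_real ((cmod (A t x))\<^sup>2) * A t x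
          \<and> 0 + D1 * 0 - h * \<phi> t x + (cmod (A t x))\<^sup>2 * \<phi> t x = 0"
        by (simp add: A_def \<phi>_def)
    qed
  qed (use T0 C C\<phi> init in \<open>auto simp: A_def \<phi>_def bc\<close>)
  moreover have "blows_up_at L A T0"
    unfolding blows_up_at_def
  proof -
    have "filterlim (\<lambda>t. integral {0..L} (\<lambda>x. (B (T0 - t) x)\<^sup>2)) at_top (at_left T0)"
      by (rule filterlim_compose[OF blowup filterlim_reflect_at_left])
    moreover have "\<forall>\<^sub>F t in at_left T0. integral {0..L} (\<lambda>x. (B (T0 - t) x)\<^sup>2) = Psi L A t"
    proof -
      have "\<forall>\<^sub>F t in at_left T0. t \<in> {0<..<T0}"
        using T0 by (intro eventually_at_leftI[of 0]) auto
      then show ?thesis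
      proof eventually_elim
        case (elim t)
        then have "Psi L A t = integral {0..L} (\<lambda>x. (cmod (A t x))\<^sup>2)"
          by (intro Psi_eq_integral contA) auto
        then show ?case by (simp add: A_def)
      qed
    qed
    ultimately show "filterlim (Psi L A) at_top (at_left T0)"
      by (simp cong: filterlim_cong)
  qed
  ultimately show ?thesis by blast
qed

text \<open>By monotonicity, exceeding a bound once means staying above it. The initial value, to which \<open>mono\<close> does
not apply, is excluded as a witness by asking to exceed it as well.\<close>

lemma blows_up_if_unbounded:
  assumes T0: "0 < T0" and mono: "\<And>s t. 0 < s \<Longrightarrow> s \<le> t \<Longrightarrow> t < T0 \<Longrightarrow> Psi L A s \<le> Psi L A t"
    and unb: "\<not> bdd_above (Psi L A ` {0..<T0})"
  shows "blows_up_at L A T0"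
  unfolding blows_up_at_def filterlim_at_top
proof
  fix Z :: real
  have "\<exists>s\<in>{0..<T0}. \<not> Psi L A s \<le> max Z (Psi L A 0)"
  proof (rule ccontr)
    assume "\<not> ?thesis"
    then have "bdd_above (Psi L A ` {0..<T0})"
      by (intro bdd_aboveI2[of _ _ "max Z (Psi L A 0)"]) blast
    with unb show False ..
  qed
  then obtain s where s: "0 \<le> s" "s < T0" "Psi L A s > max Z (Psi L A 0)" by (auto simp: not_le)
  then have "s \<noteq> 0" by auto
  with s have "s > 0" by simp
  have "\<forall>\<^sub>F t in at_left T0. t \<in> {s<..<T0}"
    using s by (intro eventually_at_leftI[of s]) auto
  then show "\<forall>\<^sub>F t in at_left T0. Z \<le> Psi L A t"
  proof eventually_elim
    case (elim t)
    then have "Psi L A s \<le> Psi L A t" using \<open>s > 0\<close> by (intro mono) auto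
    with s show ?case by simp
  qed
qed

theorem mainTheorem3:
  fixes L D1 h lam1 :: real
  assumes "L > 0" and "D1 > 0" and "h \<ge> 0"
    and "lam1 = first_dirichlet_eigenvalue L"
  shows
    "(\<exists>T0 A0 \<phi>0 A \<phi>. local_solution L D1 h (ereal T0) A0 \<phi>0 A \<phi> \<and> blows_up_at L A T0)
   \<and> (\<forall>T A0 \<phi>0 A \<phi>. local_solution L D1 h T A0 \<phi>0 A \<phi> \<longrightarrow>
        Psi L A 0 = (L2norm L A0)\<^sup>2
      \<and> (\<forall>t. 0 < t \<and> ereal t < T \<longrightarrow>
            Psi L A differentiable (at t)
          \<and> deriv (Psi L A) t \<ge> - 2 * Psi L A t + 2 * lam1 * Psi L A t + 2 / L * (Psi L A t)\<^sup>2)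
      \<and> (Psi L A 0 > (1 - lam1) * L \<and> Psi L A 0 > 0 \<longrightarrow>
            set_integrable lborel {Psi L A 0<..} (blowup_integrand L lam1)
          \<and> T \<le> ereal (LINT s:{Psi L A 0<..}|lborel. blowup_integrand L lam1 s)
          \<and> (maximal_with_continuation L D1 h T A0 \<phi>0 A \<phi> \<longrightarrow>
               (\<exists>T0. T = ereal T0
                  \<and> T0 \<le> (LINT s:{Psi L A 0<..}|lborel. blowup_integrand L lam1 s)
                  \<and> blows_up_at L A T0))))"
proof (rule conjI[OF blowup_solution_exists[OF assms(1)]], intro allI impI)
  note L = assms(1)
  have lam1: "lam1 = (pi / L)\<^sup>2" using assms(4) first_dirichlet_eigenvalue_eq[OF L] by simp
  fix T A0 \<phi>0 A \<phi> assume sol: "local_solution L D1 h T A0 \<phi>0 A \<phi>"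
  then obtain At Ax Axx \<phi>t \<phi>x \<phi>xx where
    C: "C12_derivs L T A At Ax Axx" and C\<phi>: "C12_derivs L T \<phi> \<phi>t \<phi>x \<phi>xx"
    and pde: "\<And>t x. 0 < t \<Longrightarrow> ereal t < T \<Longrightarrow> x \<in> {0<..<L} \<Longrightarrow>
        At t x + A t x + Axx t x - complex_of_real ((\<phi> t x)\<^sup>2) * A t x
          = complex_of_real ((cmod (A t x))\<^sup>2) * A t x"
    and bc: "\<And>t. 0 < t \<Longrightarrow> ereal t < T \<Longrightarrow> A t 0 = 0 \<and> A t L = 0"
    and T: "0 < T"
    unfolding local_solution_def by blast
  define D where "D t = integral {0..L} (\<lambda>x. 2 * (A t x \<bullet> At t x))" for t
  have der: "(Psi L A has_real_derivative D t) (at t)" if "0 < t" "ereal t < T" for t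
    unfolding D_def by (rule Psi_has_derivative[OF C that])
  have ineq: "D t \<ge> - 2 * Psi L A t + 2 * lam1 * Psi L A t + 2 / L * (Psi L A t)\<^sup>2"
    if "0 < t" "ereal t < T" for t
    unfolding D_def lam1 using bc[OF that]
    by (intro Psi_derivative_ge[OF L C C\<phi> that pde[OF that]]) auto
  have diff: "Psi L A differentiable (at t)
      \<and> deriv (Psi L A) t \<ge> - 2 * Psi L A t + 2 * lam1 * Psi L A t + 2 / L * (Psi L A t)\<^sup>2"
    if "0 < t" "ereal t < T" for t
    using der[OF that] ineq[OF that]
    by (auto simp: DERIV_imp_deriv real_differentiable_def)
  let ?I = "LINT s:{Psi L A 0<..}|lborel. blowup_integrand L lam1 s"
  have "set_integrable lborel {Psi L A 0<..} (blowup_integrand L lam1) \<and> T \<le> ereal ?I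
      \<and> (maximal_with_continuation L D1 h T A0 \<phi>0 A \<phi> \<longrightarrow>
           (\<exists>T0. T = ereal T0 \<and> T0 \<le> ?I \<and> blows_up_at L A T0))"
    if "Psi L A 0 > (1 - lam1) * L \<and> Psi L A 0 > 0"
  proof (intro conjI impI)
    note pos = that[THEN conjunct2] that[THEN conjunct1]
    note ode = riccati_blowup[OF L pos T Psi_tendsto_initial[OF sol] der ineq]
    show "set_integrable lborel {Psi L A 0<..} (blowup_integrand L lam1)"
      by (rule set_integrable_blowup_integrand[OF L pos])
    show le: "T \<le> ereal ?I" by (rule ode(1))
    assume max: "maximal_with_continuation L D1 h T A0 \<phi>0 A \<phi>"
    obtain T0 where T0: "T = ereal T0" using T le by (cases T) auto
    have eq: "{t. 0 \<le> t \<and> ereal t < T} = {0..<T0}" by (auto simp: T0)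
    have "\<not> bdd_above (Psi L A ` {0..<T0})"
      using max unfolding maximal_with_continuation_def eq by (auto simp: T0)
    then have "blows_up_at L A T0"
      by (rule blows_up_if_unbounded[rotated 2]) (use T ode(2) in \<open>auto simp: T0\<close>)
    with T0 le show "\<exists>T0. T = ereal T0 \<and> T0 \<le> ?I \<and> blows_up_at L A T0" by auto
  qed
  with Psi_zero[OF sol] diff
  show "Psi L A 0 = (L2norm L A0)\<^sup>2
      \<and> (\<forall>t. 0 < t \<and> ereal t < T \<longrightarrow>
            Psi L A differentiable (at t)
          \<and> deriv (Psi L A) t \<ge> - 2 * Psi L A t + 2 * lam1 * Psi L A t + 2 / L * (Psi L A t)\<^sup>2)
      \<and> (Psi L A 0 > (1 - lam1) * L \<and> Psi L A 0 > 0 \<longrightarrow>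
            set_integrable lborel {Psi L A 0<..} (blowup_integrand L lam1)
          \<and> T \<le> ereal ?I
          \<and> (maximal_with_continuation L D1 h T A0 \<phi>0 A \<phi> \<longrightarrow>
               (\<exists>T0. T = ereal T0 \<and> T0 \<le> ?I \<and> blows_up_at L A T0)))"
    by blast
qed

end
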